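(* The number of elements of $\mathcal{Q}$ with $2n$ faces is asymptotic to a positive fraction of the number of (rooted) 3-connected triangulations with $2n$ faces as $n\to\infty$. That is, if $q_n$ denotes the number of elements of $\mathcal{Q}$ with $2n$ faces and $t_n$ denotes the number of rooted 3-connected triangulations with $2n$ faces, then there is a constant $c>0$ such that $q_n/t_n\to c$ as $n\to\infty$.
   Context: A planar map is a 2-cell embedding of a connected graph in the plane. A triangulation is a planar map all of whose faces (including the external face) are triangles. All maps are rooted, i.e. in the usual sense of map enumeration: an edge of the external face is distinguished together with a direction along it, and maps are counted up to root-preserving isomorphism (orientation-preserving homeomorphism of the plane). In this setting, a triangulation is called 3-connected if it has no loops and no multiple edges. A triangulation with $2n$ faces (external face included) has $n+2$ vertices and $3n$ edges, $n\ge 1$. A separating 3-cycle of a triangulation is a 3-cycle with at least one vertex in its interior and at least one vertex in its exterior. $\mathcal{Q}$ is the set of all rooted 3-connected triangulations $T$ having a rooted 3-connected triangulation $T_1$ with $V(T_1)\ge 4$ vertices inside a 3-cycle $C$ of $T$ and a rooted 3-connected triangulation $T_2$ with $V(T_2)\ge 4$ vertices outside $C$, so that $C$ is a separating 3-cycle of $T$. Here $T_1$ consists of $C$ together with everything of $T$ inside $C$, and $T_2$ consists of $C$ together with everything of $T$ outside $C$, so $T_1$ and $T_2$ intersect exactly in $C$ and $V(T)=V(T_1)+V(T_2)-3$. It is not required that $T_1$ or $T_2$ have a separating 3-cycle. *)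

theory Defs
  imports Complex_Main "HOL-Combinatorics.Permutations" "HOL-Combinatorics.Orbits"
begin

text \<open>
  Planar maps are represented as rotation systems. A dart is an edge with a direction; \<open>opp\<close>
  reverses it, and \<open>rot\<close> sends it to the next dart counterclockwise around its initial vertex.
  Then \<open>rot \<circ> opp\<close> follows the boundary of the face to the right of a dart, so the vertices, edges
  and faces are the orbits of \<open>rot\<close>, \<open>opp\<close> and \<open>rot \<circ> opp\<close>. The map is a 2-cell embedding in the
  sphere iff it is connected and satisfies Euler's formula; choosing \<open>outer_face\<close> places it in
  the plane.
\<close>

record 'd plane_map =
  darts :: "'d set"
  rot :: "'d \<Rightarrow> 'd"
  opp :: "'d \<Rightarrow> 'd"
  outer_face :: "'d set"
  root_dart :: 'd

definition face_perm :: "'d plane_map \<Rightarrow> 'd \<Rightarrow> 'd" where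
  "face_perm M = rot M \<circ> opp M"

definition vertices :: "'d plane_map \<Rightarrow> 'd set set" where
  "vertices M = orbit (rot M) ` darts M"

definition edges :: "'d plane_map \<Rightarrow> 'd set set" where
  "edges M = orbit (opp M) ` darts M"

definition faces :: "'d plane_map \<Rightarrow> 'd set set" where
  "faces M = orbit (face_perm M) ` darts M"

definition tail :: "'d plane_map \<Rightarrow> 'd \<Rightarrow> 'd set" where
  "tail M d = orbit (rot M) d"

definition head :: "'d plane_map \<Rightarrow> 'd \<Rightarrow> 'd set" where
  "head M d = tail M (opp M d)"

definition connected_map :: "'d plane_map \<Rightarrow> bool" where
  "connected_map M \<longleftrightarrow>
    (\<forall>d\<in>darts M. \<forall>e\<in>darts M.
      (d, e) \<in> ({(x, rot M x) |x. x \<in> darts M} \<union> {(x, opp M x) |x. x \<in> darts M})\<^sup>*)"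

text \<open>
  The root is an edge of the outer face with an arbitrary direction along it, so the outer face may
  lie to its right or to its left. (Under the convention that it always lies to the right, all
  numbers of rooted maps considered here would be halved.)
\<close>

definition rooted_plane_map :: "'d plane_map \<Rightarrow> bool" where
  "rooted_plane_map M \<longleftrightarrow>
    finite (darts M) \<and>
    rot M permutes darts M \<and>
    opp M permutes darts M \<and>
    (\<forall>d\<in>darts M. opp M d \<noteq> d \<and> opp M (opp M d) = d) \<and>
    connected_map M \<and>
    card (vertices M) + card (faces M) = card (edges M) + 2 \<and>
    outer_face M \<in> faces M \<and>
    root_dart M \<in> darts M \<and>
    (root_dart M \<in> outer_face M \<or> opp M (root_dart M) \<in> outer_face M)"

definition rooted_triangulation :: "'d plane_map \<Rightarrow> bool" where
  "rooted_triangulation M \<longleftrightarrow> rooted_plane_map M \<and> (\<forall>F\<in>faces M. card F = 3)"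

definition no_loops :: "'d plane_map \<Rightarrow> bool" where
  "no_loops M \<longleftrightarrow> (\<forall>d\<in>darts M. tail M d \<noteq> head M d)"

definition no_multiple_edges :: "'d plane_map \<Rightarrow> bool" where
  "no_multiple_edges M \<longleftrightarrow>
    (\<forall>d\<in>darts M. \<forall>e\<in>darts M.
      {tail M d, head M d} = {tail M e, head M e} \<longrightarrow> e = d \<or> e = opp M d)"

definition three_connected_triangulation :: "'d plane_map \<Rightarrow> bool" where
  "three_connected_triangulation M \<longleftrightarrow>
    rooted_triangulation M \<and> no_loops M \<and> no_multiple_edges M"

text \<open>A 3-cycle is given by the six darts of its three edges.\<close>

definition is_3cycle :: "'d plane_map \<Rightarrow> 'd set \<Rightarrow> bool" where
  "is_3cycle M C \<longleftrightarrow>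
    (\<exists>a\<in>darts M. \<exists>b\<in>darts M. \<exists>c\<in>darts M.
      head M a = tail M b \<and> head M b = tail M c \<and> head M c = tail M a \<and>
      tail M a \<noteq> tail M b \<and> tail M b \<noteq> tail M c \<and> tail M c \<noteq> tail M a \<and>
      C = {a, b, c, opp M a, opp M b, opp M c})"

text \<open>
  A dart lies outside \<open>C\<close> if the face to its right does, i.e. if this face can be reached from the
  outer face without crossing an edge of \<open>C\<close>. Each edge of \<open>C\<close> has one dart on either side.
\<close>

definition outside_darts :: "'d plane_map \<Rightarrow> 'd set \<Rightarrow> 'd set" where
  "outside_darts M C =
    ({(x, face_perm M x) |x. x \<in> darts M} \<union> {(x, opp M x) |x. x \<in> darts M - C})\<^sup>* `` outer_face M"

definition inside_darts :: "'d plane_map \<Rightarrow> 'd set \<Rightarrow> 'd set" where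
  "inside_darts M C = darts M - outside_darts M C"

definition separating_3cycle :: "'d plane_map \<Rightarrow> 'd set \<Rightarrow> bool" where
  "separating_3cycle M C \<longleftrightarrow>
    is_3cycle M C \<and>
    (\<exists>v\<in>vertices M. v \<subseteq> inside_darts M C - C) \<and>
    (\<exists>v\<in>vertices M. v \<subseteq> outside_darts M C - C)"

text \<open>
  Deleting edges: the darts of \<open>S\<close> (a set closed under \<open>opp\<close>) are kept, with the cyclic order around
  each vertex induced by \<open>rot\<close>.
\<close>

definition next_in :: "('d \<Rightarrow> 'd) \<Rightarrow> 'd set \<Rightarrow> 'd \<Rightarrow> 'd" where
  "next_in f S x = (f ^^ (LEAST k. 0 < k \<and> (f ^^ k) x \<in> S)) x"

definition submap :: "'d plane_map \<Rightarrow> 'd set \<Rightarrow> 'd set \<Rightarrow> 'd \<Rightarrow> 'd plane_map" where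
  "submap M S F r =
    \<lparr>darts = S,
     rot = (\<lambda>d. if d \<in> S then next_in (rot M) S d else d),
     opp = (\<lambda>d. if d \<in> S then opp M d else d),
     outer_face = F,
     root_dart = r\<rparr>"

text \<open>
  The outer face of the inner part is bounded by \<open>C\<close>; its darts are those of \<open>C\<close> with the outside of
  \<open>C\<close> to their right. The outer part keeps the outer face of \<open>M\<close>.
\<close>

definition inner_part :: "'d plane_map \<Rightarrow> 'd set \<Rightarrow> 'd \<Rightarrow> 'd plane_map" where
  "inner_part M C r = submap M (inside_darts M C \<union> C) (outside_darts M C \<inter> C) r"

definition outer_part :: "'d plane_map \<Rightarrow> 'd set \<Rightarrow> 'd \<Rightarrow> 'd plane_map" where
  "outer_part M C r = submap M (outside_darts M C \<union> C) (outer_face M) r"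

definition Q :: "'d plane_map set" where
  "Q = {M. three_connected_triangulation M \<and>
    (\<exists>C. separating_3cycle M C \<and>
      (\<exists>r. three_connected_triangulation (inner_part M C r) \<and>
           4 \<le> card (vertices (inner_part M C r))) \<and>
      (\<exists>r. three_connected_triangulation (outer_part M C r) \<and>
           4 \<le> card (vertices (outer_part M C r))))}"

text \<open>
  Isomorphisms preserve the counterclockwise rotation, hence the orientation, and the outer face
  and root.
\<close>

definition rooted_iso :: "'d plane_map \<Rightarrow> 'e plane_map \<Rightarrow> bool" where
  "rooted_iso M N \<longleftrightarrow>
    (\<exists>f. bij_betw f (darts M) (darts N) \<and>
      (\<forall>d\<in>darts M. f (rot M d) = rot N (f d) \<and> f (opp M d) = opp N (f d)) \<and>
      f ` outer_face M = outer_face N \<and>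
      f (root_dart M) = root_dart N)"

definition num_up_to_iso :: "'d plane_map set \<Rightarrow> nat" where
  "num_up_to_iso A = card (A // {(M, N). M \<in> A \<and> N \<in> A \<and> rooted_iso M N})"

text \<open>Every finite map is isomorphic to one whose darts are natural numbers.\<close>

definition t :: "nat \<Rightarrow> nat" where
  "t n = num_up_to_iso
    {M :: nat plane_map. three_connected_triangulation M \<and> card (faces M) = 2 * n}"

definition q :: "nat \<Rightarrow> nat" where
  "q n = num_up_to_iso {M :: nat plane_map. M \<in> Q \<and> card (faces M) = 2 * n}"

end

theory Submission
  imports Defs
begin

text \<open>
The limit is 1: a triangulation with an interior vertex of degree 3 lies in \<open>Q\<close>, because the link of
that vertex is a separating 3-cycle, and triangulations without such a vertex are rare.

For the latter, let \<open>v\<close> be an interior vertex of degree \<open>d\<close> with \<open>4 \<le> d \<le> 11\<close>. By planarity, of any two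
consecutive edges at \<open>v\<close> one can be flipped without creating a multiple edge: otherwise there would be two
crossing chords between neighbours of \<open>v\<close>. Flipping successively edges at \<open>v\<close> reduces its degree to 3.
Starting from a triangulation without interior vertices of degree 3, the result has only boundedly
many vertices of degree 3, so that boundedly many pairs of a triangulation and a vertex \<open>v\<close> lead to it.
As every triangulation has linearly many vertices of degree at most 11, the proportion of
triangulations with \<open>2n\<close> faces and without interior vertices of degree 3 is \<open>O(1/n)\<close>.

Everything is counted for maps with a fixed set of darts: since rooted maps have no automorphisms,
this multiplies all numbers by the factorial of the number of darts.
\<close>

text \<open>Planarity is available only as Euler's formula for rotation systems. So even the fact
  that a 3-cycle has two sides is obtained by counting: edges that connect all vertices, together
  with disjoint edges whose duals connect all faces, number at least (V - 1) + (F - 1) = E. The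
  bound 11 comes from the degree sum 6n: at most n/2 of the n + 2 vertices have degree 12 or more,
  and at most three vertices are outer, so about n/2 candidates for v remain. Only interior vertices
  are used, since flips at them leave the outer face and the root untouched. The number of darts at
  vertices of degree 3 has to be tracked along the flips: it is at most 9 at the start and grows by
  at most 12 per flip, and it finally bounds the number of positions in which v can be marked. A
  limit of the quotient also presupposes that there are triangulations at all; double wheels provide
  them.\<close>

section \<open>Orbits and first-return maps of finite permutations\<close>

lemma card_image_eq_if_same_kernel:
  assumes "\<And>x y. x \<in> S \<Longrightarrow> y \<in> S \<Longrightarrow> f x = f y \<longleftrightarrow> g x = g y"
  shows "card (f ` S) = card (g ` S)"
proof -
  have fg: "(g \<circ> inv_into S f) (f x) = g x" if "x \<in> S" for x
    using that assms[of "inv_into S f (f x)" x] by (simp add: inv_into_into f_inv_into_f)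
  have "inj_on (g \<circ> inv_into S f) (f ` S)"
    using assms by (auto simp del: o_apply simp: inj_on_def fg)
  moreover have "(g \<circ> inv_into S f) ` f ` S = g ` S"
    unfolding image_image using fg by (intro image_cong) auto
  ultimately show ?thesis by (metis card_image)
qed

lemma orbit_in_permutes:
  assumes "f permutes D" "finite D"
  shows self_in_orbit: "x \<in> orbit f x"
    and orbit_eqI_in: "y \<in> orbit f x \<Longrightarrow> orbit f y = orbit f x"
    and orbit_step_eq: "orbit f (f x) = orbit f x"
proof -
  have p: "permutation f" using assms permutation_permutes by blast
  show "x \<in> orbit f x" using p by (rule permutation_self_in_orbit)
  show "orbit f (f x) = orbit f x" using p by (rule permutation_orbit_step)
  show "orbit f y = orbit f x" if "y \<in> orbit f x"
    using that cyclic_on_orbit'[OF p, of x] orbit_cyclic_eq3 by metis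
qed

lemma orbit_subset_closed:
  assumes "x \<in> X" "\<And>y. y \<in> X \<Longrightarrow> f y \<in> X"
  shows "orbit f x \<subseteq> X"
proof
  fix y assume "y \<in> orbit f x"
  then show "y \<in> X" by induction (use assms in auto)
qed

lemma orbit_of_period_3:
  assumes "f (f (f x)) = x"
  shows "orbit f x = {x, f x, f (f x)}"
proof
  show "orbit f x \<subseteq> {x, f x, f (f x)}"
    using orbit_subset_closed[of x "{x, f x, f (f x)}" f] assms by auto
  show "{x, f x, f (f x)} \<subseteq> orbit f x"
    using orbit.base[of f x] orbit.step[of _ f x] assms by (metis insertE singletonD subsetI)
qed

text \<open>For a finite permutation \<open>y\<close> is itself an iterate of \<open>f y\<close>, so
  forward invariance implies backward invariance. This is why connectedness can be expressed by sets
  closed under \<open>rot\<close> and \<open>opp\<close> alone.\<close>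

lemma closed_permutes_iff:
  assumes "f permutes D" "finite D" "X \<subseteq> D" "\<And>y. y \<in> X \<Longrightarrow> f y \<in> X"
  shows "f y \<in> X \<longleftrightarrow> y \<in> X"
proof
  assume "f y \<in> X"
  have "y \<in> orbit f (f y)"
    using orbit_in_permutes[OF assms(1,2)] by metis
  then show "y \<in> X" using orbit_subset_closed[of "f y" X f] \<open>f y \<in> X\<close> assms(4) by blast
qed (use assms in auto)

lemma next_in_in_orbit:
  assumes f: "f permutes D" "finite D" and x: "x \<in> S"
  shows "next_in f S x \<in> S" "next_in f S x \<in> orbit f x"
    and "\<exists>k>0. next_in f S x = (f ^^ k) x \<and> (\<forall>j. 0 < j \<longrightarrow> (f ^^ j) x \<in> S \<longrightarrow> k \<le> j)"
proof -
  have "x \<in> orbit f x" using orbit_in_permutes[OF f] by blast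
  then have "\<exists>k. 0 < k \<and> (f ^^ k) x \<in> S" using x unfolding orbit_altdef by auto
  then have k: "0 < (LEAST k. 0 < k \<and> (f ^^ k) x \<in> S) \<and>
    (f ^^ (LEAST k. 0 < k \<and> (f ^^ k) x \<in> S)) x \<in> S" by (rule LeastI_ex)
  then show "next_in f S x \<in> S" unfolding next_in_def by simp
  show "next_in f S x \<in> orbit f x" unfolding next_in_def orbit_altdef using k by blast
  have "\<forall>j. 0 < j \<longrightarrow> (f ^^ j) x \<in> S \<longrightarrow> (LEAST k. 0 < k \<and> (f ^^ k) x \<in> S) \<le> j"
    by (auto intro: Least_le)
  then show "\<exists>k>0. next_in f S x = (f ^^ k) x \<and> (\<forall>j. 0 < j \<longrightarrow> (f ^^ j) x \<in> S \<longrightarrow> k \<le> j)"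
    unfolding next_in_def using k by blast
qed

lemma next_in_eq:
  assumes "f x \<in> S"
  shows "next_in f S x = f x"
proof -
  have "(LEAST k. 0 < k \<and> (f ^^ k) x \<in> S) = 1"
    using assms by (intro Least_equality) auto
  then show ?thesis unfolding next_in_def by simp
qed

lemma next_in_skip:
  assumes "f x \<notin> S" "f (f x) \<in> S"
  shows "next_in f S x = f (f x)"
proof -
  have "(LEAST k. 0 < k \<and> (f ^^ k) x \<in> S) = 2"
  proof (rule Least_equality)
    fix k assume "0 < k \<and> (f ^^ k) x \<in> S"
    then show "2 \<le> k" using assms by (cases "k = 1") auto
  qed (use assms in \<open>auto simp: numeral_2_eq_2\<close>)
  then show ?thesis unfolding next_in_def by (simp add: numeral_2_eq_2)
qed

text \<open>Deleting edges neither merges nor splits the vertices that keep a dart. Both the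
  comparison of a map with its flip and the study of submaps rest on this.\<close>

lemma orbit_next_in:
  assumes f: "f permutes D" "finite D" and x: "x \<in> S"
  shows "orbit (next_in f S) x = orbit f x \<inter> S"
proof
  show "orbit (next_in f S) x \<subseteq> orbit f x \<inter> S"
  proof (rule order_trans[OF orbit_subset_closed[of x "orbit f x \<inter> S"]])
    show "x \<in> orbit f x \<inter> S" using x orbit_in_permutes[OF f] by blast
    fix y assume "y \<in> orbit f x \<inter> S"
    then show "next_in f S y \<in> orbit f x \<inter> S"
      using next_in_in_orbit(1,2)[OF f, of y S] orbit_eqI_in[OF f, of y x] by auto
  qed auto
  \<comment> \<open>Cut the path from \<open>z\<close> at its first return to \<open>S\<close> and
    apply the induction hypothesis to the remainder.\<close>
  have "(f ^^ k) z \<in> orbit (next_in f S) z" if "0 < k" "z \<in> S" "(f ^^ k) z \<in> S" for k z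
    using that
  proof (induction k arbitrary: z rule: less_induct)
    case (less k)
    obtain m where m: "0 < m" "next_in f S z = (f ^^ m) z" "m \<le> k"
      using next_in_in_orbit(3)[OF f, of z S] less.prems by blast
    show ?case
    proof (cases "m = k")
      case True
      then show ?thesis using m orbit.base[of "next_in f S" z] by simp
    next
      case False
      have "(f ^^ k) z = (f ^^ (k - m)) (next_in f S z)"
        using m by (metis comp_apply funpow_add le_add_diff_inverse2)
      moreover have "(f ^^ (k - m)) (next_in f S z) \<in> orbit (next_in f S) (next_in f S z)"
        using less.IH[of "k - m" "next_in f S z"] less.prems m False calculation
          next_in_in_orbit(1)[OF f, of z S] by auto
      ultimately show ?thesis using orbit_trans[OF _ orbit.base[of "next_in f S" z]] by metis
    qed
  qed
  then show "orbit f x \<inter> S \<subseteq> orbit (next_in f S) x"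
    unfolding orbit_altdef[of f] using x by blast
qed

text \<open>Each point of \<open>S\<close> lies on its own return orbit, so the first-return map is
  onto the finite set \<open>S\<close> and hence bijective.\<close>

lemma next_in_permutes:
  assumes f: "f permutes D" "finite D" and S: "S \<subseteq> D"
  shows "(\<lambda>d. if d \<in> S then next_in f S d else d) permutes S"
proof -
  let ?n = "next_in f S"
  have "S \<subseteq> ?n ` S"
  proof
    fix x assume x: "x \<in> S"
    have o: "orbit ?n x = orbit f x \<inter> S" by (rule orbit_next_in[OF f x])
    then have "x \<in> orbit ?n x" using x orbit_in_permutes[OF f] by blast
    then show "x \<in> ?n ` S" by cases (use x o in auto)
  qed
  moreover have "?n ` S \<subseteq> S" using next_in_in_orbit(1)[OF f] by auto
  ultimately have "?n ` S = S" by blast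
  moreover have "finite S" using S f(2) finite_subset by blast
  ultimately have "bij_betw ?n S S" unfolding bij_betw_def by (metis eq_card_imp_inj_on)
  then have "bij_betw (\<lambda>d. if d \<in> S then next_in f S d else d) S S"
    by (simp cong: bij_betw_cong)
  then show ?thesis by (rule bij_imp_permutes) auto
qed

lemma card_of_constant_fibres:
  assumes "finite A" "\<And>B. B \<in> P \<Longrightarrow> card B = k" "\<Union>P = A" "pairwise disjnt P"
  shows "card A = k * card P"
proof -
  have "\<And>B. B \<in> P \<Longrightarrow> finite B" using assms by (metis Union_upper finite_subset)
  then have "card A = sum card P" using assms(3,4) card_Union_disjoint by blast
  then show ?thesis using assms(2) by simp
qed

lemma disjoint_orbits:
  assumes "f permutes D" "finite D"
  shows "pairwise disjnt (orbit f ` D)" "\<Union>(orbit f ` D) = D"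
proof -
  show "pairwise disjnt (orbit f ` D)"
    unfolding pairwise_def disjnt_def using orbit_eqI_in[OF assms] by (auto, metis+)
  show "\<Union>(orbit f ` D) = D"
    using permutes_orbit_subset[OF assms(1)] orbit_in_permutes(1)[OF assms] by blast
qed

lemma orbit_involution:
  assumes "f (f x) = x"
  shows "orbit f x = {x, f x}"
proof
  show "orbit f x \<subseteq> {x, f x}"
    using orbit_subset_closed[of x "{x, f x}" f] assms by auto
  show "{x, f x} \<subseteq> orbit f x"
    using orbit.base[of f x] orbit.step[of _ f x] assms by (metis insertE singletonD subsetI)
qed

lemma card_orbit_period_3:
  assumes "f (f (f x)) = x" "f x \<noteq> x"
  shows "card (orbit f x) = 3"
proof -
  have "f (f x) \<noteq> x" "f (f x) \<noteq> f x" using assms by metis+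
  then show ?thesis using assms by (auto simp: orbit_of_period_3 card_insert_if)
qed

lemma period_3_of_card_orbit:
  assumes f: "f permutes D" "finite D" and c: "card (orbit f x) = 3"
  shows "f (f (f x)) = x" "f x \<noteq> x"
proof -
  show n1: "f x \<noteq> x" using c orbit_eq_singleton_iff[of f x] by auto
  show "f (f (f x)) = x"
  proof (rule ccontr)
    assume n3: "f (f (f x)) \<noteq> x"
    have n2: "f (f x) \<noteq> x" using c orbit_involution[of f x] n1 by auto
    have inj: "f a = f b \<longleftrightarrow> a = b" for a b using f(1) by (metis permutes_inj inj_eq)
    have "card {x, f x, f (f x), f (f (f x))} = 4" using n1 n2 n3 inj by auto
    moreover have "{x, f x, f (f x), f (f (f x))} \<subseteq> orbit f x"
      using orbit_in_permutes(1)[OF f, of x] by (auto intro: orbit.intros)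
    moreover have "finite (orbit f x)" using finite_orbit orbit_in_permutes(1)[OF f] by metis
    ultimately have "4 \<le> card (orbit f x)" by (metis card_mono)
    then show False using c by simp
  qed
qed

section \<open>Simple triangulations\<close>

text \<open>Connectedness without paths: a proof exhibits one nonempty invariant set and concludes
  that it contains every dart.\<close>

definition cut_connected :: "'d plane_map \<Rightarrow> bool" where
  "cut_connected M \<longleftrightarrow> (\<forall>X \<subseteq> darts M. X \<noteq> {} \<longrightarrow> (\<forall>d\<in>X. rot M d \<in> X) \<longrightarrow> (\<forall>d\<in>X. opp M d \<in> X) \<longrightarrow>
    X = darts M)"

lemma connected_map_iff_cut:
  assumes "finite (darts M)" "rot M permutes darts M" "opp M permutes darts M"
  shows "connected_map M \<longleftrightarrow> cut_connected M"
proof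
  let ?R = "{(x, rot M x) |x. x \<in> darts M} \<union> {(x, opp M x) |x. x \<in> darts M}"
  assume conn: "connected_map M"
  show "cut_connected M" unfolding cut_connected_def
  proof (intro allI impI)
    fix X assume X: "X \<subseteq> darts M" "X \<noteq> {}" "\<forall>d\<in>X. rot M d \<in> X" "\<forall>d\<in>X. opp M d \<in> X"
    then obtain d where d: "d \<in> X" by blast
    have "e \<in> X" if "e \<in> darts M" for e
    proof -
      have "(d, e) \<in> ?R\<^sup>*" using conn d X that unfolding connected_map_def by blast
      then show ?thesis by induction (use d X in auto)
    qed
    then show "X = darts M" using X by blast
  qed
next
  let ?R = "{(x, rot M x) |x. x \<in> darts M} \<union> {(x, opp M x) |x. x \<in> darts M}"
  assume conn: "cut_connected M"
  show "connected_map M" unfolding connected_map_def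
  proof (intro ballI)
    fix d e assume de: "d \<in> darts M" "e \<in> darts M"
    let ?X = "{x \<in> darts M. (d, x) \<in> ?R\<^sup>*}"
    have "rot M x \<in> ?X \<and> opp M x \<in> ?X" if "x \<in> ?X" for x
    proof -
      have "(x, rot M x) \<in> ?R" "(x, opp M x) \<in> ?R" using that by auto
      then show ?thesis using that permutes_in_image[OF assms(2), of x] permutes_in_image[OF assms(3), of x]
        by (blast intro: rtrancl_into_rtrancl)
    qed
    moreover have "d \<in> ?X" using de by simp
    ultimately have "?X = darts M"
      using conn[unfolded cut_connected_def, rule_format, of ?X] by blast
    then show "(d, e) \<in> ?R\<^sup>*" using de by blast
  qed
qed

text \<open>The working form of the definition. If all faces have size 3, there are |D|/2 edges and
  |D|/3 faces, so Euler's formula becomes V = |D|/6 + 2. In the absence of loops, multiple edges are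
  excluded by comparing darts with equal tails and equal heads.\<close>

lemma three_connected_triangulation_iff:
  "three_connected_triangulation M \<longleftrightarrow>
    finite (darts M) \<and> rot M permutes darts M \<and> opp M permutes darts M \<and>
    (\<forall>d\<in>darts M. opp M d \<noteq> d \<and> opp M (opp M d) = d) \<and>
    cut_connected M \<and>
    (\<forall>d\<in>darts M. face_perm M (face_perm M (face_perm M d)) = d \<and> face_perm M d \<noteq> d) \<and>
    6 * card (vertices M) = card (darts M) + 12 \<and>
    (\<exists>d\<in>darts M. outer_face M = {d, face_perm M d, face_perm M (face_perm M d)}) \<and>
    root_dart M \<in> darts M \<and>
    (root_dart M \<in> outer_face M \<or> opp M (root_dart M) \<in> outer_face M) \<and>
    (\<forall>d\<in>darts M. tail M d \<noteq> head M d) \<and>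
    (\<forall>d\<in>darts M. \<forall>e\<in>darts M. tail M d = tail M e \<longrightarrow> head M d = head M e \<longrightarrow> d = e)"
  (is "?L \<longleftrightarrow> ?R")
proof -
  let ?B = "finite (darts M) \<and> rot M permutes darts M \<and> opp M permutes darts M \<and>
    (\<forall>d\<in>darts M. opp M d \<noteq> d \<and> opp M (opp M d) = d)"
  have main: "?L \<longleftrightarrow> ?R" if B: ?B
  proof -
    have fin: "finite (darts M)" using B by blast
    have s: "rot M permutes darts M" "opp M permutes darts M" using B by blast+
    have p: "face_perm M permutes darts M" unfolding face_perm_def using B permutes_compose by blast
    have od: "opp M d \<in> darts M \<longleftrightarrow> d \<in> darts M" for d using s permutes_in_image by metis
    have face3: "(\<forall>F\<in>faces M. card F = 3) \<longleftrightarrow>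
      (\<forall>d\<in>darts M. face_perm M (face_perm M (face_perm M d)) = d \<and> face_perm M d \<noteq> d)"
      unfolding faces_def
      using card_orbit_period_3[of "face_perm M"] period_3_of_card_orbit[OF p fin] by auto
    have simple: "no_multiple_edges M \<longleftrightarrow>
      (\<forall>d\<in>darts M. \<forall>e\<in>darts M. tail M d = tail M e \<longrightarrow> head M d = head M e \<longrightarrow> d = e)"
      if "no_loops M"
    proof
      assume *: "no_multiple_edges M"
      show "\<forall>d\<in>darts M. \<forall>e\<in>darts M. tail M d = tail M e \<longrightarrow> head M d = head M e \<longrightarrow> d = e"
      proof (intro ballI impI)
        fix d e assume de: "d \<in> darts M" "e \<in> darts M" "tail M d = tail M e" "head M d = head M e"
        then have "e = d \<or> e = opp M d" using * unfolding no_multiple_edges_def by simp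
        moreover have "e \<noteq> opp M d" using de that B unfolding no_loops_def head_def by metis
        ultimately show "d = e" by simp
      qed
    next
      assume *: "\<forall>d\<in>darts M. \<forall>e\<in>darts M. tail M d = tail M e \<longrightarrow> head M d = head M e \<longrightarrow> d = e"
      show "no_multiple_edges M" unfolding no_multiple_edges_def
      proof (intro ballI impI)
        fix d e assume de: "d \<in> darts M" "e \<in> darts M" "{tail M d, head M d} = {tail M e, head M e}"
        then have "tail M e = tail M d \<and> head M e = head M d \<or> tail M e = tail M (opp M d) \<and> head M e = head M (opp M d)"
          using B unfolding head_def doubleton_eq_iff by metis
        then show "e = d \<or> e = opp M d" using * de od by metis
      qed
    qed
    have cE: "card (darts M) = 2 * card (edges M)"
      unfolding edges_def
      by (rule card_of_constant_fibres[OF fin _ disjoint_orbits(2)[OF s(2) fin] disjoint_orbits(1)[OF s(2) fin]])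
        (use B orbit_involution[of "opp M"] in auto)
    have cF: "card (darts M) = 3 * card (faces M)" if "\<forall>F\<in>faces M. card F = 3"
      unfolding faces_def
      by (rule card_of_constant_fibres[OF fin _ disjoint_orbits(2)[OF p fin] disjoint_orbits(1)[OF p fin]])
        (use that in \<open>auto simp: faces_def\<close>)
    have of3: "outer_face M \<in> faces M \<longleftrightarrow>
      (\<exists>d\<in>darts M. outer_face M = {d, face_perm M d, face_perm M (face_perm M d)})" if "\<forall>F\<in>faces M. card F = 3"
    proof -
      have "orbit (face_perm M) d = {d, face_perm M d, face_perm M (face_perm M d)}" if "d \<in> darts M" for d
        using \<open>\<forall>F\<in>faces M. card F = 3\<close> face3 that by (intro orbit_of_period_3) auto
      then show ?thesis unfolding faces_def by auto
    qed
    have euler: "card (vertices M) + card (faces M) = card (edges M) + 2 \<longleftrightarrow>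
      6 * card (vertices M) = card (darts M) + 12" if "\<forall>F\<in>faces M. card F = 3"
      using cE cF[OF that] by auto
    show ?thesis
      unfolding three_connected_triangulation_def rooted_triangulation_def rooted_plane_map_def
      using connected_map_iff_cut[OF fin s] face3 simple euler of3 unfolding no_loops_def by (smt (verit))
  qed
  show ?thesis
  proof (cases ?B)
    case False
    then show ?thesis
      unfolding three_connected_triangulation_def rooted_triangulation_def rooted_plane_map_def by blast
  qed (rule main)
qed

locale simple_triangulation =
  fixes M :: "'d plane_map"
  assumes triangulation: "three_connected_triangulation M"
begin

abbreviation "D \<equiv> darts M"
abbreviation "\<sigma> \<equiv> rot M"
abbreviation "\<alpha> \<equiv> opp M"
abbreviation "\<phi> \<equiv> face_perm M"

lemma triangulation_properties:
  shows fin: "finite D" and rot_permutes: "\<sigma> permutes D" and opp_permutes: "\<alpha> permutes D"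
    and opp_neq: "d \<in> D \<Longrightarrow> \<alpha> d \<noteq> d" and connectedness: "cut_connected M"
    and face3: "d \<in> D \<Longrightarrow> \<phi> (\<phi> (\<phi> d)) = d"
    and face_neq: "d \<in> D \<Longrightarrow> \<phi> d \<noteq> d"
    and euler: "6 * card (vertices M) = card D + 12"
    and outer: "\<exists>d\<in>D. outer_face M = {d, \<phi> d, \<phi> (\<phi> d)}"
    and root: "root_dart M \<in> D" "root_dart M \<in> outer_face M \<or> \<alpha> (root_dart M) \<in> outer_face M"
    and no_loop: "d \<in> D \<Longrightarrow> tail M d \<noteq> head M d"
    and simple: "d \<in> D \<Longrightarrow> e \<in> D \<Longrightarrow> tail M d = tail M e \<Longrightarrow> head M d = head M e \<Longrightarrow> d = e"
  using triangulation unfolding three_connected_triangulation_iff by blast+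

lemma opp_opp [simp]: "\<alpha> (\<alpha> d) = d"
  using triangulation unfolding three_connected_triangulation_iff permutes_def by metis

lemma face_eq: "\<phi> d = \<sigma> (\<alpha> d)"
  unfolding face_perm_def by simp

lemma rot_eq: "\<sigma> d = \<phi> (\<alpha> d)"
  by (simp add: face_eq)

lemma face_permutes: "\<phi> permutes D"
  unfolding face_perm_def using rot_permutes opp_permutes permutes_compose by blast

lemma in_D_iff [simp]: "\<sigma> d \<in> D \<longleftrightarrow> d \<in> D" "\<alpha> d \<in> D \<longleftrightarrow> d \<in> D" "\<phi> d \<in> D \<longleftrightarrow> d \<in> D"
  using permutes_in_image rot_permutes opp_permutes face_permutes by metis+

lemma eq_iff [simp]: "\<sigma> d = \<sigma> e \<longleftrightarrow> d = e" "\<alpha> d = \<alpha> e \<longleftrightarrow> d = e" "\<phi> d = \<phi> e \<longleftrightarrow> d = e"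
  using permutes_inj[OF rot_permutes] permutes_inj[OF opp_permutes] permutes_inj[OF face_permutes]
  by (simp_all add: inj_eq)

lemma in_tail [simp]: "d \<in> tail M d"
  unfolding tail_def using self_in_orbit[OF rot_permutes fin] .

lemma in_tail_iff: "d \<in> tail M e \<longleftrightarrow> tail M d = tail M e"
  using orbit_eqI_in[OF rot_permutes fin] in_tail unfolding tail_def by metis

lemma tail_rot [simp]: "tail M (\<sigma> d) = tail M d"
  unfolding tail_def using orbit_step_eq[OF rot_permutes fin] .

lemma tail_face: "tail M (\<phi> d) = head M d"
  unfolding face_eq by (simp add: head_def)

lemma head_opp [simp]: "head M (\<alpha> d) = tail M d"
  by (simp add: head_def)

lemma tail_opp: "tail M (\<alpha> d) = head M d"
  by (simp add: head_def)

lemma face_vertices_distinct: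
  assumes "d \<in> D"
  shows "tail M d \<noteq> tail M (\<phi> d)" "tail M (\<phi> d) \<noteq> tail M (\<phi> (\<phi> d))"
    "tail M d \<noteq> tail M (\<phi> (\<phi> d))"
  using no_loop[of d] no_loop[of "\<phi> d"] no_loop[of "\<phi> (\<phi> d)"] assms face3[OF assms]
    tail_face[of d] tail_face[of "\<phi> d"] tail_face[of "\<phi> (\<phi> d)"] by auto

lemma tail_subset: "d \<in> D \<Longrightarrow> tail M d \<subseteq> D"
  unfolding tail_def using permutes_orbit_subset[OF rot_permutes] .

lemma finite_tail: "d \<in> D \<Longrightarrow> finite (tail M d)"
  using tail_subset fin finite_subset by blast

lemma outer_closed: "d \<in> outer_face M \<Longrightarrow> \<phi> d \<in> outer_face M"
  using outer face3 by auto

lemma outer_subset: "outer_face M \<subseteq> D"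
  using outer by auto

lemma outer_face_iff: "d \<in> D \<Longrightarrow> \<phi> d \<in> outer_face M \<longleftrightarrow> d \<in> outer_face M"
  using outer_closed face3 by metis

lemma vertices_eq: "vertices M = tail M ` D"
  unfolding vertices_def tail_def by auto

end

section \<open>Edge flips\<close>

text \<open>Let \<open>g\<close> be the reverse of \<open>f\<close>. The faces \<open>(f, p, r)\<close> and \<open>(g, h, k)\<close> on the two sides of this edge
  are replaced by \<open>(f, k, p)\<close> and \<open>(g, r, h)\<close>.\<close>

definition flip :: "'d plane_map \<Rightarrow> 'd \<Rightarrow> 'd plane_map" where
  "flip M f =
    (let g = opp M f; p = face_perm M f; r = face_perm M p; h = face_perm M g; k = face_perm M h
     in M\<lparr>rot := (face_perm M)(f := k, k := p, p := f, g := r, r := h, h := g) \<circ> opp M\<rparr>)"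

text \<open>\<open>u\<close> and \<open>w\<close> are the corners opposite to the edge in its two
  faces, that is, the ends of the new edge. The condition prevents a loop and a multiple
  edge.\<close>

definition flippable :: "'d plane_map \<Rightarrow> 'd \<Rightarrow> bool" where
  "flippable M f \<longleftrightarrow>
    (let u = tail M (face_perm M (face_perm M f)); w = tail M (face_perm M (face_perm M (opp M f)))
     in u \<noteq> w \<and> (\<forall>y\<in>darts M. tail M y = u \<longrightarrow> head M y \<noteq> w))"

lemma flip_simps [simp]:
  "darts (flip M f) = darts M" "opp (flip M f) = opp M" "outer_face (flip M f) = outer_face M"
  "root_dart (flip M f) = root_dart M"
  by (simp_all add: flip_def Let_def)

locale flip_triangulation = simple_triangulation +
  fixes f
  assumes f: "f \<in> D" and flippable: "flippable M f"
begin

definition "g = \<alpha> f"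
definition "p = \<phi> f"
definition "r = \<phi> p"
definition "h = \<phi> g"
definition "k = \<phi> h"

lemmas flip_dart_defs = g_def p_def r_def h_def k_def

abbreviation "M' \<equiv> flip M f"

lemma in_D: "g \<in> D" "p \<in> D" "r \<in> D" "h \<in> D" "k \<in> D"
  using f by (simp_all add: flip_dart_defs)

lemma face_steps: "\<phi> f = p" "\<phi> p = r" "\<phi> r = f" "\<phi> g = h" "\<phi> h = k" "\<phi> k = g" "\<alpha> f = g" "\<alpha> g = f"
  using f face3 by (simp_all add: flip_dart_defs)

lemma tails: "tail M h = tail M f" "tail M p = tail M g"
  using tail_face[of f] tail_face[of g] head_opp[of f] tail_opp[of f] face_steps by auto

lemma tails_neq:
  "tail M f \<noteq> tail M g" "tail M f \<noteq> tail M r" "tail M g \<noteq> tail M r"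
  "tail M f \<noteq> tail M k" "tail M g \<noteq> tail M k" "tail M r \<noteq> tail M k"
  using face_vertices_distinct[of f] face_vertices_distinct[of g] f in_D tails flippable face_steps
  unfolding flippable_def Let_def by auto

text \<open>Darts with different tails differ. Only \<open>f\<close>, \<open>h\<close> and
  \<open>p\<close>, \<open>g\<close> share their tails; these pairs are separated by means of the
  face permutation.\<close>

lemma distinct: "distinct [f, p, r, g, h, k]"
proof -
  have "f \<noteq> h"
  proof
    assume "f = h"
    then have "\<phi> g = f" using face_steps by simp
    then have "g = r" using face_steps face3[OF f] eq_iff(3) by metis
    then show False using tails_neq by simp
  qed
  moreover have "p \<noteq> g"
  proof
    assume "p = g"
    then have "\<phi> f = \<phi> k" using face_steps by simp
    then show False using tails_neq by auto
  qed
  moreover have "f \<noteq> p" "f \<noteq> r" "f \<noteq> g" "f \<noteq> k" "p \<noteq> r" "p \<noteq> h" "p \<noteq> k" "r \<noteq> g" "r \<noteq> h" "r \<noteq> k"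
    "g \<noteq> h" "g \<noteq> k" "h \<noteq> k"
    using tails_neq tails by metis+
  ultimately show ?thesis by simp
qed

lemma face_eq_flip_dart_iff:
  "\<phi> d = f \<longleftrightarrow> d = r" "\<phi> d = k \<longleftrightarrow> d = h" "\<phi> d = p \<longleftrightarrow> d = f"
  "\<phi> d = g \<longleftrightarrow> d = k" "\<phi> d = r \<longleftrightarrow> d = p" "\<phi> d = h \<longleftrightarrow> d = g"
  using face_steps eq_iff(3) by metis+

lemma face_flip: "face_perm M' = \<phi>(f := k, k := p, p := f, g := r, r := h, h := g)"
proof -
  have "rot M' = \<phi>(f := k, k := p, p := f, g := r, r := h, h := g) \<circ> \<alpha>"
    unfolding flip_def Let_def g_def[symmetric] p_def[symmetric] r_def[symmetric]
      h_def[symmetric] k_def[symmetric] by simp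
  then show ?thesis unfolding face_perm_def[of M'] by (simp add: fun_eq_iff)
qed

lemma rot_flip: "rot M' d = face_perm M' (\<alpha> d)"
  unfolding face_perm_def[of M'] by simp

lemma face_flip_steps:
  "face_perm M' f = k" "face_perm M' k = p" "face_perm M' p = f"
  "face_perm M' g = r" "face_perm M' r = h" "face_perm M' h = g"
  "d \<notin> {f, k, p, g, r, h} \<Longrightarrow> face_perm M' d = \<phi> d"
  unfolding face_flip using distinct by auto

abbreviation "S \<equiv> D - {f, g}"

lemma opp_in_S: "\<alpha> d \<in> S \<longleftrightarrow> d \<in> S"
  using face_steps by auto (metis opp_opp)+

lemma face_flip_permutes: "face_perm M' permutes D"
proof -
  have inj: "inj_on (face_perm M') D"
  proof (rule inj_onI)
    fix x y assume *: "x \<in> D" "y \<in> D" "face_perm M' x = face_perm M' y"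
    have a: "\<phi> d \<in> {f, k, p, g, r, h} \<longleftrightarrow> d \<in> {f, k, p, g, r, h}" for d
      using face_eq_flip_dart_iff[of d] by blast
    have b: "face_perm M' d \<in> {f, k, p, g, r, h} \<longleftrightarrow> d \<in> {f, k, p, g, r, h}" for d
      using face_flip_steps a by (cases "d \<in> {f, k, p, g, r, h}") auto
    show "x = y"
    proof (cases "x \<in> {f, k, p, g, r, h}")
      case True
      then have "y \<in> {f, k, p, g, r, h}" using b * by metis
      then show ?thesis using True * face_flip_steps distinct by auto
    next
      case False
      then have "y \<notin> {f, k, p, g, r, h}" using b * by metis
      then show ?thesis using False * face_flip_steps(7) eq_iff by metis
    qed
  qed
  moreover have "face_perm M' ` D \<subseteq> D"
    using f in_D by (auto simp: face_flip split: if_splits)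
  ultimately have "bij_betw (face_perm M') D D"
    unfolding bij_betw_def using fin by (metis endo_inj_surj)
  moreover have "face_perm M' d = d" if "d \<notin> D" for d
    using that f in_D face_permutes unfolding face_flip by (auto simp: permutes_def)
  ultimately show ?thesis by (rule bij_imp_permutes)
qed

lemma rot_flip_permutes: "rot M' permutes D"
proof -
  have "rot M' = face_perm M' \<circ> \<alpha>" using rot_flip by auto
  then show ?thesis using permutes_compose[OF opp_permutes face_flip_permutes] by simp
qed

text \<open>Away from the flipped edge the two rotation systems agree: both induce the same rotation on the
  map from which this edge has been deleted.\<close>

lemma next_in_flip:
  assumes y: "y \<in> S"
  shows "next_in (rot M') S y = next_in \<sigma> S y"
proof -
  have r: "\<sigma> y = \<phi> (\<alpha> y)" "rot M' y = face_perm M' (\<alpha> y)" by (simp_all add: rot_eq rot_flip)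
  have z: "\<alpha> y \<in> S" using y opp_in_S by blast
  have S: "p \<in> S" "r \<in> S" "h \<in> S" "k \<in> S" using in_D distinct by auto
  \<comment> \<open>In the first and third case the new edge has to be skipped in \<open>M'\<close>,
    in the second and fourth the old edge in \<open>M\<close>; elsewhere the rotations
    coincide.\<close>
  consider "\<alpha> y = p" | "\<alpha> y = r" | "\<alpha> y = h" | "\<alpha> y = k" | "\<alpha> y \<notin> {f, k, p, g, r, h}"
    using z by auto
  then show ?thesis
  proof cases
    case 1
    have "rot M' (rot M' y) = r" using r 1 face_flip_steps face_steps rot_flip by simp
    then show ?thesis using r 1 face_flip_steps face_steps S by (subst next_in_skip) (auto simp: next_in_eq)
  next
    case 2
    have "\<sigma> (\<sigma> y) = h" using r 2 face_steps rot_eq by simp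
    then show ?thesis using r 2 face_flip_steps face_steps S by (subst (2) next_in_skip) (auto simp: next_in_eq)
  next
    case 3
    have "rot M' (rot M' y) = k" using r 3 face_flip_steps face_steps rot_flip by simp
    then show ?thesis using r 3 face_flip_steps face_steps S by (subst next_in_skip) (auto simp: next_in_eq)
  next
    case 4
    have "\<sigma> (\<sigma> y) = p" using r 4 face_steps rot_eq by simp
    then show ?thesis using r 4 face_flip_steps face_steps S by (subst (2) next_in_skip) (auto simp: next_in_eq)
  next
    case 5
    then have "rot M' y = \<sigma> y" using r face_flip_steps(7) by simp
    moreover have "\<sigma> y \<in> S"
    proof -
      have "\<sigma> y \<noteq> f" "\<sigma> y \<noteq> g"
        using 5 r face_eq_flip_dart_iff by auto
      then show ?thesis using y by auto
    qed
    ultimately show ?thesis by (simp add: next_in_eq)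
  qed
qed

text \<open>Both sides are the orbit of \<open>y\<close> under the common rotation induced on
  \<open>S\<close>.\<close>

lemma tail_flip_S:
  assumes "y \<in> S"
  shows "tail M' y \<inter> S = tail M y \<inter> S"
proof -
  have eq: "next_in (rot M') S s = next_in \<sigma> S s" if "s \<in> orbit (next_in \<sigma> S) y" for s
    using that orbit_next_in[OF rot_permutes fin assms] next_in_flip by simp
  have self: "y \<in> orbit (next_in \<sigma> S) y"
    using orbit_next_in[OF rot_permutes fin assms] self_in_orbit[OF rot_permutes fin] assms by simp
  have "orbit (next_in (rot M') S) y = orbit (next_in \<sigma> S) y"
    by (rule orbit_cong[OF self eq])
  then show ?thesis
    unfolding tail_def orbit_next_in[OF rot_permutes fin assms, symmetric]
      orbit_next_in[OF rot_flip_permutes fin assms, symmetric] .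
qed

lemma tail_flip_eq_iff_in: "d \<in> tail M' e \<longleftrightarrow> tail M' d = tail M' e"
  using orbit_eqI_in[OF rot_flip_permutes fin] self_in_orbit[OF rot_flip_permutes fin] unfolding tail_def by metis

lemma tail_rot_flip: "tail M' (rot M' d) = tail M' d"
  unfolding tail_def using orbit_step_eq[OF rot_flip_permutes fin] .

lemma tail_flip_eq_iff:
  assumes "y \<in> S" "z \<in> S"
  shows "tail M' y = tail M' z \<longleftrightarrow> tail M y = tail M z"
proof -
  have "tail M' y = tail M' z \<longleftrightarrow> y \<in> tail M' z \<inter> S" using assms tail_flip_eq_iff_in by simp
  also have "\<dots> \<longleftrightarrow> y \<in> tail M z" using tail_flip_S[OF assms(2)] assms by auto
  finally show ?thesis by (simp add: in_tail_iff)
qed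

lemma tail_flip_fg: "tail M' f = tail M' r" "tail M' g = tail M' k"
  using tail_rot_flip[of f] tail_rot_flip[of g] face_flip_steps face_steps rot_flip by simp_all

lemma prhk_in_S: "p \<in> S" "r \<in> S" "h \<in> S" "k \<in> S"
  using in_D distinct by auto

text \<open>A dart of \<open>S\<close> that starts in \<open>M'\<close> at the same vertex as
  \<open>d\<close>: the new edge joins the tails of \<open>r\<close> and \<open>k\<close>. Questions
  about vertices of \<open>M'\<close> are thereby answered in \<open>M\<close>.\<close>

definition "shadow d = (if d = f then r else if d = g then k else d)"

lemma shadow_in_S: "d \<in> D \<Longrightarrow> shadow d \<in> S"
  using prhk_in_S by (auto simp: shadow_def)

lemma tail_flip_shadow:
  assumes "d \<in> D" "e \<in> D"
  shows "tail M' d = tail M' e \<longleftrightarrow> tail M (shadow d) = tail M (shadow e)"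
proof -
  have "tail M' x = tail M' (shadow x)" for x using tail_flip_fg by (simp add: shadow_def)
  then show ?thesis using tail_flip_eq_iff shadow_in_S assms by metis
qed

text \<open>The darts of \<open>S\<close> already represent all vertices: \<open>f\<close> and
  \<open>g\<close> share theirs with \<open>h\<close> and \<open>p\<close> before the flip, with
  \<open>r\<close> and \<open>k\<close> after it.\<close>

lemma vertices_flip: "card (vertices M') = card (vertices M)"
proof -
  have "tail M' ` D = tail M' ` S"
    using tail_flip_fg prhk_in_S by (auto simp: image_iff)
  moreover have "tail M ` D = tail M ` S"
    using tails[symmetric] prhk_in_S by (auto simp: image_iff)
  moreover have "card (tail M' ` S) = card (tail M ` S)"
    by (rule card_image_eq_if_same_kernel) (rule tail_flip_eq_iff)
  moreover have "vertices M' = tail M' ` D" unfolding vertices_def tail_def by auto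
  ultimately show ?thesis using vertices_eq by metis
qed

text \<open>An invariant set of \<open>M'\<close> contains \<open>f\<close> iff it contains
  \<open>g\<close>, hence all or none of the six darts of the two faces. So it is invariant under
  the old face permutation, too.\<close>

lemma cut_connected_flip: "cut_connected M'"
  unfolding cut_connected_def
proof (intro allI impI)
  fix X assume X: "X \<subseteq> darts M'" "X \<noteq> {}" "\<forall>d\<in>X. rot M' d \<in> X" "\<forall>d\<in>X. opp M' d \<in> X"
  have r: "rot M' d \<in> X \<longleftrightarrow> d \<in> X" for d
    using closed_permutes_iff[OF rot_flip_permutes fin] X by simp
  have a: "\<alpha> d \<in> X \<longleftrightarrow> d \<in> X" for d
    using X by (metis flip_simps(2) opp_opp)
  have ff: "face_perm M' d \<in> X \<longleftrightarrow> d \<in> X" for d using r a rot_flip by (metis opp_opp)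
  have "f \<in> X \<longleftrightarrow> g \<in> X" using a face_steps by metis
  then have "\<phi> d \<in> X" if "d \<in> X" for d
    using that ff[of f] ff[of k] ff[of p] ff[of g] ff[of r] ff[of h] ff[of d] face_flip_steps face_steps
    by (cases "d \<in> {f, k, p, g, r, h}") auto
  then have "\<forall>d\<in>X. \<sigma> d \<in> X" using rot_eq a by metis
  then show "X = darts M'" using connectedness X unfolding cut_connected_def by simp
qed

text \<open>Each of the two faces contains a dart starting at the tail of \<open>f\<close>, namely
  \<open>f\<close> and \<open>h\<close>, so neither is the outer face.\<close>

lemma outer_disjoint:
  assumes "tail M f \<inter> outer_face M = {}"
  shows "outer_face M \<inter> {f, k, p, g, r, h} = {}"
proof -
  have "f \<notin> outer_face M" "h \<notin> outer_face M" using assms tails in_tail by auto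
  then show ?thesis
    using outer_face_iff[of f] outer_face_iff[of p] outer_face_iff[of h] outer_face_iff[of g]
      f in_D face_steps by auto
qed

lemma flip_triangulation:
  assumes "tail M f \<inter> outer_face M = {}"
  shows "three_connected_triangulation M'"
proof -
  let ?six = "{f, k, p, g, r, h}"
  have out: "face_perm M' d = \<phi> d" if "d \<in> outer_face M" for d
    using outer_disjoint[OF assms] that by (intro face_flip_steps(7)) auto
  have six: "\<phi> d \<notin> ?six" if "d \<notin> ?six" for d
    using that face_eq_flip_dart_iff[of d] by blast
  have f3: "face_perm M' (face_perm M' (face_perm M' d)) = d \<and> face_perm M' d \<noteq> d" if "d \<in> D" for d
  proof (cases "d \<in> ?six")
    case True
    then show ?thesis using distinct face_flip_steps(1-6) by auto
  next
    case False
    then have "face_perm M' d = \<phi> d" "face_perm M' (\<phi> d) = \<phi> (\<phi> d)" 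
      "face_perm M' (\<phi> (\<phi> d)) = \<phi> (\<phi> (\<phi> d))" using six face_flip_steps(7) by blast+
    then show ?thesis using that face3 face_neq by simp
  qed
  have outer': "\<exists>d\<in>D. outer_face M = {d, face_perm M' d, face_perm M' (face_perm M' d)}"
  proof -
    obtain d where "d \<in> D" "outer_face M = {d, \<phi> d, \<phi> (\<phi> d)}" using outer by blast
    then show ?thesis using out by (intro bexI[of _ d]) auto
  qed
  have opp_shadow: "shadow (\<alpha> d) = \<alpha> d" if "d \<in> S" for d
    using that opp_in_S[of d] by (auto simp: shadow_def)
  have sh: "shadow d = d" if "d \<in> S" for d using that by (auto simp: shadow_def)
  have sh_fg: "shadow f = r" "shadow g = k" using distinct by (auto simp: shadow_def)
  have fl: "tail M y = tail M r \<Longrightarrow> head M y \<noteq> tail M k" if "y \<in> D" for y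
    using flippable that unfolding flippable_def Let_def using face_steps by auto
  have loop': "tail M' d \<noteq> head M' d" if "d \<in> D" for d
  proof -
    have "tail M (shadow d) \<noteq> tail M (shadow (\<alpha> d))"
    proof (cases "d \<in> S")
      case True
      then show ?thesis using opp_shadow sh no_loop[OF that] by (simp add: head_def)
    next
      case False
      then have "d = f \<or> d = g" using that by blast
      then show ?thesis using sh_fg face_steps tails_neq by metis
    qed
    then show ?thesis unfolding head_def using tail_flip_shadow[of d "\<alpha> d"] that by simp
  qed
  have simple': "d = e" if de: "d \<in> D" "e \<in> D" "tail M' d = tail M' e" "head M' d = head M' e" for d e
  proof -
    have eqs: "tail M (shadow d) = tail M (shadow e)" "tail M (shadow (\<alpha> d)) = tail M (shadow (\<alpha> e))"
      using de tail_flip_shadow[of d e] tail_flip_shadow[of "\<alpha> d" "\<alpha> e"] by (auto simp: head_def)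
    \<comment> \<open>A dart of \<open>S\<close> parallel to the new edge would join the opposite
      corners, contrary to \<open>flippable\<close>.\<close>
    have no: False if "x \<in> S" "y \<in> {f, g}" "tail M (shadow x) = tail M (shadow y)"
      "tail M (shadow (\<alpha> x)) = tail M (shadow (\<alpha> y))" for x y
    proof -
      have "tail M x = tail M r \<and> head M x = tail M k \<or> tail M x = tail M k \<and> head M x = tail M r"
        using that opp_shadow sh sh_fg face_steps by (auto simp: head_def)
      then show False using fl[of x] fl[of "\<alpha> x"] that by (auto simp: tail_opp)
    qed
    consider "d \<in> S" "e \<in> S" | "d \<in> S" "e \<in> {f, g}" | "e \<in> S" "d \<in> {f, g}" | "d \<in> {f, g}" "e \<in> {f, g}"
      using de by blast
    then show ?thesis
    proof cases
      case 1
      then show ?thesis using eqs sh opp_shadow simple de by (simp add: head_def)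
    next
      case 4
      then show ?thesis using eqs sh_fg tails_neq by auto
    qed (use no eqs in metis)+
  qed
  show ?thesis
    unfolding three_connected_triangulation_iff
    using fin rot_flip_permutes opp_permutes opp_neq cut_connected_flip f3 vertices_flip euler outer'
      root loop' simple'
    by (auto simp del: in_D_iff)
qed

lemma face_flip_inverse:
  "\<phi> = (face_perm M')(f := p, p := r, r := f, g := h, h := k, k := g)"
  unfolding face_flip using face_steps distinct by (auto simp: fun_eq_iff)

end

section \<open>Cycles separate\<close>

text \<open>A connected graph with V vertices has at least V - 1 edges. Vertices are the orbits of
  \<open>f\<close>, edges the pairs \<open>{d, a d}\<close> in \<open>A\<close>. It is applied to
  the map and to its dual.\<close>

lemma card_orbits_le_connecting_edges:
  assumes f: "f permutes D" "finite D" "D \<noteq> {}"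
    and A: "A \<subseteq> D" "\<And>d. d \<in> A \<Longrightarrow> a d \<in> A \<and> a (a d) = d \<and> a d \<noteq> d"
    and conn: "\<And>X. X \<subseteq> D \<Longrightarrow> X \<noteq> {} \<Longrightarrow> (\<And>d. d \<in> X \<Longrightarrow> f d \<in> X) \<Longrightarrow>
      (\<And>d. d \<in> X \<Longrightarrow> d \<in> A \<Longrightarrow> a d \<in> X) \<Longrightarrow> X = D"
  shows "2 * card (orbit f ` D) \<le> card A + 2"
proof -
  have finA: "finite A" using f A finite_subset by blast
  \<comment> \<open>Grow a connected part orbit by orbit: an edge leaving \<open>X\<close> adds a
    new orbit and contributes two new darts inside.\<close>
  have "\<exists>X \<subseteq> D. X \<noteq> {} \<and> (\<forall>d\<in>X. f d \<in> X) \<and> card (orbit f ` X) = Suc k \<and>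
    2 * k \<le> card {d\<in>A. d \<in> X \<and> a d \<in> X}" if "Suc k \<le> card (orbit f ` D)" for k
    using that
  proof (induction k)
    case 0
    obtain x where x: "x \<in> D" using f by blast
    have "orbit f ` orbit f x = {orbit f x}"
      using orbit_eqI_in[OF f(1,2)] self_in_orbit[OF f(1,2)] by blast
    moreover have "\<forall>d\<in>orbit f x. f d \<in> orbit f x" by (auto intro: orbit.intros)
    ultimately show ?case
      using permutes_orbit_subset[OF f(1) x] orbit_nonempty[of f x] by (intro exI[of _ "orbit f x"]) auto
  next
    case (Suc k)
    then obtain X where X: "X \<subseteq> D" "X \<noteq> {}" "\<forall>d\<in>X. f d \<in> X" "card (orbit f ` X) = Suc k"
      "2 * k \<le> card {d\<in>A. d \<in> X \<and> a d \<in> X}" by auto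
    have "X \<noteq> D" using X Suc.prems by auto
    then obtain d where d: "d \<in> X" "d \<in> A" "a d \<notin> X"
      using conn[of X] X by blast
    define O' where "O' = orbit f (a d)"
    have aD: "a d \<in> D" using d A by blast
    have O'D: "O' \<subseteq> D" unfolding O'_def by (rule permutes_orbit_subset[OF f(1) aD])
    have orb: "orbit f ` O' = {O'}"
      unfolding O'_def using orbit_eqI_in[OF f(1,2)] self_in_orbit[OF f(1,2)] by blast
    have "O' \<notin> orbit f ` X"
    proof
      assume "O' \<in> orbit f ` X"
      then obtain x where "x \<in> X" "O' = orbit f x" by blast
      moreover have "orbit f x \<subseteq> X" using orbit_subset_closed[of x X f] X \<open>x \<in> X\<close> by blast
      ultimately show False using d self_in_orbit[OF f(1,2), of "a d"] unfolding O'_def by blast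
    qed
    moreover have "finite (orbit f ` X)" using X(1) f(2) finite_subset by blast
    ultimately have "card (orbit f ` (X \<union> O')) = Suc (Suc k)"
      using X(4) orb by (simp add: image_Un)
    moreover have "2 * Suc k \<le> card {e\<in>A. e \<in> X \<union> O' \<and> a e \<in> X \<union> O'}"
    proof -
      have "a d \<in> O'" unfolding O'_def using self_in_orbit[OF f(1,2)] .
      then have "{e\<in>A. e \<in> X \<and> a e \<in> X} \<union> {d, a d} \<subseteq> {e\<in>A. e \<in> X \<union> O' \<and> a e \<in> X \<union> O'}"
        using d A(2)[of d] by auto
      then have le: "card ({e\<in>A. e \<in> X \<and> a e \<in> X} \<union> {d, a d}) \<le> card {e\<in>A. e \<in> X \<union> O' \<and> a e \<in> X \<union> O'}"
        using finA by (intro card_mono) auto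
      have "2 * Suc k = 2 * k + card {d, a d}" using A(2)[of d] d by auto
      also have "\<dots> \<le> card {e\<in>A. e \<in> X \<and> a e \<in> X} + card {d, a d}" using X(5) by simp
      also have "\<dots> = card ({e\<in>A. e \<in> X \<and> a e \<in> X} \<union> {d, a d})"
        using finA d by (intro card_Un_disjoint[symmetric]) auto
      also note le
      finally show ?thesis .
    qed
    moreover have "\<forall>d\<in>X \<union> O'. f d \<in> X \<union> O'" using X(3) unfolding O'_def by (auto intro: orbit.intros)
    ultimately show ?case using X(1,2) O'D by (intro exI[of _ "X \<union> O'"]) auto
  qed
  note * = this
  have "card (orbit f ` D) \<noteq> 0" using f by simp
  then obtain k where k: "card (orbit f ` D) = Suc k" using not0_implies_Suc by blast
  then obtain X where "2 * k \<le> card {d\<in>A. d \<in> X \<and> a d \<in> X}" using *[of k] by auto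
  also have "\<dots> \<le> card A" using finA by (intro card_mono) auto
  finally show ?thesis using k by simp
qed

lemma sum_over_involution_eq_0:
  fixes g :: "'a \<Rightarrow> int"
  assumes "\<And>d. d \<in> A \<Longrightarrow> a d \<in> A \<and> a (a d) = d \<and> g (a d) = - g d"
  shows "sum g A = 0"
proof -
  have "sum g A = sum (\<lambda>d. g (a d)) A"
    by (rule sum.reindex_bij_witness[of _ a a]) (use assms in auto)
  also have "\<dots> = - sum g A" using assms by (simp add: sum_negf[symmetric])
  finally show ?thesis by simp
qed

context simple_triangulation
begin

text \<open>For \<open>B\<close> closed under \<alpha>, this is connectedness of the spanning
  subgraph with edge set \<open>B\<close>; \<open>dual_connected\<close> is the same for the dual
  edges, the orbits of \<phi> being the dual vertices.\<close>

definition "primal_connected B \<longleftrightarrow> (\<forall>X \<subseteq> D. X \<noteq> {} \<longrightarrow> (\<forall>d\<in>X. \<sigma> d \<in> X) \<longrightarrow>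
  (\<forall>d\<in>X. d \<in> B \<longrightarrow> \<alpha> d \<in> X) \<longrightarrow> X = D)"

definition "dual_connected B \<longleftrightarrow> (\<forall>X \<subseteq> D. X \<noteq> {} \<longrightarrow> (\<forall>d\<in>X. \<phi> d \<in> X) \<longrightarrow>
  (\<forall>d\<in>X. d \<in> B \<longrightarrow> \<alpha> d \<in> X) \<longrightarrow> X = D)"

lemma rot_closed_iff: "X \<subseteq> D \<Longrightarrow> \<forall>d\<in>X. \<sigma> d \<in> X \<Longrightarrow> \<sigma> d \<in> X \<longleftrightarrow> d \<in> X"
  using closed_permutes_iff[OF rot_permutes fin] by blast

lemma face_closed_iff: "X \<subseteq> D \<Longrightarrow> \<forall>d\<in>X. \<phi> d \<in> X \<Longrightarrow> \<phi> d \<in> X \<longleftrightarrow> d \<in> X"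
  using closed_permutes_iff[OF face_permutes fin] by blast

text \<open>Were a vertex set \<open>X\<close> cut off by edges of \<open>A\<close> only, take one such edge: without it the dual edges
  of \<open>A\<close> leave a set \<open>H\<close> of faces isolated, and the signed number of crossings of the boundary of
  \<open>X\<close> along the boundaries of the faces in \<open>H\<close> would be \<open>\<pm>1\<close> instead of \<open>0\<close>.\<close>

lemma complement_of_minimal_dual_connected:
  assumes A: "A \<subseteq> D" "\<And>d. d \<in> A \<Longrightarrow> \<alpha> d \<in> A"
    and minimal: "\<And>e. e \<in> A \<Longrightarrow> \<not> dual_connected (A - {e, \<alpha> e})"
    and dual: "dual_connected A"
  shows "primal_connected (D - A)"
  unfolding primal_connected_def
proof (intro allI impI, rule ccontr)
  fix X assume X: "X \<subseteq> D" "X \<noteq> {}" "\<forall>d\<in>X. \<sigma> d \<in> X" "\<forall>d\<in>X. d \<in> D - A \<longrightarrow> \<alpha> d \<in> X" "X \<noteq> D"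
  obtain e where e: "e \<in> X" "\<alpha> e \<notin> X"
    using connectedness[unfolded cut_connected_def, rule_format, of X] X by blast
  then have eA: "e \<in> A" using X by blast
  obtain H where H: "H \<subseteq> D" "H \<noteq> {}" "\<forall>d\<in>H. \<phi> d \<in> H" "\<forall>d\<in>H. d \<in> A - {e, \<alpha> e} \<longrightarrow> \<alpha> d \<in> H" "H \<noteq> D"
    using minimal[OF eA] unfolding dual_connected_def by blast
  have cut: "e \<in> H \<longleftrightarrow> \<alpha> e \<notin> H"
  proof -
    obtain d where d: "d \<in> H" "d \<in> A" "\<alpha> d \<notin> H"
      using dual[unfolded dual_connected_def, rule_format, of H] H by blast
    then have "d = e \<or> d = \<alpha> e" using H(4) by blast
    then show ?thesis using d by auto
  qed
  \<comment> \<open>1 if \<open>d\<close> enters \<open>X\<close>, -1 if it leaves \<open>X\<close>.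
    As \<open>X\<close> is a union of vertices, \<open>\<alpha> d\<close> may be replaced by
    \<open>\<phi> d\<close>, so that \<open>c\<close> telescopes to 0 along every face.\<close>
  define c where "c d = (of_bool (\<alpha> d \<in> X) - of_bool (d \<in> X) :: int)" for d
  have c: "c d = of_bool (\<phi> d \<in> X) - of_bool (d \<in> X)" for d
    unfolding c_def using rot_closed_iff[OF X(1,3), of "\<alpha> d"] by (simp add: face_eq)
  have "bij_betw \<phi> H H"
  proof -
    have "inj_on \<phi> H" by (auto intro: inj_onI)
    moreover have "\<phi> ` H \<subseteq> H" using H by blast
    ultimately show ?thesis using finite_subset[OF H(1) fin] by (metis bij_betw_def endo_inj_surj)
  qed
  then have "sum (\<lambda>d. of_bool (\<phi> d \<in> X) :: int) H = sum (\<lambda>d. of_bool (d \<in> X)) H"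
    by (rule sum.reindex_bij_betw)
  then have zero: "sum c H = 0" unfolding c by (simp add: sum_subtractf)
  have finH: "finite H" using finite_subset[OF H(1) fin] .
  \<comment> \<open>Apart from the edge of \<open>e\<close>, an edge of \<open>A\<close> with one
    dart in \<open>H\<close> has both there, and they count with opposite signs.\<close>
  have "sum c (H \<inter> A - {e, \<alpha> e}) = 0"
  proof (rule sum_over_involution_eq_0[where a = \<alpha>])
    fix d assume "d \<in> H \<inter> A - {e, \<alpha> e}"
    moreover from this have "\<alpha> d \<in> H" "\<alpha> d \<in> A" using H A by auto
    moreover have "\<alpha> d \<noteq> e" "\<alpha> d \<noteq> \<alpha> e" using calculation by auto
    ultimately show "\<alpha> d \<in> H \<inter> A - {e, \<alpha> e} \<and> \<alpha> (\<alpha> d) = d \<and> c (\<alpha> d) = - c d"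
      unfolding c_def by auto
  qed
  \<comment> \<open>Darts outside \<open>A\<close> do not cross the boundary of
    \<open>X\<close>.\<close>
  moreover have "sum c (H \<inter> A - {e, \<alpha> e}) = sum c (H - {e, \<alpha> e})"
  proof (rule sum.mono_neutral_left)
    show "\<forall>d\<in>H - {e, \<alpha> e} - (H \<inter> A - {e, \<alpha> e}). c d = 0"
    proof
      fix d assume "d \<in> H - {e, \<alpha> e} - (H \<inter> A - {e, \<alpha> e})"
      then have "d \<in> D - A" "\<alpha> d \<in> D - A" using H A by (auto, metis opp_opp)
      then have "\<alpha> d \<in> X \<longleftrightarrow> d \<in> X" using X(4) by (metis opp_opp)
      then show "c d = 0" unfolding c_def by simp
    qed
  qed (use finH in auto)
  moreover have "sum c H = sum c (H - {e, \<alpha> e}) + sum c (H \<inter> {e, \<alpha> e})"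
    using finH by (metis Int_commute add.commute sum.Int_Diff)
  ultimately have "sum c (H \<inter> {e, \<alpha> e}) = 0" using zero by simp
  moreover have "H \<inter> {e, \<alpha> e} = {e} \<or> H \<inter> {e, \<alpha> e} = {\<alpha> e}" using cut by auto
  ultimately show False using e unfolding c_def by auto
qed

text \<open>If the dual graph stayed connected without the cycle \<open>C\<close>, then edges of a minimal dual connected
  subgraph together with those of its complement, which is connected even after removing an edge of
  \<open>C\<close>, would exceed the number of edges permitted by Euler's formula.\<close>

lemma cycle_separates:
  assumes C: "c \<in> C" "C \<subseteq> D" "\<And>d. d \<in> C \<Longrightarrow> \<alpha> d \<in> C"
    and cycle: "\<And>X. X \<subseteq> D \<Longrightarrow> (\<And>d. d \<in> X \<Longrightarrow> \<sigma> d \<in> X) \<Longrightarrow>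
      (\<And>d. d \<in> X \<Longrightarrow> d \<in> C - {c, \<alpha> c} \<Longrightarrow> \<alpha> d \<in> X) \<Longrightarrow> c \<in> X \<longleftrightarrow> \<alpha> c \<in> X"
  shows "\<not> dual_connected (D - C)"
proof
  assume "dual_connected (D - C)"
  \<comment> \<open>Edge sets off \<open>C\<close> whose duals connect all faces. One with the
    fewest darts cannot lose any edge.\<close>
  define P where "P A \<longleftrightarrow> A \<subseteq> D - C \<and> (\<forall>d\<in>A. \<alpha> d \<in> A) \<and> dual_connected A" for A
  have P0: "P (D - C)" unfolding P_def using \<open>dual_connected (D - C)\<close> C(3) by (auto, metis opp_opp)
  obtain A where A: "P A" and minA: "\<And>B. P B \<Longrightarrow> card A \<le> card B"
    using exists_least_lemma[of "\<lambda>n. \<exists>A. P A \<and> card A = n"] P0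
      ex_has_least_nat[of P "D - C" card] by blast
  have A': "A \<subseteq> D - C" "\<And>d. d \<in> A \<Longrightarrow> \<alpha> d \<in> A" "dual_connected A" using A unfolding P_def by blast+
  have finA: "finite A" using A'(1) fin finite_subset by blast
  have min: "\<not> dual_connected (A - {e, \<alpha> e})" if "e \<in> A" for e
  proof
    assume "dual_connected (A - {e, \<alpha> e})"
    moreover have "\<alpha> d \<in> A - {e, \<alpha> e}" if "d \<in> A - {e, \<alpha> e}" for d
      using that A'(2) opp_opp by (metis Diff_iff empty_iff insert_iff)
    ultimately have "P (A - {e, \<alpha> e})" unfolding P_def using A' by blast
    then have "card A \<le> card (A - {e, \<alpha> e})" by (rule minA)
    then show False using that finA by (metis Diff_subset card_seteq Diff_iff insertI1)
  qed
  have prim: "primal_connected (D - A)"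
    by (rule complement_of_minimal_dual_connected) (use A' min in auto)
  \<comment> \<open>The edges outside \<open>A\<close> without that of \<open>c\<close>. The other
    edges of \<open>C\<close> belong to \<open>B\<close> and still join the ends of
    \<open>c\<close>, so all vertices remain connected.\<close>
  define B where "B = D - A - {c, \<alpha> c}"
  have conn: "X = D" if X: "X \<subseteq> D" "X \<noteq> {}" "\<And>d. d \<in> X \<Longrightarrow> \<sigma> d \<in> X" "\<And>d. d \<in> X \<Longrightarrow> d \<in> B \<Longrightarrow> \<alpha> d \<in> X" for X
  proof -
    have "C - {c, \<alpha> c} \<subseteq> B" using C A'(1) unfolding B_def by blast
    then have "c \<in> X \<longleftrightarrow> \<alpha> c \<in> X" using X by (intro cycle) auto
    moreover have "d \<in> {c, \<alpha> c} \<or> d \<in> B" if "d \<in> D - A" for d using that unfolding B_def by blast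
    ultimately have "\<forall>d\<in>X. d \<in> D - A \<longrightarrow> \<alpha> d \<in> X"
      using X(4) by (metis insertE opp_opp singletonD)
    then show ?thesis using prim[unfolded primal_connected_def, rule_format, of X] X by blast
  qed
  have ne: "D \<noteq> {}" using C by auto
  have "2 * card (orbit \<sigma> ` D) \<le> card B + 2"
  proof (rule card_orbits_le_connecting_edges[OF rot_permutes fin ne, where a = \<alpha>])
    fix d assume d: "d \<in> B"
    then have "\<alpha> d \<notin> A" using A'(2)[of "\<alpha> d"] by (auto simp: B_def)
    moreover have "\<alpha> d \<noteq> c" "\<alpha> d \<noteq> \<alpha> c" using d by (auto simp: B_def)
    ultimately show "\<alpha> d \<in> B \<and> \<alpha> (\<alpha> d) = d \<and> \<alpha> d \<noteq> d" using d opp_neq by (auto simp: B_def)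
  qed (use conn in \<open>auto simp: B_def\<close>)
  moreover have "2 * card (orbit \<phi> ` D) \<le> card A + 2"
  proof (rule card_orbits_le_connecting_edges[OF face_permutes fin ne, where a = \<alpha>])
    fix X assume "X \<subseteq> D" "X \<noteq> {}" "\<And>d. d \<in> X \<Longrightarrow> \<phi> d \<in> X" "\<And>d. d \<in> X \<Longrightarrow> d \<in> A \<Longrightarrow> \<alpha> d \<in> X"
    then show "X = D" using A'(3)[unfolded dual_connected_def, rule_format, of X] by simp
  next
    fix d assume "d \<in> A"
    then show "\<alpha> d \<in> A \<and> \<alpha> (\<alpha> d) = d \<and> \<alpha> d \<noteq> d" using A' opp_neq by auto
  qed (use A' in blast)
  \<comment> \<open>Hence 2V + 2F \<le> |A| + |B| + 4 = |D| + 2, while Euler's formula gives 2V + 2F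
    = |D| + 4.\<close>
  moreover have "card A + card B + 2 = card D"
  proof -
    have c2: "c \<in> D" "\<alpha> c \<in> D" "c \<notin> A" "\<alpha> c \<notin> A" "c \<noteq> \<alpha> c"
      using C A'(1) opp_neq[of c] by auto
    then have "card B = card (D - A) - card {c, \<alpha> c}"
      unfolding B_def by (intro card_Diff_subset) auto
    moreover have "card (D - A) = card D - card A" using A'(1) finA by (intro card_Diff_subset) auto
    moreover have "card {c, \<alpha> c} = 2" using c2 by simp
    moreover have "card {c, \<alpha> c} \<le> card (D - A)" using c2 fin by (intro card_mono) auto
    moreover have "card A \<le> card D" using A'(1) fin by (intro card_mono) auto
    ultimately show ?thesis by linarith
  qed
  moreover have "card D = 3 * card (orbit \<phi> ` D)"
    by (rule card_of_constant_fibres[OF fin _ disjoint_orbits(2,1)[OF face_permutes fin]])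
      (use face3 face_neq card_orbit_period_3[of \<phi>] in auto)
  moreover have "6 * card (orbit \<sigma> ` D) = card D + 12" using euler unfolding vertices_def .
  ultimately show False by linarith
qed

end

section \<open>The two sides of a 3-cycle and crossing chords\<close>

context simple_triangulation
begin

lemma rot_closed_tail:
  assumes "\<And>d. d \<in> X \<Longrightarrow> \<sigma> d \<in> X" "tail M d = tail M e" "d \<in> X"
  shows "e \<in> X"
  using orbit_subset_closed[of d X \<sigma>] assms in_tail[of e] unfolding tail_def by blast

text \<open>The Jordan curve theorem for 3-cycles: \<open>H\<close> consists of the darts whose
  faces lie on one side. \<open>cycle_separates\<close> yields a proper set of faces that can be
  left only across the cycle; the work is to show that every edge of the cycle, not just some, has
  different sides.\<close>

lemma sides_of_3cycle:
  assumes abc: "a \<in> D" "b \<in> D" "c \<in> D"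
    and cyc: "head M a = tail M b" "head M b = tail M c" "head M c = tail M a"
  obtains H where "\<And>d. \<phi> d \<in> H \<longleftrightarrow> d \<in> H"
    and "\<And>d. d \<in> D \<Longrightarrow> d \<notin> {a, b, c, \<alpha> a, \<alpha> b, \<alpha> c} \<Longrightarrow> \<alpha> d \<in> H \<longleftrightarrow> d \<in> H"
    and "\<And>d. d \<in> {a, b, c, \<alpha> a, \<alpha> b, \<alpha> c} \<Longrightarrow> \<alpha> d \<in> H \<longleftrightarrow> d \<notin> H"
proof -
  define C where "C = {a, b, c, \<alpha> a, \<alpha> b, \<alpha> c}"
  have opp_tails: "tail M (\<alpha> a) = tail M b" "tail M (\<alpha> b) = tail M c" "tail M (\<alpha> c) = tail M a"
    using cyc by (simp_all add: tail_opp)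
  have tails: "tail M a \<noteq> tail M b" "tail M b \<noteq> tail M c" "tail M c \<noteq> tail M a"
    using no_loop abc cyc by metis+
  have C: "C \<subseteq> D" "\<And>d. d \<in> C \<Longrightarrow> \<alpha> d \<in> C" unfolding C_def using abc by auto
  have "\<not> dual_connected (D - C)"
  proof (rule cycle_separates[where c = a])
    fix X assume X: "X \<subseteq> D" "\<And>d. d \<in> X \<Longrightarrow> \<sigma> d \<in> X" "\<And>d. d \<in> X \<Longrightarrow> d \<in> C - {a, \<alpha> a} \<Longrightarrow> \<alpha> d \<in> X"
    have same: "d \<in> X \<longleftrightarrow> e \<in> X" if "tail M d = tail M e" for d e
      using rot_closed_tail[of X] X that by metis
    have "d \<in> C - {a, \<alpha> a}" if "d \<in> {b, c, \<alpha> b, \<alpha> c}" for d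
    proof -
      have "d \<noteq> a" "d \<noteq> \<alpha> a" using that tails opp_tails opp_opp by (metis empty_iff insert_iff)+
      then show ?thesis using that unfolding C_def by blast
    qed
    then have "b \<in> X \<longleftrightarrow> \<alpha> b \<in> X" "c \<in> X \<longleftrightarrow> \<alpha> c \<in> X"
      using X(3)[of b] X(3)[of "\<alpha> b"] X(3)[of c] X(3)[of "\<alpha> c"] by auto
    then show "a \<in> X \<longleftrightarrow> \<alpha> a \<in> X" using same opp_tails by metis
  qed (use C in \<open>auto simp: C_def\<close>)
  then obtain H where H: "H \<subseteq> D" "H \<noteq> {}" "\<forall>d\<in>H. \<phi> d \<in> H" "\<forall>d\<in>H. d \<in> D - C \<longrightarrow> \<alpha> d \<in> H" "H \<noteq> D"
    unfolding dual_connected_def by blast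
  have face: "\<phi> d \<in> H \<longleftrightarrow> d \<in> H" for d by (rule face_closed_iff[OF H(1,3)])
  have off: "\<alpha> d \<in> H \<longleftrightarrow> d \<in> H" if "d \<in> D" "d \<notin> C" for d
  proof -
    have "\<alpha> d \<in> D - C" using that C(2)[of "\<alpha> d"] by auto
    then show ?thesis using H(4) that by (metis DiffI opp_opp)
  qed
  \<comment> \<open>The change of side across the edge of \<open>d\<close>; as \<open>H\<close> is a
    union of faces, it is also the change from \<open>d\<close> to the next dart around its
    vertex.\<close>
  define s where "s d = (of_bool (\<alpha> d \<in> H) - of_bool (d \<in> H) :: int)" for d
  have s_opp: "s (\<alpha> d) = - s d" for d unfolding s_def by simp
  have s_rot: "s d = of_bool (\<sigma> d \<in> H) - of_bool (d \<in> H)" for d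
    unfolding s_def using face[of "\<alpha> d"] by (simp add: face_eq)
  \<comment> \<open>Once around a vertex of the cycle the changes of side add up to 0, and only the
    two darts of the cycle there contribute.\<close>
  have balance: "s y = s x" if xy: "x \<in> D" "y \<in> D" "tail M y \<inter> C = {y, \<alpha> x}" "y \<noteq> \<alpha> x" for x y
  proof -
    let ?w = "tail M y"
    have finw: "finite ?w" using finite_tail xy by blast
    have "bij_betw \<sigma> ?w ?w"
    proof -
      have "\<sigma> ` ?w \<subseteq> ?w" by (auto simp: in_tail_iff)
      moreover have "inj_on \<sigma> ?w" by (auto intro: inj_onI)
      ultimately show ?thesis using finw by (metis bij_betw_def endo_inj_surj)
    qed
    then have "sum (\<lambda>d. of_bool (\<sigma> d \<in> H) :: int) ?w = sum (\<lambda>d. of_bool (d \<in> H)) ?w"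
      by (rule sum.reindex_bij_betw)
    then have "sum s ?w = 0" unfolding s_rot by (simp add: sum_subtractf)
    moreover have "sum s (?w \<inter> C) = sum s ?w"
    proof (rule sum.mono_neutral_left)
      show "\<forall>d\<in>?w - ?w \<inter> C. s d = 0" using off tail_subset[OF xy(2)] unfolding s_def by auto
    qed (use finw in auto)
    ultimately show ?thesis using xy s_opp[of x] by simp
  qed
  have balance_abc: "s b = s a" "s c = s b"
  proof -
    have mem: "d \<in> tail M y \<longleftrightarrow> tail M d = tail M y" for d y by (rule in_tail_iff)
    have "tail M b \<inter> C = {b, \<alpha> a}" "tail M c \<inter> C = {c, \<alpha> b}"
      unfolding C_def using tails opp_tails tails[symmetric] by (auto simp: mem)
    moreover have "b \<noteq> \<alpha> a" "c \<noteq> \<alpha> b" using tails opp_tails opp_opp by metis+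
    ultimately show "s b = s a" "s c = s b" using balance abc by blast+
  qed
  \<comment> \<open>Otherwise \<open>H\<close> would be invariant under \<alpha> and \<sigma>,
    contrary to connectedness. By the balance, one nonzero value makes all of them nonzero.\<close>
  have "\<exists>d\<in>C. s d \<noteq> 0"
  proof (rule ccontr)
    assume "\<not> ?thesis"
    then have "\<alpha> d \<in> H \<longleftrightarrow> d \<in> H" if "d \<in> C" for d using that unfolding s_def by fastforce
    then have "\<alpha> d \<in> H \<longleftrightarrow> d \<in> H" if "d \<in> D" for d using off that by blast
    then have "\<forall>d\<in>H. \<alpha> d \<in> H \<and> \<sigma> d \<in> H" using H(1) face rot_eq by (metis subsetD)
    then show False using connectedness[unfolded cut_connected_def, rule_format, of H] H by blast
  qed
  then have "s d \<noteq> 0" if "d \<in> C" for d using that balance_abc s_opp unfolding C_def by auto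
  then have on: "\<alpha> d \<in> H \<longleftrightarrow> d \<notin> H" if "d \<in> C" for d using that unfolding s_def by fastforce
  show thesis using that[of H] face off on unfolding C_def by blast
qed

lemma rot_orbit_distinct:
  assumes "4 \<le> card (tail M x)"
  shows "\<sigma> x \<noteq> x" "\<sigma> (\<sigma> x) \<noteq> x" "\<sigma> (\<sigma> (\<sigma> x)) \<noteq> x"
proof -
  have le: "card (tail M x) \<le> 3" if "tail M x \<subseteq> {a, b, c}" for a b c
  proof -
    have "card (tail M x) \<le> card {a, b, c}" using that by (intro card_mono) auto
    also have "\<dots> \<le> 3" by (simp add: card_insert_if)
    finally show ?thesis .
  qed
  show "\<sigma> x \<noteq> x" using le[of x x x] assms orbit_eq_singleton_iff[of \<sigma> x] unfolding tail_def by force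
  show "\<sigma> (\<sigma> x) \<noteq> x" using le[of x "\<sigma> x" x] assms orbit_involution[of \<sigma> x] unfolding tail_def by force
  show "\<sigma> (\<sigma> (\<sigma> x)) \<noteq> x"
    using le[of x "\<sigma> x" "\<sigma> (\<sigma> x)"] assms orbit_of_period_3[of \<sigma> x] unfolding tail_def by force
qed

lemma face_face_rot: "x \<in> D \<Longrightarrow> \<phi> (\<phi> (\<sigma> x)) = \<alpha> x"
  using face3[of "\<alpha> x"] rot_eq[of x] by simp

text \<open>The corners opposite to the edge of \<open>\<sigma> x\<close> are the ends of the
  preceding and the following edge around its tail.\<close>

lemma flippable_rot_iff:
  assumes "x \<in> D"
  shows "flippable M (\<sigma> x) \<longleftrightarrow> head M x \<noteq> head M (\<sigma> (\<sigma> x)) \<and>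
    (\<forall>y\<in>D. tail M y = head M x \<longrightarrow> head M y \<noteq> head M (\<sigma> (\<sigma> x)))"
  unfolding flippable_def Let_def face_face_rot[OF assms] using rot_eq[of "\<sigma> x"]
  by (simp add: tail_opp tail_face)

text \<open>If neither edge can be flipped, chords \<open>y\<close> and \<open>z\<close> join the
  first to the third and the second to the fourth of four successive neighbours; degree at least 4
  makes these neighbours distinct. The 3-cycle through the tail of \<open>x\<close> and
  \<open>y\<close> separates the ends of \<open>z\<close>.\<close>

lemma crossing_chord_flippable:
  assumes x: "x \<in> D" and deg: "4 \<le> card (tail M x)"
  shows "flippable M (\<sigma> x) \<or> flippable M (\<sigma> (\<sigma> x))"
proof (rule ccontr)
  assume not: "\<not> ?thesis"
  define e1 e2 e3 where "e1 = \<sigma> x" "e2 = \<sigma> e1" "e3 = \<sigma> e2"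
  note e_defs = this
  have D: "e1 \<in> D" "e2 \<in> D" "e3 \<in> D" using x by (simp_all add: e_defs)
  have tails: "tail M e1 = tail M x" "tail M e2 = tail M x" "tail M e3 = tail M x" by (simp_all add: e_defs)
  have neq: "x \<noteq> e1" "x \<noteq> e2" "x \<noteq> e3" "e1 \<noteq> e2" "e1 \<noteq> e3" "e2 \<noteq> e3"
    using rot_orbit_distinct[OF deg] unfolding e_defs by (auto simp: eq_sym_conv)
  have heads: "head M x \<noteq> head M e1" "head M x \<noteq> head M e2" "head M x \<noteq> head M e3"
    "head M e1 \<noteq> head M e2" "head M e1 \<noteq> head M e3" "head M e2 \<noteq> head M e3"
    using simple neq x D tails by metis+
  obtain y where y: "y \<in> D" "tail M y = head M x" "head M y = head M e2"
    using not flippable_rot_iff[OF x] heads unfolding e_defs by blast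
  obtain z where z: "z \<in> D" "tail M z = head M e1" "head M z = head M e3"
    using not flippable_rot_iff[OF D(1)] heads unfolding e_defs by blast
  obtain H where H: "\<And>d. \<phi> d \<in> H \<longleftrightarrow> d \<in> H"
    "\<And>d. d \<in> D \<Longrightarrow> d \<notin> {x, y, \<alpha> e2, \<alpha> x, \<alpha> y, \<alpha> (\<alpha> e2)} \<Longrightarrow> \<alpha> d \<in> H \<longleftrightarrow> d \<in> H"
    "\<And>d. d \<in> {x, y, \<alpha> e2, \<alpha> x, \<alpha> y, \<alpha> (\<alpha> e2)} \<Longrightarrow> \<alpha> d \<in> H \<longleftrightarrow> d \<notin> H"
    using sides_of_3cycle[of x y "\<alpha> e2"] x y D tails tail_opp head_opp in_D_iff(2) by metis
  have Hrot: "\<sigma> d \<in> H \<longleftrightarrow> \<alpha> d \<in> H" for d using H(1) rot_eq by simp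
  have off: "\<alpha> d \<in> H \<longleftrightarrow> d \<in> H" if "d \<in> D" "d \<noteq> x" "d \<noteq> e2" "d \<noteq> y" "d \<noteq> \<alpha> x" "d \<noteq> \<alpha> e2" "d \<noteq> \<alpha> y" for d
    using H(2) that by auto
  \<comment> \<open>All darts at a vertex off the 3-cycle lie on the same side.\<close>
  have const: "d \<in> H \<longleftrightarrow> e \<in> H"
    if w: "d \<in> D" "tail M d = tail M e" "tail M d \<noteq> tail M x" "tail M d \<noteq> head M x" "tail M d \<noteq> head M e2" for d e
  proof -
    have 1: "\<sigma> d' \<in> H \<longleftrightarrow> d' \<in> H" if "tail M d' = tail M d" "d' \<in> D" for d'
    proof -
      have "d' \<noteq> x" "d' \<noteq> e2" "d' \<noteq> y" "d' \<noteq> \<alpha> x" "d' \<noteq> \<alpha> e2" "d' \<noteq> \<alpha> y"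
        using that w y tails tail_opp by metis+
      then show ?thesis using Hrot off that by blast
    qed
    have "orbit \<sigma> d \<subseteq> {d' \<in> tail M d. d' \<in> H \<longleftrightarrow> d \<in> H}"
    proof (rule orbit_subset_closed)
      fix d' assume "d' \<in> {d' \<in> tail M d. d' \<in> H \<longleftrightarrow> d \<in> H}"
      moreover from this have "d' \<in> D" using tail_subset[OF w(1)] by blast
      ultimately show "\<sigma> d' \<in> {d' \<in> tail M d. d' \<in> H \<longleftrightarrow> d \<in> H}"
        using 1[of d'] by (auto simp: in_tail_iff)
    qed simp
    moreover have "e \<in> orbit \<sigma> d" using w(2) in_tail[of e] unfolding tail_def by simp
    ultimately show ?thesis by blast
  qed
  have v: "head M e1 \<noteq> tail M x" "head M e3 \<noteq> tail M x" using no_loop D tails by metis+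
  have "e1 \<in> H \<longleftrightarrow> \<alpha> e1 \<in> H" "e3 \<in> H \<longleftrightarrow> \<alpha> e3 \<in> H" "z \<in> H \<longleftrightarrow> \<alpha> z \<in> H"
  proof -
    have "e1 \<noteq> y" "e3 \<noteq> y" "z \<noteq> x" "z \<noteq> e2" using y z no_loop x D tails heads v by metis+
    moreover have "e1 \<noteq> \<alpha> x" "e1 \<noteq> \<alpha> e2" "e1 \<noteq> \<alpha> y" "e3 \<noteq> \<alpha> x" "e3 \<noteq> \<alpha> e2" "e3 \<noteq> \<alpha> y"
      using y no_loop x D tails heads v head_opp tail_opp by metis+
    moreover have "z \<noteq> y" "z \<noteq> \<alpha> x" "z \<noteq> \<alpha> e2" "z \<noteq> \<alpha> y" using y z heads v tail_opp by metis+
    ultimately show "e1 \<in> H \<longleftrightarrow> \<alpha> e1 \<in> H" "e3 \<in> H \<longleftrightarrow> \<alpha> e3 \<in> H" "z \<in> H \<longleftrightarrow> \<alpha> z \<in> H"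
      using off D z(1) neq by metis+
  qed
  \<comment> \<open>Following the chord \<open>z\<close>, the darts \<open>e2\<close>,
    \<open>\<alpha> e1\<close>, \<open>z\<close>, \<open>\<alpha> z\<close>,
    \<open>\<alpha> e3\<close>, \<open>e3\<close>, \<open>\<alpha> e2\<close> all lie on the same
    side; but \<open>e2\<close> belongs to the cycle and has its two darts on different
    sides.\<close>
  moreover have "\<alpha> e1 \<in> H \<longleftrightarrow> z \<in> H"
    using D z heads v tails by (intro const) (auto simp: tail_opp)
  moreover have "\<alpha> e3 \<in> H \<longleftrightarrow> \<alpha> z \<in> H"
    using D z heads v tails by (intro const) (auto simp: tail_opp)
  moreover have "e2 \<in> H \<longleftrightarrow> \<alpha> e1 \<in> H" "e3 \<in> H \<longleftrightarrow> \<alpha> e2 \<in> H"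
    using Hrot unfolding e_defs by blast+
  moreover have "\<alpha> e2 \<in> H \<longleftrightarrow> e2 \<notin> H" using H(3)[of "\<alpha> e2"] by auto
  ultimately show False by blast
qed

end

section \<open>Degrees after a flip\<close>

context flip_triangulation
begin

text \<open>The new edge ends at the two opposite corners, so the vertex loses \<open>f\<close> and
  gains nothing.\<close>

lemma card_tail_flip:
  assumes "e \<in> D" "\<sigma> e = f" "1 < card (tail M e)"
  shows "card (tail M' e) = card (tail M e) - 1" "tail M' e \<subseteq> tail M e"
proof -
  have eS: "e \<in> S" 
  proof -
    have "e \<noteq> f"
    proof
      assume "e = f"
      then have "tail M e = {e}" using assms(2) orbit_eq_singleton_iff[of \<sigma> e] unfolding tail_def by simp
      then show False using assms(3) by simp
    qed
    moreover have "tail M e = tail M f" using assms(2) tail_rot[of e] by simp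
    ultimately show ?thesis using assms(1) tails_neq by auto
  qed
  have te: "tail M e = tail M f" using assms(2) tail_rot[of e] by simp
  have "tail M (shadow e) = tail M f" using eS te by (auto simp: shadow_def)
  then have "tail M' e \<noteq> tail M' f" "tail M' e \<noteq> tail M' g"
    using tail_flip_shadow[of e f] tail_flip_shadow[of e g] tails_neq assms(1) f in_D
    by (auto simp: shadow_def split: if_splits)
  then have 1: "f \<notin> tail M' e" "g \<notin> tail M' e" using tail_flip_eq_iff_in by metis+
  have 2: "f \<in> tail M e" "g \<notin> tail M e" using te tails_neq in_tail_iff by metis+
  have "tail M' e \<subseteq> D"
    unfolding tail_def using permutes_orbit_subset[OF rot_flip_permutes assms(1)] .
  then have "tail M' e = tail M e - {f}"
    using tail_flip_S[OF eS] 1 2 tail_subset[OF assms(1)] by auto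
  then show "card (tail M' e) = card (tail M e) - 1" "tail M' e \<subseteq> tail M e"
    using 2 finite_tail[OF assms(1)] by (simp_all add: card_Diff_singleton)
qed

text \<open>Only the four corners of the two faces, represented in \<open>M'\<close> by
  \<open>h\<close>, \<open>p\<close>, \<open>r\<close>, \<open>k\<close>, change their darts. Each
  that has degree 3 afterwards accounts for three darts, hence 12.\<close>

lemma card_degree_3_darts_flip:
  "card {d\<in>D. card (tail M' d) = 3} \<le> card {d\<in>D. card (tail M d) = 3} + 12"
proof -
  let ?U = "{tail M' z |z. z \<in> {h, p, r, k} \<and> card (tail M' z) = 3}"
  have finU: "finite ?U" by simp
  have cardU: "card (\<Union>?U) \<le> 12"
  proof -
    have sub: "?U \<subseteq> tail M' ` {h, p, r, k}" by blast
    have "card ?U \<le> card (tail M' ` {h, p, r, k})" using sub by (intro card_mono) auto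
    also have "\<dots> \<le> card {h, p, r, k}" by (rule card_image_le) simp
    also have "\<dots> \<le> 4" by (simp add: card_insert_if)
    finally have "card ?U \<le> 4" .
    have "card (\<Union>?U) \<le> sum card ?U"
      by (rule card_Union_le_sum_card)
    also have "\<dots> = 3 * card ?U" by (subst sum.cong[OF refl, of _ _ "\<lambda>_. 3"]) auto
    finally show ?thesis using \<open>card ?U \<le> 4\<close> by simp
  qed
  have "{d\<in>D. card (tail M' d) = 3} \<subseteq> {d\<in>D. card (tail M d) = 3} \<union> \<Union>?U"
  proof
    fix d assume d: "d \<in> {d\<in>D. card (tail M' d) = 3}"
    show "d \<in> {d\<in>D. card (tail M d) = 3} \<union> \<Union>?U"
    proof (cases "\<exists>z\<in>{h, p, r, k}. tail M' d = tail M' z")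
      case True
      then obtain z where "z \<in> {h, p, r, k}" "tail M' d = tail M' z" by blast
      then show ?thesis using d tail_flip_eq_iff_in[of d z] by auto
    next
      case False
      then have dS: "d \<in> S" using d tail_flip_fg by auto
      have "tail M d \<noteq> tail M f" "tail M d \<noteq> tail M g"
        using False tail_flip_eq_iff[OF dS] prhk_in_S tails by auto
      then have "f \<notin> tail M d" "g \<notin> tail M d" using in_tail_iff by metis+
      moreover have "f \<notin> tail M' d" "g \<notin> tail M' d" using False tail_flip_eq_iff_in tail_flip_fg by auto
      moreover have "tail M d \<subseteq> D" "tail M' d \<subseteq> D"
        using tail_subset permutes_orbit_subset[OF rot_flip_permutes] dS unfolding tail_def by auto
      ultimately have "tail M' d = tail M d" using tail_flip_S[OF dS] by blast
      then show ?thesis using d by auto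
    qed
  qed
  moreover have "finite (\<Union>?U)"
  proof -
    have "finite B" if "B \<in> ?U" for B using that card.infinite by fastforce
    then show ?thesis using finU by (intro finite_Union) auto
  qed
  ultimately have "card {d\<in>D. card (tail M' d) = 3} \<le> card ({d\<in>D. card (tail M d) = 3} \<union> \<Union>?U)"
    using fin by (intro card_mono) auto
  also have "\<dots> \<le> card {d\<in>D. card (tail M d) = 3} + card (\<Union>?U)" by (rule card_Un_le)
  finally show ?thesis using cardU by simp
qed

end

section \<open>Interior vertices of degree 3\<close>

context simple_triangulation
begin

lemma submap_simps:
  assumes "d \<in> S"
  shows "rot (submap M S F r) d = next_in \<sigma> S d" "opp (submap M S F r) d = \<alpha> d"
  using assms by (simp_all add: submap_def)

lemma darts_submap [simp]: "darts (submap M S F r) = S" "outer_face (submap M S F r) = F"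
  "root_dart (submap M S F r) = r"
  by (simp_all add: submap_def)

lemma submap_permutes:
  assumes "S \<subseteq> D" "\<And>d. d \<in> S \<Longrightarrow> \<alpha> d \<in> S"
  shows "rot (submap M S F r) permutes S" "opp (submap M S F r) permutes S"
proof -
  show "rot (submap M S F r) permutes S"
    unfolding submap_def using next_in_permutes[OF rot_permutes fin assms(1)] by simp
  have "bij_betw (opp (submap M S F r)) S S"
    by (rule bij_betw_byWitness[where f' = \<alpha>]) (use assms in \<open>auto simp: submap_def\<close>)
  then show "opp (submap M S F r) permutes S"
    by (rule bij_imp_permutes) (simp add: submap_def)
qed

lemma face_submap:
  assumes "d \<in> S" "\<And>d. d \<in> S \<Longrightarrow> \<alpha> d \<in> S"
  shows "face_perm (submap M S F r) d = next_in \<sigma> S (\<alpha> d)"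
  using assms by (simp add: face_perm_def submap_simps)

lemma tail_submap:
  assumes "d \<in> S"
  shows "tail (submap M S F r) d = tail M d \<inter> S"
proof -
  let ?n = "next_in \<sigma> S" and ?N = "submap M S F r"
  have o: "orbit ?n d = tail M d \<inter> S" unfolding tail_def by (rule orbit_next_in[OF rot_permutes fin assms])
  have "d \<in> orbit ?n d" using o assms by simp
  then have "orbit (rot ?N) d = orbit ?n d"
    by (rule orbit_cong) (use o in \<open>auto simp: submap_def\<close>)
  then show ?thesis using o unfolding tail_def by simp
qed

lemma tail_submap_eq_iff:
  assumes "d \<in> S" "e \<in> S"
  shows "tail (submap M S F r) d = tail (submap M S F r) e \<longleftrightarrow> tail M d = tail M e"
  using assms tail_submap in_tail in_tail_iff by (metis IntI Int_iff)

lemma vertices_submap: "card (vertices (submap M S F r)) = card (tail M ` S)"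
proof -
  have "vertices (submap M S F r) = tail (submap M S F r) ` S"
    unfolding vertices_def tail_def by simp
  then show ?thesis
    using card_image_eq_if_same_kernel[of S "tail (submap M S F r)" "tail M"] tail_submap_eq_iff by metis
qed

text \<open>Darts of a submap share a tail exactly if they do in \<open>M\<close>, so the absence of
  loops and multiple edges is inherited. The conditions left as hypotheses are stated with
  \<open>next_in\<close> because that is what can be computed in concrete submaps.\<close>

lemma submap_triangulation:
  assumes S: "S \<subseteq> D" "\<And>d. d \<in> S \<Longrightarrow> \<alpha> d \<in> S"
    and "cut_connected (submap M S F r)"
    and faces: "\<And>d. d \<in> S \<Longrightarrow> (let f = \<lambda>d. next_in \<sigma> S (\<alpha> d) in f (f (f d)) = d \<and> f d \<noteq> d)"
    and "6 * card (tail M ` S) = card S + 12"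
    and F: "o' \<in> S" "F = (let f = \<lambda>d. next_in \<sigma> S (\<alpha> d) in {o', f o', f (f o')})"
    and "r \<in> S" "r \<in> F \<or> \<alpha> r \<in> F"
  shows "three_connected_triangulation (submap M S F r)"
proof -
  let ?N = "submap M S F r"
  have f: "face_perm ?N d = next_in \<sigma> S (\<alpha> d)" "next_in \<sigma> S (\<alpha> d) \<in> S" if "d \<in> S" for d
    using face_submap[OF that S(2)] next_in_in_orbit(1)[OF rot_permutes fin S(2)[OF that]] by simp_all
  have o: "opp ?N d = \<alpha> d" if "d \<in> S" for d using submap_simps(2) that .
  have h: "head ?N d = tail ?N (\<alpha> d)" if "d \<in> S" for d using o that by (simp add: head_def)
  have "tail ?N d \<noteq> head ?N d" if "d \<in> S" for d
    using tail_submap_eq_iff[of d S "\<alpha> d"] h that S no_loop[of d] by (auto simp: tail_opp)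
  moreover have "d = e" if "d \<in> S" "e \<in> S" "tail ?N d = tail ?N e" "head ?N d = head ?N e" for d e
  proof -
    have "d \<in> D" "e \<in> D" using that S by blast+
    then show ?thesis
      using tail_submap_eq_iff[of d S e] tail_submap_eq_iff[of "\<alpha> d" S "\<alpha> e"] h that S(2) simple[of d e]
      by (simp add: tail_opp)
  qed
  ultimately show ?thesis
    unfolding three_connected_triangulation_iff
    using assms submap_permutes[OF S] finite_subset[OF S(1) fin] f o opp_neq vertices_submap
    by (auto simp: Let_def)
qed

end

text \<open>The fifth vertex excludes the tetrahedron, in which no vertex lies outside the
  link.\<close>

locale degree_3_vertex = simple_triangulation +
  fixes x
  assumes x: "x \<in> D" and degree_3: "card (tail M x) = 3"
    and interior: "tail M x \<inter> outer_face M = {}"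
    and five_vertices: "5 \<le> card (vertices M)"
begin

text \<open>The link of the vertex is traversed by the darts \<open>W s\<close>, which have the outside to their
  right; \<open>Z s\<close> is the reverse of \<open>W s\<close>.\<close>

definition "Z s = \<phi> (\<sigma> s)"
definition "W s = \<alpha> (Z s)"

abbreviation "spokes \<equiv> tail M x"

lemma rot_period: "s \<in> spokes \<Longrightarrow> \<sigma> (\<sigma> (\<sigma> s)) = s" "s \<in> spokes \<Longrightarrow> \<sigma> s \<noteq> s" "s \<in> spokes \<Longrightarrow> \<sigma> (\<sigma> s) \<noteq> s"
proof -
  assume s: "s \<in> spokes"
  then have "card (orbit \<sigma> s) = 3" using degree_3 in_tail_iff unfolding tail_def by metis
  then show "\<sigma> (\<sigma> (\<sigma> s)) = s" "\<sigma> s \<noteq> s"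
    using period_3_of_card_orbit[OF rot_permutes fin] by blast+
  then show "\<sigma> (\<sigma> s) \<noteq> s" by metis
qed

lemma spokes_eq: "spokes = {x, \<sigma> x, \<sigma> (\<sigma> x)}"
  using orbit_of_period_3[of \<sigma> x] rot_period(1)[OF in_tail] unfolding tail_def by simp

lemma spoke_step: "s \<in> spokes \<Longrightarrow> \<sigma> s \<in> spokes"
  by (simp add: in_tail_iff)

lemma spoke_in_D: "s \<in> spokes \<Longrightarrow> s \<in> D"
  using tail_subset[OF x] by blast

lemma ZW_in_D: "s \<in> spokes \<Longrightarrow> Z s \<in> D" "s \<in> spokes \<Longrightarrow> W s \<in> D"
  unfolding W_def Z_def using spoke_in_D by auto

text \<open>The three faces at the vertex are \<open>(\<alpha> s, \<sigma> s, Z s)\<close> for its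
  spokes \<open>s\<close>; the other equations are rearrangements of this.\<close>

lemma link_steps:
  assumes "s \<in> spokes"
  shows "\<phi> (\<alpha> s) = \<sigma> s" "\<phi> (\<sigma> s) = Z s" "\<phi> (Z s) = \<alpha> s" "\<sigma> (\<alpha> s) = Z (\<sigma> (\<sigma> s))" "\<sigma> (W s) = \<alpha> s"
    "\<alpha> (W s) = Z s" "\<alpha> (Z s) = W s" "\<phi> s = Z (\<sigma> (\<sigma> s))"
proof -
  have D: "s \<in> D" using spoke_in_D assms .
  show "\<phi> (\<alpha> s) = \<sigma> s" "\<phi> (\<sigma> s) = Z s" "\<alpha> (W s) = Z s" "\<alpha> (Z s) = W s"
    unfolding W_def Z_def by (simp_all add: rot_eq)
  show "\<phi> (Z s) = \<alpha> s" unfolding Z_def using D by (rule face_face_rot)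
  then show "\<sigma> (W s) = \<alpha> s" unfolding W_def by (simp add: rot_eq)
  show "\<phi> s = Z (\<sigma> (\<sigma> s))" unfolding Z_def using rot_period(1)[OF assms] by simp
  then show "\<sigma> (\<alpha> s) = Z (\<sigma> (\<sigma> s))" by (simp add: rot_eq)
qed

lemma link_vertices:
  assumes "s \<in> spokes"
  shows "tail M s = spokes" "tail M (\<alpha> s) = head M s" "tail M (Z s) = head M (\<sigma> s)" "tail M (W s) = head M s"
    "head M (W s) = head M (\<sigma> s)" "head M (Z s) = head M s" "head M s \<noteq> spokes"
proof -
  show 1: "tail M s = spokes" using assms by (simp add: in_tail_iff)
  show "head M s \<noteq> spokes" using no_loop[OF spoke_in_D[OF assms]] 1 by simp
  show 2: "tail M (\<alpha> s) = head M s" by (rule tail_opp)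
  show 3: "tail M (Z s) = head M (\<sigma> s)" unfolding Z_def by (rule tail_face)
  show "tail M (W s) = head M s" using link_steps(5)[OF assms] tail_rot[of "W s"] 2 by simp
  then show "head M (Z s) = head M s" "head M (W s) = head M (\<sigma> s)"
    using link_steps(6,7)[OF assms] 3 tail_opp by metis+
qed

lemma spoke_heads_eq_iff: "s \<in> spokes \<Longrightarrow> s' \<in> spokes \<Longrightarrow> head M s = head M s' \<longleftrightarrow> s = s'"
  using simple spoke_in_D link_vertices(1) by metis

lemma tail_eq_head_spoke:
  assumes "s \<in> spokes" "s' \<in> spokes"
  shows "tail M (W s') = head M s \<longleftrightarrow> s' = s" "tail M (Z s') = head M s \<longleftrightarrow> s' = \<sigma> (\<sigma> s)"
    "tail M (\<alpha> s') = head M s \<longleftrightarrow> s' = s"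
proof -
  show "tail M (W s') = head M s \<longleftrightarrow> s' = s" "tail M (\<alpha> s') = head M s \<longleftrightarrow> s' = s"
    using link_vertices[OF assms(2)] spoke_heads_eq_iff assms by auto
  have "tail M (Z s') = head M s \<longleftrightarrow> \<sigma> s' = s"
    using link_vertices[OF assms(2)] spoke_heads_eq_iff assms spoke_step by auto
  then show "tail M (Z s') = head M s \<longleftrightarrow> s' = \<sigma> (\<sigma> s)" using rot_period(1) assms by metis
qed

text \<open>\<open>C\<close> is the link with both directions of its edges; \<open>I\<close>
  consists of the nine darts of the three faces at the vertex.\<close>

definition "C = Z ` spokes \<union> W ` spokes"
definition "I = spokes \<union> \<alpha> ` spokes \<union> Z ` spokes"

lemma link_darts_distinct:
  assumes "s \<in> spokes" "s' \<in> spokes"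
  shows "s \<noteq> \<alpha> s'" "s \<noteq> Z s'" "s \<noteq> W s'" "\<alpha> s \<noteq> Z s'" "\<alpha> s \<noteq> W s'" "Z s \<noteq> W s'"
proof -
  note v = link_vertices[OF assms(1)] link_vertices[OF assms(2)] link_vertices(7)[OF spoke_step[OF assms(1)]]
    link_vertices(7)[OF spoke_step[OF assms(2)]]
  show "s \<noteq> \<alpha> s'" "s \<noteq> Z s'" "s \<noteq> W s'" "\<alpha> s \<noteq> Z s'" "\<alpha> s \<noteq> W s'"
    using v head_opp[of s] by metis+
  show "Z s \<noteq> W s'"
  proof
    assume "Z s = W s'"
    then have "head M (\<sigma> s) = head M s'" "head M s = head M (\<sigma> s')" using v by metis+
    then have "\<sigma> s = s'" "s = \<sigma> s'" using spoke_heads_eq_iff assms spoke_step by metis+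
    then show False using rot_period(3)[OF assms(1)] by simp
  qed
qed

lemma link_darts_disjoint:
  "spokes \<inter> \<alpha> ` spokes = {}" "spokes \<inter> Z ` spokes = {}" "spokes \<inter> W ` spokes = {}"
  "\<alpha> ` spokes \<inter> Z ` spokes = {}" "\<alpha> ` spokes \<inter> W ` spokes = {}" "Z ` spokes \<inter> W ` spokes = {}"
  using link_darts_distinct by blast+

lemma C_subset: "C \<subseteq> D"
  unfolding C_def using ZW_in_D by blast

lemma I_subset: "I \<subseteq> D"
  unfolding I_def using ZW_in_D spoke_in_D by auto

lemma face_I_iff: "\<phi> d \<in> I \<longleftrightarrow> d \<in> I"
proof (rule closed_permutes_iff[OF face_permutes fin I_subset])
  fix d assume "d \<in> I"
  then show "\<phi> d \<in> I" unfolding I_def using link_steps spoke_step by auto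
qed

lemma rot_face_closed_all:
  assumes "X \<subseteq> D" "X \<noteq> {}" "\<And>d. d \<in> X \<Longrightarrow> \<phi> d \<in> X" "\<And>d. d \<in> X \<Longrightarrow> \<alpha> d \<in> X"
  shows "X = D"
  using connectedness[unfolded cut_connected_def, rule_format, of X] assms rot_eq by simp

text \<open>The faces forming \<open>I\<close> can be left only across \<open>C\<close>, so the
  search from the outer face never enters them. Conversely, what it reaches together with
  \<open>I\<close> is invariant under \<phi> and \<alpha>, provided that it reaches every
  \<open>W s\<close>.\<close>

lemma outside: "outside_darts M C = D - I"
proof -
  let ?R = "outside_darts M C"
  let ?r = "{(x, \<phi> x) |x. x \<in> D} \<union> {(x, \<alpha> x) |x. x \<in> D - C}"
  have outer_I: "outer_face M \<inter> I = {}"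
  proof -
    have "\<alpha> s \<notin> outer_face M \<and> Z s \<notin> outer_face M" if "s \<in> spokes" for s
      using outer_closed[of "\<alpha> s"] outer_closed[of "Z s"] link_steps[OF that] spoke_step[OF that] interior by auto
    then show ?thesis using interior unfolding I_def by blast
  qed
  have R1: "?R \<subseteq> D - I"
  proof
    fix e assume "e \<in> ?R"
    then obtain d where d: "d \<in> outer_face M" "(d, e) \<in> ?r\<^sup>*" unfolding outside_darts_def by blast
    from d(2) show "e \<in> D - I"
    proof induction
      case base
      then show ?case using d(1) outer_subset outer_I by blast
    next
      case (step a b)
      have "\<alpha> a \<notin> I" if "a \<notin> C"
      proof
        assume "\<alpha> a \<in> I"
        then have "a \<in> \<alpha> ` I" by (metis image_eqI opp_opp)
        then obtain d where d: "d \<in> I" "a = \<alpha> d" by blast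
        then consider "a \<in> \<alpha> ` spokes" | "a \<in> spokes" | s where "s \<in> spokes" "a = W s"
          unfolding I_def W_def by fastforce
        then show False using that step(3) unfolding I_def C_def by cases blast+
      qed
      moreover have "b = \<phi> a \<or> b = \<alpha> a \<and> a \<notin> C" using step(2) by blast
      moreover have "a \<in> D" "a \<notin> I" using step(3) by auto
      ultimately show ?case using face_I_iff in_D_iff by (metis DiffI)
    qed
  qed
  have Rface: "\<phi> d \<in> ?R" if "d \<in> ?R" for d
  proof -
    have "(d, \<phi> d) \<in> ?r" using that R1 by blast
    then show ?thesis using that unfolding outside_darts_def by (blast intro: rtrancl_into_rtrancl)
  qed
  have Ropp: "\<alpha> d \<in> ?R" if "d \<in> ?R" "d \<notin> C" for d
  proof -
    have "(d, \<alpha> d) \<in> ?r" using that R1 by blast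
    then show ?thesis using that unfolding outside_darts_def by (blast intro: rtrancl_into_rtrancl)
  qed
  have Rne: "?R \<noteq> {}" using outer unfolding outside_darts_def by auto
  have RZ: "Z s \<notin> ?R" if "s \<in> spokes" for s using R1 that unfolding I_def by blast
  \<comment> \<open>Cross the face to the right of the preceding link dart and turn around the head
    of \<open>s\<close>. Without meeting \<open>W s\<close> the search would run through the entire
    vertex and reach \<open>\<alpha> s\<close>, which lies inside.\<close>
  have W_step: "W s \<in> ?R" if s: "s \<in> spokes" and W: "W (\<sigma> (\<sigma> s)) \<in> ?R" for s
  proof (rule ccontr)
    assume no: "W s \<notin> ?R"
    let ?b = "\<phi> (W (\<sigma> (\<sigma> s)))"
    have b: "?b = \<sigma> (Z (\<sigma> (\<sigma> s)))" using link_steps(6) s spoke_step rot_eq unfolding W_def by metis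
    have ss: "\<sigma> (\<sigma> s) \<in> spokes" using s spoke_step by blast
    have tb: "tail M ?b = head M s"
      unfolding b tail_rot using tail_eq_head_spoke(2)[OF s ss] by simp
    have "orbit \<sigma> ?b \<subseteq> ?R \<inter> tail M ?b"
    proof (rule orbit_subset_closed)
      fix d assume d: "d \<in> ?R \<inter> tail M ?b"
      then have td: "tail M d = head M s" using tb in_tail_iff[of d ?b] by simp
      have "d \<notin> C"
      proof
        assume "d \<in> C"
        then obtain s' where s': "s' \<in> spokes" "d = W s'" using RZ d unfolding C_def by blast
        then show False using tail_eq_head_spoke(1)[OF s s'(1)] td no d by auto
      qed
      then have "\<sigma> d \<in> ?R" using d Ropp[of d] Rface[of "\<alpha> d"] rot_eq[of d] by simp
      moreover have "\<sigma> d \<in> tail M ?b" unfolding in_tail_iff tail_rot using td tb by simp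
      ultimately show "\<sigma> d \<in> ?R \<inter> tail M ?b" by blast
    qed (use Rface W in auto)
    moreover have "\<alpha> s \<in> orbit \<sigma> ?b"
      using tb in_tail_iff[of "\<alpha> s" ?b] tail_opp[of s] unfolding tail_def by simp
    ultimately show False using R1 s unfolding I_def by blast
  qed
  have W_all: "W s \<in> ?R" if "s \<in> spokes" "s' \<in> spokes" "W s' \<in> ?R" for s s'
  proof -
    have "W (\<sigma> t) \<in> ?R" if "t \<in> spokes" "W t \<in> ?R" for t
      using W_step[of "\<sigma> t"] that spoke_step rot_period(1) by metis
    moreover have "s = s' \<or> s = \<sigma> s' \<or> s = \<sigma> (\<sigma> s')"
      using that(1,2) rot_period(1)[of x] x spokes_eq by auto
    ultimately show ?thesis using that spoke_step by metis
  qed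
  \<comment> \<open>Otherwise the search never meets \<open>C\<close>; its result is then invariant
    under \<alpha> as well and would be all of \<open>D\<close>.\<close>
  have "\<exists>s\<in>spokes. W s \<in> ?R"
  proof (rule ccontr)
    assume "\<not> ?thesis"
    then have "?R \<inter> C = {}" using RZ unfolding C_def by blast
    then have "?R = D" using R1 Rne Rface Ropp by (intro rot_face_closed_all) blast+
    then show False using R1 x in_tail[of x] unfolding I_def by blast
  qed
  then have W: "W s \<in> ?R" if "s \<in> spokes" for s using W_all that by blast
  have "?R \<union> I = D"
  proof (rule rot_face_closed_all)
    fix d assume d: "d \<in> ?R \<union> I"
    then show "\<phi> d \<in> ?R \<union> I" using Rface face_I_iff by blast
    show "\<alpha> d \<in> ?R \<union> I"
    proof (cases "d \<in> I")
      case True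
      then show ?thesis using W link_steps unfolding I_def by auto
    next
      case False
      then have "d \<in> ?R" using d by blast
      then have "d \<in> C \<Longrightarrow> d \<in> W ` spokes" using RZ unfolding C_def by blast
      show ?thesis
      proof (cases "d \<in> C")
        case True
        then obtain s where "s \<in> spokes" "d = W s" using \<open>d \<in> C \<Longrightarrow> d \<in> W ` spokes\<close> by blast
        then have "\<alpha> d \<in> Z ` spokes" using link_steps(6) by simp
        then show ?thesis unfolding I_def by blast
      qed (use Ropp \<open>d \<in> ?R\<close> in blast)
    qed
  qed (use R1 I_subset Rne in auto)
  then show ?thesis using R1 by blast
qed

lemma inside: "inside_darts M C = I"
  unfolding inside_darts_def outside using I_subset by blast

lemma link_is_3cycle: "is_3cycle M C"
  unfolding is_3cycle_def
proof (intro bexI conjI)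
  have sp: "x \<in> spokes" "\<sigma> x \<in> spokes" "\<sigma> (\<sigma> x) \<in> spokes" using spokes_eq by auto
  note v = sp[THEN link_vertices(4)] sp[THEN link_vertices(5)] rot_period[OF sp(1)]
  show "head M (W x) = tail M (W (\<sigma> x))" "head M (W (\<sigma> x)) = tail M (W (\<sigma> (\<sigma> x)))"
    "head M (W (\<sigma> (\<sigma> x))) = tail M (W x)" using v by simp_all
  show "tail M (W x) \<noteq> tail M (W (\<sigma> x))" "tail M (W (\<sigma> x)) \<noteq> tail M (W (\<sigma> (\<sigma> x)))"
    "tail M (W (\<sigma> (\<sigma> x))) \<noteq> tail M (W x)"
    using v sp spoke_heads_eq_iff by auto
  show "C = {W x, W (\<sigma> x), W (\<sigma> (\<sigma> x)), \<alpha> (W x), \<alpha> (W (\<sigma> x)), \<alpha> (W (\<sigma> (\<sigma> x)))}"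
    unfolding C_def using sp[THEN link_steps(6)] by (subst (1 2) spokes_eq) auto
  show "W x \<in> D" "W (\<sigma> x) \<in> D" "W (\<sigma> (\<sigma> x)) \<in> D" using sp ZW_in_D by auto
qed

lemma I_C_tails:
  assumes "d \<in> I \<union> C"
  shows "tail M d \<in> insert spokes (head M ` spokes)"
proof -
  obtain s where "s \<in> spokes" "d = s \<or> d = \<alpha> s \<or> d = Z s \<or> d = W s"
    using assms unfolding I_def C_def by blast
  then show ?thesis using link_vertices(1-4)[of s] spoke_step[of s] by (metis image_eqI insertCI)
qed

lemma card_link_vertices: "card (insert spokes (head M ` spokes)) = 4"
proof -
  have "inj_on (head M) spokes" using spoke_heads_eq_iff by (auto intro: inj_onI)
  then have "card (head M ` spokes) = 3" using degree_3 card_image by metis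
  moreover have "spokes \<notin> head M ` spokes" using link_vertices(7) by blast
  moreover have "finite (head M ` spokes)" using finite_tail[OF x] by simp
  ultimately show ?thesis by simp
qed

lemma link_separating: "separating_3cycle M C"
  unfolding separating_3cycle_def outside inside
proof (intro conjI)
  have "spokes \<subseteq> I - C" unfolding I_def C_def using link_darts_disjoint by blast
  moreover have "spokes \<in> vertices M" using vertices_eq x by blast
  ultimately show "\<exists>v\<in>vertices M. v \<subseteq> I - C" by blast
  \<comment> \<open>The vertex and its three neighbours are only four; any fifth vertex has no dart
    in \<open>I\<close> or \<open>C\<close> and lies outside.\<close>
  have "\<not> vertices M \<subseteq> insert spokes (head M ` spokes)"
  proof
    assume "vertices M \<subseteq> insert spokes (head M ` spokes)"
    then have "card (vertices M) \<le> card (insert spokes (head M ` spokes))"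
      using finite_tail[OF x] by (intro card_mono) auto
    then show False using card_link_vertices five_vertices by linarith
  qed
  then obtain v where "v \<in> vertices M" "v \<notin> insert spokes (head M ` spokes)" by blast
  then obtain d where d: "d \<in> D" "tail M d \<notin> insert spokes (head M ` spokes)"
    unfolding vertices_eq by (metis imageE)
  have "tail M d \<subseteq> D - I - C"
  proof
    fix e assume e: "e \<in> tail M d"
    then have "tail M e = tail M d" using in_tail_iff by blast
    then have "e \<notin> I \<union> C" using d(2) I_C_tails[of e] by metis
    then show "e \<in> D - I - C" using e tail_subset[OF d(1)] by blast
  qed
  then show "\<exists>v\<in>vertices M. v \<subseteq> D - I - C" using d vertices_eq by blast
qed (rule link_is_3cycle)

abbreviation "S\<^sub>o \<equiv> D - (spokes \<union> \<alpha> ` spokes)"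

lemma C_in_outer: "C \<subseteq> S\<^sub>o"
proof -
  have "C \<inter> (spokes \<union> \<alpha> ` spokes) = {}"
    unfolding C_def Int_Un_distrib Int_Un_distrib2 using link_darts_disjoint by (simp add: Int_commute)
  then show ?thesis using C_subset by blast
qed

lemma outer_darts: "D - I \<union> C = S\<^sub>o"
  using C_in_outer unfolding I_def C_def by auto

text \<open>When the spokes are deleted, the only dart skipped around a neighbour of the vertex is
  \<open>\<alpha> s\<close>, which sits between \<open>W s\<close> and
  \<open>Z (\<sigma> (\<sigma> s))\<close>.\<close>

lemma next_in_outer:
  assumes "d \<in> S\<^sub>o"
  shows "d \<notin> W ` spokes \<Longrightarrow> next_in \<sigma> S\<^sub>o d = \<sigma> d"
    and "s \<in> spokes \<Longrightarrow> next_in \<sigma> S\<^sub>o (W s) = Z (\<sigma> (\<sigma> s))"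
proof -
  assume d: "d \<notin> W ` spokes"
  have "\<sigma> d \<notin> spokes" using assms by (auto simp: in_tail_iff)
  moreover have "\<sigma> d \<noteq> \<alpha> s" if "s \<in> spokes" for s
    using d that link_steps(5)[OF that] eq_iff(1) by (metis image_eqI)
  ultimately show "next_in \<sigma> S\<^sub>o d = \<sigma> d" using assms by (intro next_in_eq) auto
next
  assume s: "s \<in> spokes"
  have "Z (\<sigma> (\<sigma> s)) \<in> S\<^sub>o" using C_in_outer s spoke_step unfolding C_def by blast
  then show "next_in \<sigma> S\<^sub>o (W s) = Z (\<sigma> (\<sigma> s))"
    using link_steps[OF s] next_in_skip[of \<sigma> "W s" S\<^sub>o] s by auto
qed

text \<open>Removing the vertex costs one vertex and six darts, in accordance with Euler's formula,
  and merges its three faces into the single triangle of the darts \<open>Z s\<close>.\<close>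

lemma outer_part_triangulation:
  "three_connected_triangulation (outer_part M C (root_dart M))"
  "4 \<le> card (vertices (outer_part M C (root_dart M)))"
proof -
  let ?S = "S\<^sub>o" and ?N = "submap M S\<^sub>o (outer_face M) (root_dart M)"
  let ?f = "\<lambda>d. next_in \<sigma> ?S (\<alpha> d)"
  have N: "outer_part M C (root_dart M) = ?N" unfolding outer_part_def outside outer_darts ..
  have opp: "\<alpha> d \<in> ?S" if "d \<in> ?S" for d using that by (auto, metis image_eqI opp_opp)
  have f1: "?f d = \<phi> d" if "d \<in> ?S" "d \<notin> Z ` spokes" for d
  proof -
    have "\<alpha> d \<notin> W ` spokes" using that(2) link_steps(6) by (auto, metis image_eqI opp_opp)
    then show ?thesis using next_in_outer(1)[OF opp[OF that(1)]] by (simp add: face_eq)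
  qed
  have f2: "?f (Z s) = Z (\<sigma> (\<sigma> s))" if "s \<in> spokes" for s
    using that next_in_outer(2) link_steps(7) C_in_outer unfolding C_def by fastforce
  have f1_in: "\<phi> d \<in> ?S \<and> \<phi> d \<notin> Z ` spokes" if "d \<in> ?S" "d \<notin> Z ` spokes" for d
    using that face_I_iff[of d] unfolding I_def by auto
  have tails: "tail M ` ?S = vertices M - {spokes}"
  proof
    show "tail M ` ?S \<subseteq> vertices M - {spokes}"
      using vertices_eq in_tail by blast
    show "vertices M - {spokes} \<subseteq> tail M ` ?S"
    proof
      fix v assume v: "v \<in> vertices M - {spokes}"
      then obtain d where d: "d \<in> D" "v = tail M d" using vertices_eq by blast
      then have "d \<notin> spokes" using v in_tail_iff by blast
      show "v \<in> tail M ` ?S"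
      proof (cases "d \<in> \<alpha> ` spokes")
        case True
        then obtain s where "s \<in> spokes" "d = \<alpha> s" by blast
        then have "v = tail M (W s)" "W s \<in> ?S"
          using d(2) link_vertices(2,4)[of s] C_in_outer unfolding C_def by auto
        then show ?thesis by blast
      qed (use d \<open>d \<notin> spokes\<close> in blast)
    qed
  qed
  have finv: "finite (vertices M)" using vertices_eq fin by simp
  have cv: "card (tail M ` ?S) = card (vertices M) - 1"
    unfolding tails using x vertices_eq finv by (subst card_Diff_singleton) auto
  have "card (spokes \<union> \<alpha> ` spokes) = 6"
  proof -
    have "spokes \<inter> \<alpha> ` spokes = {}" by (rule link_darts_disjoint)
    moreover have "card (\<alpha> ` spokes) = 3" using degree_3 by (subst card_image) (auto intro: inj_onI)
    ultimately show ?thesis using degree_3 finite_tail[OF x] by (subst card_Un_disjoint) auto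
  qed
  moreover have "spokes \<union> \<alpha> ` spokes \<subseteq> D" using spoke_in_D by auto
  ultimately have cS: "card ?S + 6 = card D" using fin
    by (metis add.commute card_Diff_subset card_mono finite_subset le_add_diff_inverse)
  \<comment> \<open>If \<open>X\<close> contains no \<open>W s\<close>, it is already invariant in
    \<open>M\<close>. Otherwise it contains all of them and becomes invariant in \<open>M\<close>
    when the spokes and their reverses are added.\<close>
  have connected': "cut_connected ?N" unfolding cut_connected_def darts_submap
  proof (intro allI impI)
    fix X assume X: "X \<subseteq> ?S" "X \<noteq> {}" "\<forall>d\<in>X. rot ?N d \<in> X" "\<forall>d\<in>X. opp ?N d \<in> X"
    have XS: "d \<in> ?S" if "d \<in> X" for d using that X(1) by (rule subsetD[rotated])
    have nx: "next_in \<sigma> ?S d \<in> X" if "d \<in> X" for d using X(3) that submap_simps(1)[OF XS[OF that]] by metis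
    have op: "\<alpha> d \<in> X" if "d \<in> X" for d using X(4) that submap_simps(2)[OF XS[OF that]] by metis
    have Zs: "Z (\<sigma> (\<sigma> s)) \<in> X" if "s \<in> spokes" "W s \<in> X" for s
      using nx[OF that(2)] next_in_outer(2)[OF _ that(1)] that X(1) by (metis subsetD)
    have WW: "W (\<sigma> (\<sigma> s)) \<in> X" if "s \<in> spokes" "W s \<in> X" for s
      using op[OF Zs[OF that]] unfolding W_def .
    have all: "W s \<in> X" if "s \<in> spokes" "s' \<in> spokes" "W s' \<in> X" for s s'
    proof -
      have "s = s' \<or> s = \<sigma> (\<sigma> s') \<or> s = \<sigma> (\<sigma> (\<sigma> (\<sigma> s')))"
        using that(1,2) rot_period(1)[of x] spokes_eq by auto
      then show ?thesis using that WW spoke_step by metis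
    qed
    have "\<exists>s\<in>spokes. W s \<in> X"
    proof (rule ccontr)
      assume no: "\<not> ?thesis"
      have "\<sigma> d \<in> X" if "d \<in> X" for d
        using nx[OF that] next_in_outer(1)[of d] no that X(1) by (metis imageE subsetD)
      then have "X = D" using connectedness[unfolded cut_connected_def, rule_format, of X] X op by blast
      then show False using X(1) x in_tail[of x] by blast
    qed
    then have allW: "W s \<in> X" if "s \<in> spokes" for s using all that by blast
    let ?Y = "X \<union> spokes \<union> \<alpha> ` spokes"
    have allZ: "Z s \<in> X" if "s \<in> spokes" for s using op[OF allW[OF that]] link_steps(6)[OF that] by simp
    have "?Y = D"
    proof (rule connectedness[unfolded cut_connected_def, rule_format, of ?Y])
      show "?Y \<subseteq> D" using X(1) spoke_in_D by auto
      show "?Y \<noteq> {}" using X by blast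
      fix d assume d: "d \<in> ?Y"
      show "\<alpha> d \<in> ?Y" using d op by auto
      consider "d \<in> spokes" | s where "s \<in> spokes" "d = \<alpha> s" | s where "s \<in> spokes" "d = W s"
        | "d \<in> X" "d \<notin> W ` spokes" using d by blast
      then show "\<sigma> d \<in> ?Y"
      proof cases
        case 2
        then show ?thesis using allZ spoke_step link_steps(4) by auto
      next
        case 4
        then have "\<sigma> d \<in> X" using nx[of d] next_in_outer(1)[OF XS] by simp
        then show ?thesis by blast
      qed (use spoke_step link_steps in auto)
    qed
    then show "X = ?S" using X(1) by blast
  qed
  have faces: "?f (?f (?f d)) = d \<and> ?f d \<noteq> d" if d: "d \<in> ?S" for d
  proof (cases "d \<in> Z ` spokes")
    case True
    then obtain s where s: "s \<in> spokes" "d = Z s" by blast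
    have "\<sigma> (\<sigma> s) \<in> spokes" "\<sigma> (\<sigma> (\<sigma> (\<sigma> s))) \<in> spokes" using s spoke_step by blast+
    then have "?f (?f (?f d)) = Z (\<sigma> (\<sigma> (\<sigma> (\<sigma> (\<sigma> (\<sigma> s))))))" using s f2 by metis
    moreover have "?f d \<noteq> d" using f2 s rot_period(3)[OF s(1)] unfolding Z_def by auto
    ultimately show ?thesis using rot_period(1)[OF s(1)] s by simp
  next
    case False
    then have d1: "\<phi> d \<in> ?S \<and> \<phi> d \<notin> Z ` spokes" using d f1_in by blast
    then have d2: "\<phi> (\<phi> d) \<in> ?S \<and> \<phi> (\<phi> d) \<notin> Z ` spokes" using f1_in by blast
    have "?f d = \<phi> d" "?f (\<phi> d) = \<phi> (\<phi> d)" "?f (\<phi> (\<phi> d)) = \<phi> (\<phi> (\<phi> d))"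
      using d False d1 d2 f1 by simp_all
    then show ?thesis using face3 face_neq d by auto
  qed
  have outerS: "outer_face M \<inter> I = {}"
  proof -
    have "outer_face M \<subseteq> outside_darts M C" unfolding outside_darts_def by auto
    then show ?thesis using outside by blast
  qed
  obtain d where d: "d \<in> D" "outer_face M = {d, \<phi> d, \<phi> (\<phi> d)}" using outer by blast
  have dS: "d \<in> ?S" "d \<notin> Z ` spokes" using outerS d unfolding I_def by blast+
  have of: "outer_face M = {d, ?f d, ?f (?f d)}"
    using f1[OF dS] f1[of "\<phi> d"] f1_in[OF dS] d(2) by simp
  \<comment> \<open>Both faces at a spoke lie inside, but the root edge borders the outer
    face.\<close>
  have "root_dart M \<notin> spokes \<union> \<alpha> ` spokes"
  proof
    assume "root_dart M \<in> spokes \<union> \<alpha> ` spokes"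
    then have "root_dart M \<in> I" "\<alpha> (root_dart M) \<in> I" unfolding I_def by auto
    then show False using root(2) outerS by blast
  qed
  then have rS: "root_dart M \<in> ?S" using root(1) by blast
  show "three_connected_triangulation (outer_part M C (root_dart M))" unfolding N
  proof (rule submap_triangulation)
    show "6 * card (tail M ` ?S) = card ?S + 12" using cv euler cS five_vertices by linarith
    show "outer_face M = (let f = ?f in {d, f d, f (f d)})" unfolding Let_def by (rule of)
  qed (use opp connected' faces dS rS root in \<open>auto simp: Let_def\<close>)
  show "4 \<le> card (vertices (outer_part M C (root_dart M)))"
    unfolding N vertices_submap cv using five_vertices by simp
qed

abbreviation "S\<^sub>i \<equiv> I \<union> C"

text \<open>Around a link vertex only the step from \<open>Z s\<close> may skip darts of
  \<open>M\<close>. Its target is found by elimination: three kept darts start there, and two of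
  them are already values at other darts.\<close>

lemma next_in_inner:
  assumes "s \<in> spokes"
  shows "next_in \<sigma> S\<^sub>i s = \<sigma> s" "next_in \<sigma> S\<^sub>i (W s) = \<alpha> s" "next_in \<sigma> S\<^sub>i (\<alpha> s) = Z (\<sigma> (\<sigma> s))"
    "next_in \<sigma> S\<^sub>i (Z s) = W (\<sigma> s)"
proof -
  have 1: "next_in \<sigma> S\<^sub>i s = \<sigma> s" "next_in \<sigma> S\<^sub>i (W s) = \<alpha> s" "next_in \<sigma> S\<^sub>i (\<alpha> s) = Z (\<sigma> (\<sigma> s))"
    if "s \<in> spokes" for s
    using that link_steps[OF that] spoke_step unfolding I_def C_def by (auto intro!: next_in_eq[THEN trans])
  then show "next_in \<sigma> S\<^sub>i s = \<sigma> s" "next_in \<sigma> S\<^sub>i (W s) = \<alpha> s" "next_in \<sigma> S\<^sub>i (\<alpha> s) = Z (\<sigma> (\<sigma> s))"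
    using assms by blast+
  have ss: "\<sigma> s \<in> spokes" using assms spoke_step by blast
  have S: "Z s \<in> S\<^sub>i" "W (\<sigma> s) \<in> S\<^sub>i" "\<alpha> (\<sigma> s) \<in> S\<^sub>i" using assms ss unfolding I_def C_def by auto
  have sub: "S\<^sub>i \<subseteq> D" using I_subset C_subset by blast
  define n where "n = next_in \<sigma> S\<^sub>i (Z s)"
  have "n \<in> S\<^sub>i" "n \<in> tail M (Z s)"
    using next_in_in_orbit[OF rot_permutes fin S(1)] unfolding n_def tail_def by blast+
  then have tn: "tail M n = head M (\<sigma> s)" using link_vertices(3)[OF assms] in_tail_iff[of n "Z s"] by simp
  have inj: "a = b" if "a \<in> S\<^sub>i" "b \<in> S\<^sub>i" "next_in \<sigma> S\<^sub>i a = next_in \<sigma> S\<^sub>i b" for a b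
    using that injD[OF permutes_inj[OF next_in_permutes[OF rot_permutes fin sub]], of a b] by simp
  have "n \<noteq> \<alpha> (\<sigma> s)"
    using inj[OF S(1,2)] 1(2)[OF ss] link_darts_distinct(6)[OF assms ss] unfolding n_def by metis
  moreover have "n \<noteq> Z s"
    using inj[OF S(1,3)] 1(3)[OF ss] link_darts_distinct(4)[OF ss assms] rot_period(1)[OF assms]
    unfolding n_def by metis
  moreover have "n \<in> {W (\<sigma> s), \<alpha> (\<sigma> s), Z s}"
  proof -
    consider "n \<in> spokes" | s' where "s' \<in> spokes" "n = \<alpha> s' \<or> n = Z s' \<or> n = W s'"
      using \<open>n \<in> S\<^sub>i\<close> unfolding I_def C_def by blast
    then show ?thesis
    proof cases
      case 1
      then show ?thesis using tn link_vertices(1)[OF 1] link_vertices(7)[OF ss] by simp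
    next
      case 2
      then show ?thesis using tail_eq_head_spoke[OF ss 2(1)] tn rot_period(1)[OF assms] by auto
    qed
  qed
  ultimately show "next_in \<sigma> S\<^sub>i (Z s) = W (\<sigma> s)" unfolding n_def by blast
qed

text \<open>The inner part is a tetrahedron. Its outer face consists of the darts
  \<open>W s\<close>, so \<open>W x\<close> can serve as its root.\<close>

lemma inner_part_triangulation:
  "three_connected_triangulation (inner_part M C (W x))"
  "4 \<le> card (vertices (inner_part M C (W x)))"
proof -
  let ?S = "S\<^sub>i" and ?F = "W ` spokes"
  let ?N = "submap M ?S ?F (W x)"
  let ?f = "\<lambda>d. next_in \<sigma> ?S (\<alpha> d)"
  have F: "(D - I) \<inter> C = W ` spokes"
  proof -
    have aux: "(D' - I') \<inter> (A \<union> B) = B" if "A \<union> B \<subseteq> D'" "A \<subseteq> I'" "B \<inter> I' = {}" for A B D' I' :: "'a set"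
      using that by blast
    have "W ` spokes \<inter> I = {}"
      unfolding I_def Int_Un_distrib Int_Un_distrib2 using link_darts_disjoint by (simp add: Int_commute)
    then show ?thesis using aux[of "Z ` spokes" "W ` spokes" D I] C_subset unfolding C_def I_def by simp
  qed
  have N: "inner_part M C (W x) = ?N" unfolding inner_part_def outside inside F ..
  have sub: "?S \<subseteq> D" using I_subset C_subset by blast
  have opp: "\<alpha> d \<in> ?S" if "d \<in> ?S" for d
    using that link_steps unfolding I_def C_def by auto
  have S_cases: "\<exists>s\<in>spokes. d = s \<or> d = \<alpha> s \<or> d = Z s \<or> d = W s" if "d \<in> ?S" for d
    using that unfolding I_def C_def by blast
  have f: "?f s = Z (\<sigma> (\<sigma> s))" "?f (\<alpha> s) = \<sigma> s" "?f (Z s) = \<alpha> s" "?f (W s) = W (\<sigma> s)" if "s \<in> spokes" for s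
    using next_in_inner[OF that] link_steps[OF that] by simp_all
  have tails: "tail M ` ?S = insert spokes (head M ` spokes)"
  proof
    show "tail M ` ?S \<subseteq> insert spokes (head M ` spokes)" using I_C_tails by blast
    have "tail M x \<in> tail M ` ?S" using in_tail[of x] unfolding I_def by blast
    moreover have "head M s \<in> tail M ` ?S" if "s \<in> spokes" for s
      using that tail_opp[of s] unfolding I_def by (metis UnCI image_eqI)
    ultimately show "insert spokes (head M ` spokes) \<subseteq> tail M ` ?S" by blast
  qed
  have cS: "card ?S = 12"
  proof -
    have S: "?S = spokes \<union> (\<alpha> ` spokes \<union> (Z ` spokes \<union> W ` spokes))" unfolding I_def C_def by blast
    have c3: "card (\<alpha> ` spokes) = 3" "card (Z ` spokes) = 3" "card (W ` spokes) = 3"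
      using degree_3 by (subst card_image; auto simp: Z_def W_def intro: inj_onI)+
    have "spokes \<inter> (\<alpha> ` spokes \<union> (Z ` spokes \<union> W ` spokes)) = {}"
      "\<alpha> ` spokes \<inter> (Z ` spokes \<union> W ` spokes) = {}" "Z ` spokes \<inter> W ` spokes = {}"
      using link_darts_disjoint by blast+
    then show ?thesis unfolding S using c3 degree_3 finite_tail[OF x]
      by (simp add: card_Un_disjoint)
  qed
  have connected': "cut_connected ?N" unfolding cut_connected_def darts_submap
  proof (intro allI impI)
    fix X assume X: "X \<subseteq> ?S" "X \<noteq> {}" "\<forall>d\<in>X. rot ?N d \<in> X" "\<forall>d\<in>X. opp ?N d \<in> X"
    have XS: "d \<in> ?S" if "d \<in> X" for d using that X(1) by (rule subsetD[rotated])
    have nx: "next_in \<sigma> ?S d \<in> X" if "d \<in> X" for d using X(3) that submap_simps(1)[OF XS[OF that]] by metis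
    have op: "\<alpha> d \<in> X" if "d \<in> X" for d using X(4) that submap_simps(2)[OF XS[OF that]] by metis
    have "\<exists>s\<in>spokes. s \<in> X"
    proof -
      obtain d where "d \<in> X" using X by blast
      then obtain s where s: "s \<in> spokes" "s \<in> X \<or> \<alpha> s \<in> X \<or> Z s \<in> X \<or> W s \<in> X"
        using S_cases[of d] X(1) by blast
      have "W s \<in> X \<Longrightarrow> s \<in> X" using nx[of "W s"] next_in_inner(2)[OF s(1)] op[of "\<alpha> s"] by simp
      moreover have "Z s \<in> X \<Longrightarrow> W s \<in> X" using op[of "Z s"] link_steps(7)[OF s(1)] by simp
      moreover have "\<alpha> s \<in> X \<Longrightarrow> s \<in> X" using op[of "\<alpha> s"] by simp
      ultimately show ?thesis using s by blast
    qed
    then obtain s where s: "s \<in> spokes" "s \<in> X" by blast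
    have st: "\<sigma> s' \<in> X" if "s' \<in> spokes" "s' \<in> X" for s' using nx[of s'] next_in_inner(1) that by metis
    have sp: "s' \<in> X" if "s' \<in> spokes" for s'
    proof -
      have "s' = s \<or> s' = \<sigma> s \<or> s' = \<sigma> (\<sigma> s)"
        using that s(1) rot_period(1)[of x] spokes_eq by auto
      then show ?thesis using s st spoke_step by metis
    qed
    have "Z s' \<in> X" if "s' \<in> spokes" for s'
      using nx[OF op[OF sp[OF spoke_step[OF that]]]] next_in_inner(3)[OF spoke_step[OF that]]
        rot_period(1)[OF that] by simp
    moreover from this have "W s' \<in> X" if "s' \<in> spokes" for s'
      using that op link_steps(7) by metis
    ultimately have "?S \<subseteq> X" using S_cases sp op by blast
    then show "X = ?S" using X(1) by blast
  qed
  have faces: "?f (?f (?f d)) = d \<and> ?f d \<noteq> d" if "d \<in> ?S" for d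
  proof -
    obtain s where s: "s \<in> spokes" "d = s \<or> d = \<alpha> s \<or> d = Z s \<or> d = W s" using S_cases[OF \<open>d \<in> ?S\<close>] by blast
    have sp: "\<sigma> s \<in> spokes" "\<sigma> (\<sigma> s) \<in> spokes" using s spoke_step by blast+
    note eqs = f[OF s(1)] f[OF sp(1)] f[OF sp(2)] rot_period[OF s(1)]
    have "W (\<sigma> s) \<noteq> W s" using rot_period(2)[OF s(1)] unfolding W_def Z_def by simp
    moreover have "\<alpha> s \<noteq> Z s" "s \<noteq> Z (\<sigma> (\<sigma> s))" "\<sigma> s \<noteq> \<alpha> s"
      using link_darts_distinct s(1) sp by metis+
    ultimately show ?thesis using s(2) eqs by auto
  qed
  have xs: "x \<in> spokes" by simp
  show "three_connected_triangulation (inner_part M C (W x))" unfolding N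
  proof (rule submap_triangulation)
    show "6 * card (tail M ` ?S) = card ?S + 12" using card_link_vertices cS tails by simp
    show "?F = (let f = ?f in {W x, f (W x), f (f (W x))})"
      unfolding Let_def using f(4)[OF xs] f(4)[OF spoke_step[OF xs]] by (subst spokes_eq) auto
    show "W x \<in> ?S" unfolding C_def by simp
  qed (use sub opp connected' faces in \<open>auto simp: Let_def C_def\<close>)
  show "4 \<le> card (vertices (inner_part M C (W x)))"
    unfolding N vertices_submap tails card_link_vertices by simp
qed

lemma in_Q: "M \<in> Q"
  unfolding Q_def using triangulation link_separating inner_part_triangulation outer_part_triangulation by blast

end

section \<open>Double counting of flips\<close>

context simple_triangulation
begin

text \<open>Degree 1 would make a face meet a vertex twice. At a vertex of degree 2, the third edges
  of the two faces join the same vertices and hence coincide, so that the whole map is a triangle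
  with six darts.\<close>

lemma degree_ge_3:
  assumes x: "x \<in> D" and big: "6 < card D"
  shows "3 \<le> card (tail M x)"
proof (rule ccontr)
  assume small: "\<not> ?thesis"
  have n1: "\<sigma> x \<noteq> x"
  proof
    assume "\<sigma> x = x"
    then have "\<phi> (\<alpha> x) = x" by (simp add: face_eq)
    then show False using face_vertices_distinct(3)[of "\<alpha> x"] x by (simp add: tail_face tail_opp)
  qed
  have n2: "\<sigma> (\<sigma> x) = x"
  proof (rule ccontr)
    assume "\<sigma> (\<sigma> x) \<noteq> x"
    then have "card {x, \<sigma> x, \<sigma> (\<sigma> x)} = 3" using n1 by auto
    moreover have "{x, \<sigma> x, \<sigma> (\<sigma> x)} \<subseteq> tail M x" by (simp add: in_tail_iff)
    ultimately show False using small finite_tail[OF x] card_mono by metis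
  qed
  define x' y where "x' = \<sigma> x" and "y = \<phi> x'"
  have D: "x' \<in> D" "y \<in> D" using x by (simp_all add: x'_def y_def)
  have f: "\<phi> (\<alpha> x) = x'" "\<phi> (\<alpha> x') = x" "\<phi> x' = y" using n2 by (simp_all add: x'_def y_def face_eq)
  have f': "\<phi> y = \<alpha> x" "\<phi> (\<phi> x) = \<alpha> x'" using f face3[of "\<alpha> x"] face3[of "\<alpha> x'"] x D by auto
  have "\<phi> x = \<alpha> y"
  proof (rule simple)
    show "tail M (\<phi> x) = tail M (\<alpha> y)"
      using tail_face[of x] tail_face[of y] f' tail_opp by metis
    show "head M (\<phi> x) = head M (\<alpha> y)"
      using tail_face[of "\<phi> x"] tail_face[of x'] f f' tail_opp head_opp by metis
  qed (use x D in auto)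
  then have f'': "\<phi> x = \<alpha> y" "\<phi> (\<alpha> y) = \<alpha> x'" using f' by simp_all
  let ?X = "{x, x', \<alpha> x, \<alpha> x', y, \<alpha> y}"
  have face: "\<phi> d \<in> ?X" if "d \<in> ?X" for d using that f f' f'' by (elim insertE) simp_all
  have opp: "\<alpha> d \<in> ?X" if "d \<in> ?X" for d using that by (elim insertE) simp_all
  have "?X = D"
  proof (rule connectedness[unfolded cut_connected_def, rule_format, of ?X])
    show "?X \<subseteq> D" using x D by simp
    show "\<sigma> d \<in> ?X" if "d \<in> ?X" for d using face[OF opp[OF that]] rot_eq by simp
  qed (use opp in blast)+
  moreover have "card {x, x', \<alpha> x, \<alpha> x', y, \<alpha> y} \<le> 6" by (simp add: card_insert_if)
  ultimately show False using big by simp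
qed

lemma card_outer: "finite (outer_face M)" "card (outer_face M) \<le> 3"
  using outer by (auto simp: card_insert_if)

text \<open>The degrees add up to 6n, so at most n/2 of the n + 2 vertices have degree 12 or more,
  and at most three are outer. Counting just one dart for each remaining vertex suffices.\<close>

lemma many_interior_darts_of_low_degree:
  assumes n: "card D = 6 * n" "2 \<le> n"
    and no_interior_3: "\<And>x. x \<in> D \<Longrightarrow> card (tail M x) = 3 \<Longrightarrow> tail M x \<inter> outer_face M \<noteq> {}"
  shows "n \<le> 2 * card {x\<in>D. tail M x \<inter> outer_face M = {} \<and> card (tail M x) \<in> {4..11}} + 2"
proof -
  let ?V = "vertices M"
  let ?G = "{x\<in>D. tail M x \<inter> outer_face M = {} \<and> card (tail M x) \<in> {4..11}}"
  define big where "big = {w\<in>?V. 12 \<le> card w}"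
  have finV: "finite ?V" using vertices_eq fin by simp
  have "12 * card big = (\<Sum>w\<in>big. 12)" by simp
  also have "\<dots> \<le> sum card big" unfolding big_def by (intro sum_mono) auto
  also have "\<dots> \<le> sum card ?V" unfolding big_def using finV by (intro sum_mono2) auto
  also have "\<dots> = card (\<Union>?V)"
    using disjoint_orbits(1)[OF rot_permutes fin] vertices_eq finite_tail
    by (intro card_Union_disjoint[symmetric]) (auto simp: vertices_def)
  also have "\<Union>?V = D"
    using disjoint_orbits(2)[OF rot_permutes fin] by (simp add: vertices_def)
  finally have c_big: "12 * card big \<le> card D" .
  have "card (tail M ` outer_face M) \<le> card (outer_face M)" using card_outer by (intro card_image_le)
  then have c_out: "card (tail M ` outer_face M) \<le> 3" using card_outer by simp
  have "?V \<subseteq> tail M ` ?G \<union> (big \<union> tail M ` outer_face M)"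
  proof
    fix w assume w: "w \<in> ?V"
    then obtain x where x: "x \<in> D" "w = tail M x" using vertices_eq by blast
    show "w \<in> tail M ` ?G \<union> (big \<union> tail M ` outer_face M)"
    proof (cases "w \<in> big \<or> w \<inter> outer_face M \<noteq> {}")
      case True
      then show ?thesis using x in_tail_iff by blast
    next
      case False
      then have "3 \<le> card w" "card w \<noteq> 3" "card w < 12"
        using degree_ge_3[OF x(1)] no_interior_3[OF x(1)] x w n unfolding big_def by auto
      then show ?thesis using x False by auto
    qed
  qed
  then have "card ?V \<le> card (tail M ` ?G \<union> (big \<union> tail M ` outer_face M))"
    using fin finV card_outer(1) unfolding big_def by (intro card_mono) auto
  also have "\<dots> \<le> card (tail M ` ?G) + (card big + card (tail M ` outer_face M))"
    by (meson add_left_mono card_Un_le le_trans)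
  also have "card (tail M ` ?G) \<le> card ?G" using fin by (intro card_image_le) auto
  finally have "card ?V \<le> card ?G + card big + 3" using c_out by linarith
  then show ?thesis using c_big euler n by linarith
qed

text \<open>Three darts at each of at most three outer vertices.\<close>

lemma few_darts_of_degree_3:
  assumes "\<And>x. x \<in> D \<Longrightarrow> card (tail M x) = 3 \<Longrightarrow> tail M x \<inter> outer_face M \<noteq> {}"
  shows "card {x\<in>D. card (tail M x) = 3} \<le> 9"
proof -
  let ?O = "{y\<in>outer_face M. card (tail M y) = 3}"
  have "{x\<in>D. card (tail M x) = 3} \<subseteq> (\<Union>y\<in>?O. tail M y)"
  proof
    fix x assume x: "x \<in> {x\<in>D. card (tail M x) = 3}"
    then obtain y where "y \<in> tail M x" "y \<in> outer_face M" using assms by blast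
    then show "x \<in> (\<Union>y\<in>?O. tail M y)" using x in_tail_iff[of y x] in_tail[of x] by auto
  qed
  moreover have "finite (\<Union>y\<in>?O. tail M y)" using card_outer finite_tail outer_subset by auto
  ultimately have "card {x\<in>D. card (tail M x) = 3} \<le> card (\<Union>y\<in>?O. tail M y)" by (intro card_mono)
  also have "\<dots> \<le> (\<Sum>y\<in>?O. card (tail M y))" using card_outer by (intro card_UN_le) auto
  also have "\<dots> = 3 * card ?O" by simp
  also have "card ?O \<le> card (outer_face M)" using card_outer by (intro card_mono) auto
  finally show ?thesis using card_outer(2) by simp
qed

end

text \<open>If \<open>\<sigma> x\<close> was flipped, \<open>opp N x\<close> is the dart
  \<open>r\<close>. Running along the new faces \<open>(r, h, g)\<close> and
  \<open>(f, k, p)\<close> recovers all six darts, and with them the old faces.\<close>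

definition unflip :: "'d plane_map \<Rightarrow> 'd \<Rightarrow> 'd plane_map" where
  "unflip N x =
    (let r = opp N x; h = face_perm N r; g = face_perm N h; f = opp N g; k = face_perm N f;
         p = face_perm N k
     in N\<lparr>rot := (face_perm N)(f := p, p := r, r := f, g := h, h := k, k := g) \<circ> opp N\<rparr>)"

lemma (in flip_triangulation) unflip_flip:
  assumes "x \<in> D" "\<sigma> x = f"
  shows "unflip M' x = M"
proof -
  have r: "\<alpha> x = r" using face_face_rot[OF assms(1)] assms(2) face_steps by simp
  have inv: "\<phi> = (face_perm M')(f := p, p := r, r := f, g := h, h := k, k := g)"
    by (rule face_flip_inverse)
  have "unflip M' x = M'\<lparr>rot := (face_perm M')(f := p, p := r, r := f, g := h, h := k, k := g) \<circ> \<alpha>\<rparr>"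
    unfolding unflip_def Let_def flip_simps r face_flip_steps face_steps ..
  also have "\<dots> = M'\<lparr>rot := \<phi> \<circ> \<alpha>\<rparr>" by (subst inv) (rule refl)
  also have "\<phi> \<circ> \<alpha> = \<sigma>" by (simp add: fun_eq_iff rot_eq)
  finally show ?thesis unfolding flip_def Let_def by simp
qed

definition triangulations_on :: "'d set \<Rightarrow> 'd plane_map set" where
  "triangulations_on D = {M. three_connected_triangulation M \<and> darts M = D}"

text \<open>\<open>x\<close> marks the vertex to be reduced together with a position around it. The
  bound \<open>j\<close> is carried along because a flip may create vertices of degree 3
  elsewhere.\<close>

definition low_degree_flags :: "'d set \<Rightarrow> nat \<Rightarrow> nat \<Rightarrow> ('d plane_map \<times> 'd) set" where
  "low_degree_flags D d j = {(M, x). M \<in> triangulations_on D \<and> x \<in> D \<and> tail M x \<inter> outer_face M = {} \<and>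
    card (tail M x) = d \<and> card {y\<in>D. card (tail M y) = 3} \<le> j}"

lemma finite_triangulations_on:
  assumes "finite D"
  shows "finite (triangulations_on D)"
proof -
  let ?P = "{s. s permutes D} \<times> {a. a permutes D} \<times> Pow D \<times> D"
  have "triangulations_on D \<subseteq>
    (\<lambda>(s, a, F, r). \<lparr>darts = D, rot = s, opp = a, outer_face = F, root_dart = r\<rparr>) ` ?P"
  proof
    fix M assume "M \<in> triangulations_on D"
    then have M: "three_connected_triangulation M" "darts M = D" unfolding triangulations_on_def by auto
    interpret simple_triangulation M using M by unfold_locales
    have "(rot M, opp M, outer_face M, root_dart M) \<in> ?P"
      using M rot_permutes opp_permutes outer_subset root by auto
    moreover have "M = \<lparr>darts = D, rot = rot M, opp = opp M, outer_face = outer_face M, root_dart = root_dart M\<rparr>"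
      using M(2) by simp
    ultimately show "M \<in> (\<lambda>(s, a, F, r). \<lparr>darts = D, rot = s, opp = a, outer_face = F, root_dart = r\<rparr>) ` ?P"
      by (metis (mono_tags, lifting) image_eqI case_prod_conv)
  qed
  moreover have "finite ?P" using assms finite_permutations by auto
  ultimately show ?thesis by (metis (no_types, lifting) finite_imageI finite_subset)
qed

lemma finite_low_degree_flags:
  assumes "finite D"
  shows "finite (low_degree_flags D d j)"
  by (rule finite_subset[of _ "triangulations_on D \<times> D"])
    (use assms finite_triangulations_on in \<open>auto simp: low_degree_flags_def\<close>)

text \<open>Flipping an edge at a vertex of degree \<open>d\<close>, and remembering the dart that precedes it there,
  loses no information; and one of any two consecutive edges can be flipped.\<close>

lemma low_degree_flags_step:
  assumes D: "finite D" and d: "3 \<le> d"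
  shows "card (low_degree_flags D (Suc d) j) \<le> 2 * card (low_degree_flags D d (j + 12))"
proof -
  let ?A = "low_degree_flags D (Suc d) j"
  define G where "G = {(M, x) \<in> ?A. flippable M (rot M x)}"
  define next_dart where "next_dart = (\<lambda>(M :: 'a plane_map, x). (M, rot M x))"
  have finA: "finite ?A" by (rule finite_low_degree_flags[OF D])
  have flip_loc: "flip_triangulation M (rot M x)" and deg: "card (tail M x) = Suc d"
    and tailx: "tail M (rot M x) = tail M x" and MD: "darts M = D" "x \<in> D"
    if "(M, x) \<in> G" for M x
  proof -
    interpret simple_triangulation M
      using that unfolding G_def low_degree_flags_def triangulations_on_def by unfold_locales auto
    show "darts M = D" "x \<in> D" "card (tail M x) = Suc d"
      using that unfolding G_def low_degree_flags_def triangulations_on_def by auto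
    then show "flip_triangulation M (rot M x)"
      using that unfolding G_def by unfold_locales auto
    show "tail M (rot M x) = tail M x" by simp
  qed
  have A_next: "next_dart ` ?A \<subseteq> ?A" "inj_on next_dart ?A"
  proof -
    have loc: "simple_triangulation M" if "(M, x) \<in> ?A" for M x
      using that unfolding low_degree_flags_def triangulations_on_def by unfold_locales auto
    show "next_dart ` ?A \<subseteq> ?A"
    proof
      fix Mx assume "Mx \<in> next_dart ` ?A"
      then obtain M x where Mx: "(M, x) \<in> ?A" "Mx = (M, rot M x)" unfolding next_dart_def by auto
      interpret simple_triangulation M by (rule loc[OF Mx(1)])
      show "Mx \<in> ?A" using Mx in_D_iff(1)[of x] unfolding low_degree_flags_def triangulations_on_def by auto
    qed
    show "inj_on next_dart ?A"
    proof (rule inj_onI)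
      fix a b assume ab: "a \<in> ?A" "b \<in> ?A" "next_dart a = next_dart b"
      obtain M x where a: "a = (M, x)" by fastforce
      interpret simple_triangulation M using loc ab(1) a by blast
      show "a = b" using ab(3) a unfolding next_dart_def by (cases b) auto
    qed
  qed
  \<comment> \<open>One of the two edges after \<open>x\<close> can be flipped, so \<open>G\<close>
    and its preimage under the injection \<open>next_dart\<close> cover everything. This is the
    factor 2.\<close>
  have "?A \<subseteq> G \<union> {a\<in>?A. next_dart a \<in> G}"
  proof
    fix a assume a: "a \<in> ?A"
    obtain M x where Mx: "a = (M, x)" by fastforce
    interpret simple_triangulation M
      using a Mx unfolding low_degree_flags_def triangulations_on_def by unfold_locales auto
    have "x \<in> darts M" "card (tail M x) = Suc d"
      using a Mx unfolding low_degree_flags_def triangulations_on_def by auto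
    then have "flippable M (rot M x) \<or> flippable M (rot M (rot M x))"
      using d by (intro crossing_chord_flippable) auto
    moreover have "next_dart a \<in> ?A" using A_next a by blast
    ultimately show "a \<in> G \<union> {a\<in>?A. next_dart a \<in> G}"
      using a Mx unfolding G_def next_dart_def by auto
  qed
  moreover have finG: "finite G" unfolding G_def by (rule finite_subset[OF _ finA]) auto
  ultimately have "card ?A \<le> card (G \<union> {a\<in>?A. next_dart a \<in> G})" using finA by (intro card_mono) auto
  also have "\<dots> \<le> card G + card {a\<in>?A. next_dart a \<in> G}" by (rule card_Un_le)
  also have "card {a\<in>?A. next_dart a \<in> G} \<le> card G"
    by (rule card_inj_on_le[of next_dart]) (use A_next(2) finG in \<open>auto intro: inj_on_subset\<close>)
  finally have "card ?A \<le> 2 * card G" by simp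
  also have "card G \<le> card (low_degree_flags D d (j + 12))"
  proof (rule card_inj_on_le)
    let ?F = "\<lambda>(M, x). (flip M (rot M x), x)"
    show "finite (low_degree_flags D d (j + 12))" by (rule finite_low_degree_flags[OF D])
    show "inj_on ?F G"
    proof (rule inj_on_inverseI[where g = "\<lambda>(N, x). (unflip N x, x)"])
      fix a assume a: "a \<in> G"
      obtain M x where Mx: "a = (M, x)" by fastforce
      interpret flip_triangulation M "rot M x" using flip_loc a Mx by blast
      show "(\<lambda>(N, x). (unflip N x, x)) (?F a) = a" using unflip_flip[of x] MD a Mx by auto
    qed
    show "?F ` G \<subseteq> low_degree_flags D d (j + 12)"
    proof
      fix b assume "b \<in> ?F ` G"
      then obtain M x where Mx: "(M, x) \<in> G" "b = (flip M (rot M x), x)" by auto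
      interpret flip_triangulation M "rot M x" using flip_loc Mx by blast
      have x: "x \<in> darts M" "card (tail M x) = Suc d" "darts M = D"
        using MD[OF Mx(1)] deg[OF Mx(1)] by auto
      have out: "tail M x \<inter> outer_face M = {}" "card {y\<in>D. card (tail M y) = 3} \<le> j"
        using Mx(1) unfolding G_def low_degree_flags_def by auto
      have "three_connected_triangulation M'" using out(1) tailx[OF Mx(1)] by (intro flip_triangulation) simp
      moreover have "card (tail M' x) = d" "tail M' x \<subseteq> tail M x"
        using card_tail_flip[of x] x d by auto
      moreover have "card {y\<in>D. card (tail M' y) = 3} \<le> j + 12"
        using card_degree_3_darts_flip out(2) unfolding x(3) by linarith
      ultimately show "b \<in> low_degree_flags D d (j + 12)"
        using Mx out x unfolding low_degree_flags_def triangulations_on_def by auto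
    qed
  qed
  finally show ?thesis by simp
qed

text \<open>Here \<open>j\<close> pays off: at degree 3 a triangulation admits at most
  \<open>j\<close> marked darts.\<close>

lemma card_low_degree_flags_3:
  assumes D: "finite D"
  shows "card (low_degree_flags D 3 j) \<le> j * card (triangulations_on D)"
proof -
  let ?T = "{M \<in> triangulations_on D. card {y\<in>D. card (tail M y) = 3} \<le> j}"
  have finT: "finite ?T" using finite_triangulations_on[OF D] by simp
  have "low_degree_flags D 3 j \<subseteq> (SIGMA M:?T. {y\<in>D. card (tail M y) = 3})"
    unfolding low_degree_flags_def by auto
  then have "card (low_degree_flags D 3 j) \<le> card (SIGMA M:?T. {y\<in>D. card (tail M y) = 3})"
    using finT D by (intro card_mono) auto
  also have "\<dots> = (\<Sum>M\<in>?T. card {y\<in>D. card (tail M y) = 3})" using finT D by (intro card_SigmaI) auto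
  also have "\<dots> \<le> (\<Sum>M\<in>?T. j)" by (intro sum_mono) auto
  also have "\<dots> = j * card ?T" by simp
  also have "\<dots> \<le> j * card (triangulations_on D)"
    using finite_triangulations_on[OF D] by (intro mult_left_mono card_mono) auto
  finally show ?thesis .
qed

text \<open>\<open>d\<close> counts the flips: each doubles the bound and raises \<open>j\<close> by
  12.\<close>

lemma card_low_degree_flags:
  assumes D: "finite D"
  shows "card (low_degree_flags D (3 + d) j) \<le> 2 ^ d * (j + 12 * d) * card (triangulations_on D)"
proof (induction d arbitrary: j)
  case 0
  then show ?case using card_low_degree_flags_3[OF D] by simp
next
  case (Suc d)
  have "card (low_degree_flags D (3 + Suc d) j) \<le> 2 * card (low_degree_flags D (3 + d) (j + 12))"
    using low_degree_flags_step[OF D, of "3 + d"] by simp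
  also have "\<dots> \<le> 2 * (2 ^ d * (j + 12 + 12 * d) * card (triangulations_on D))"
    using Suc.IH by (intro mult_left_mono) auto
  finally show ?case by (simp add: algebra_simps)
qed

definition no_interior_degree_3 :: "'d plane_map \<Rightarrow> bool" where
  "no_interior_degree_3 M \<longleftrightarrow>
    (\<forall>x\<in>darts M. card (tail M x) = 3 \<longrightarrow> tail M x \<inter> outer_face M \<noteq> {})"

text \<open>Count the darts at interior vertices of degree 4 to 11 in two ways: each of these maps
  has at least (n - 2)/2 of them, and all are flags of degree 3 + d with 1 \<le> d \<le> 8 and
  initial bound 9.\<close>

lemma no_interior_degree_3_rare:
  assumes D: "finite D" "card D = 6 * n" and n: "2 \<le> n"
  shows "(n - 2) * card {M \<in> triangulations_on D. no_interior_degree_3 M}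
    \<le> 2 * (\<Sum>d\<in>{1..8}. 2 ^ d * (9 + 12 * d)) * card (triangulations_on D)"
proof -
  let ?S = "{M \<in> triangulations_on D. no_interior_degree_3 M}"
  let ?G = "\<lambda>M. {x\<in>D. tail M x \<inter> outer_face M = {} \<and> card (tail M x) \<in> {4..11}}"
  have finS: "finite ?S" using finite_triangulations_on[OF D(1)] by simp
  have S: "simple_triangulation M" "darts M = D" if "M \<in> ?S" for M
    using that unfolding triangulations_on_def by (auto simp: simple_triangulation_def)
  have "(n - 2) * card ?S = (\<Sum>M\<in>?S. n - 2)" by simp
  also have "\<dots> \<le> (\<Sum>M\<in>?S. 2 * card (?G M))"
  proof (rule sum_mono)
    fix M assume M: "M \<in> ?S"
    interpret simple_triangulation M using S M by blast
    have "n \<le> 2 * card (?G M) + 2"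
      using many_interior_darts_of_low_degree[of n] M D n S(2)[OF M] unfolding no_interior_degree_3_def by auto
    then show "n - 2 \<le> 2 * card (?G M)" by simp
  qed
  also have "\<dots> = 2 * card (SIGMA M:?S. ?G M)"
    using finS D by (subst card_SigmaI) (auto simp: sum_distrib_left)
  also have "card (SIGMA M:?S. ?G M) \<le> card (\<Union>d\<in>{1..8}. low_degree_flags D (3 + d) 9)"
  proof (rule card_mono)
    show "finite (\<Union>d\<in>{1..8}. low_degree_flags D (3 + d) 9)" using finite_low_degree_flags[OF D(1)] by blast
    show "(SIGMA M:?S. ?G M) \<subseteq> (\<Union>d\<in>{1..8}. low_degree_flags D (3 + d) 9)"
    proof
      fix a assume a: "a \<in> (SIGMA M:?S. ?G M)"
      obtain M x where Mx: "a = (M, x)" by fastforce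
      then have M: "M \<in> ?S" and x: "x \<in> ?G M" using a by auto
      interpret simple_triangulation M using S M by blast
      have "card {y\<in>D. card (tail M y) = 3} \<le> 9"
        using few_darts_of_degree_3 M S(2)[OF M] unfolding no_interior_degree_3_def by auto
      then have "a \<in> low_degree_flags D (3 + (card (tail M x) - 3)) 9"
        using M x Mx unfolding low_degree_flags_def by auto
      moreover have "card (tail M x) - 3 \<in> {1..8}" using x by auto
      ultimately show "a \<in> (\<Union>d\<in>{1..8}. low_degree_flags D (3 + d) 9)" by blast
    qed
  qed
  also have "card (\<Union>d\<in>{1..8}. low_degree_flags D (3 + d) 9) \<le> (\<Sum>d\<in>{1..8}. card (low_degree_flags D (3 + d) 9))"
    by (rule card_UN_le) simp
  also have "\<dots> \<le> (\<Sum>d\<in>{1..8}. 2 ^ d * (9 + 12 * d) * card (triangulations_on D))"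
    by (intro sum_mono card_low_degree_flags[OF D(1)])
  finally show ?thesis by (simp add: sum_distrib_right mult.assoc)
qed

section \<open>Counting up to isomorphism\<close>

definition iso_by :: "('d \<Rightarrow> 'e) \<Rightarrow> 'd plane_map \<Rightarrow> 'e plane_map \<Rightarrow> bool" where
  "iso_by f M N \<longleftrightarrow> bij_betw f (darts M) (darts N) \<and>
    (\<forall>d\<in>darts M. f (rot M d) = rot N (f d) \<and> f (opp M d) = opp N (f d)) \<and>
    f ` outer_face M = outer_face N \<and> f (root_dart M) = root_dart N"

lemma rooted_iso_iff: "rooted_iso M N \<longleftrightarrow> (\<exists>f. iso_by f M N)"
  unfolding rooted_iso_def iso_by_def ..

text \<open>The permutations are the identity off the new darts, as \<open>permutes\<close>
  demands.\<close>

definition relabel :: "('d \<Rightarrow> 'e) \<Rightarrow> 'd plane_map \<Rightarrow> 'e plane_map" where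
  "relabel f M =
    (let D = f ` darts M; g = inv_into (darts M) f
     in \<lparr>darts = D, rot = (\<lambda>y. if y \<in> D then f (rot M (g y)) else y),
         opp = (\<lambda>y. if y \<in> D then f (opp M (g y)) else y),
         outer_face = f ` outer_face M, root_dart = f (root_dart M)\<rparr>)"

context simple_triangulation
begin

text \<open>An isomorphism says nothing about \<open>rot N\<close> and \<open>opp N\<close> off the
  darts of \<open>N\<close>, so that \<open>permutes\<close> is a separate assumption.\<close>

lemma iso_transfers:
  assumes iso: "iso_by f M N" and perm: "rot N permutes darts N" "opp N permutes darts N"
  shows iso_triangulation: "three_connected_triangulation N"
    and iso_tail: "d \<in> D \<Longrightarrow> tail N (f d) = f ` tail M d"
proof -
  have bij: "inj_on f D" "f ` D = darts N"
    and hom: "\<And>d. d \<in> D \<Longrightarrow> rot N (f d) = f (\<sigma> d)" "\<And>d. d \<in> D \<Longrightarrow> opp N (f d) = f (\<alpha> d)"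
    and out: "f ` outer_face M = outer_face N" "f (root_dart M) = root_dart N"
    using iso unfolding iso_by_def bij_betw_def by auto
  have face: "face_perm N (f d) = f (\<phi> d)" if "d \<in> D" for d
    using that hom unfolding face_perm_def by simp
  have tail: "tail N (f d) = f ` tail M d" if "d \<in> D" for d
    unfolding tail_def
    by (rule orbit_inverse[symmetric, OF self_in_orbit[OF rot_permutes fin]])
      (use hom permutes_orbit_subset[OF rot_permutes that] in blast)
  then show "d \<in> D \<Longrightarrow> tail N (f d) = f ` tail M d" .
  have tail_eq: "tail N (f d) = tail N (f e) \<longleftrightarrow> tail M d = tail M e" if "d \<in> D" "e \<in> D" for d e
    using that tail tail_subset inj_on_image_eq_iff[OF bij(1)] by auto
  have head: "head N (f d) = tail N (f (\<alpha> d))" if "d \<in> D" for d using hom(2)[OF that] by (simp add: head_def)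
  have feq: "f d = f e \<longleftrightarrow> d = e" if "d \<in> D" "e \<in> D" for d e using bij(1) that by (auto simp: inj_on_def)
  have all: "(\<forall>d\<in>darts N. P d) \<longleftrightarrow> (\<forall>d\<in>D. P (f d))" for P unfolding bij(2)[symmetric] by simp
  have "vertices N = tail N ` (f ` D)"
    unfolding bij(2) vertices_def tail_def by (simp add: image_def)
  then have "vertices N = image f ` vertices M"
    unfolding vertices_eq image_image using tail by (simp cong: image_cong)
  moreover have "inj_on (image f) (vertices M)"
    unfolding vertices_eq using tail_subset inj_on_image_eq_iff[OF bij(1)] by (auto intro!: inj_onI)
  ultimately have "card (vertices N) = card (vertices M)" using card_image by metis
  moreover have "card (darts N) = card D" using bij card_image by metis
  moreover have "cut_connected N" unfolding cut_connected_def
  proof (intro allI impI)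
    fix X assume X: "X \<subseteq> darts N" "X \<noteq> {}" "\<forall>d\<in>X. rot N d \<in> X" "\<forall>d\<in>X. opp N d \<in> X"
    let ?Y = "{d\<in>D. f d \<in> X}"
    have "?Y = D"
    proof (rule connectedness[unfolded cut_connected_def, rule_format, of ?Y])
      obtain y where "y \<in> X" "y \<in> f ` D" using X(1,2) unfolding bij(2)[symmetric] by blast
      then show "?Y \<noteq> {}" by auto
      show "\<sigma> d \<in> ?Y" if "d \<in> ?Y" for d using that X(3) hom(1)[of d] by auto
      show "\<alpha> d \<in> ?Y" if "d \<in> ?Y" for d using that X(4) hom(2)[of d] by auto
    qed blast
    then show "X = darts N" using X(1) unfolding bij(2)[symmetric] by auto
  qed
  moreover have "\<exists>d\<in>darts N. outer_face N = {d, face_perm N d, face_perm N (face_perm N d)}"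
  proof -
    obtain d where d: "d \<in> D" "outer_face M = {d, \<phi> d, \<phi> (\<phi> d)}" using outer by blast
    then have "outer_face N = {f d, face_perm N (f d), face_perm N (face_perm N (f d))}"
      using out(1) face by auto
    then show ?thesis using d bij(2) by blast
  qed
  moreover have "root_dart N \<in> darts N" "root_dart N \<in> outer_face N \<or> opp N (root_dart N) \<in> outer_face N"
    using root out bij(2) hom(2)[OF root(1)] by (metis image_eqI)+
  moreover have "\<forall>d\<in>darts N. opp N d \<noteq> d \<and> opp N (opp N d) = d"
    unfolding all using hom(2) feq opp_neq by auto
  moreover have "\<forall>d\<in>darts N. face_perm N (face_perm N (face_perm N d)) = d \<and> face_perm N d \<noteq> d"
    unfolding all using face feq face3 face_neq by auto
  moreover have "\<forall>d\<in>darts N. tail N d \<noteq> head N d"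
    unfolding all using head tail_eq no_loop by (auto simp: tail_opp)
  moreover have "\<forall>d\<in>darts N. \<forall>e\<in>darts N. tail N d = tail N e \<longrightarrow> head N d = head N e \<longrightarrow> d = e"
    unfolding all using head tail_eq simple by (auto simp: tail_opp intro!: arg_cong[of _ _ f])
  moreover have "finite (darts N)" using fin unfolding bij(2)[symmetric] by (rule finite_imageI)
  ultimately show "three_connected_triangulation N"
    unfolding three_connected_triangulation_iff using perm euler by simp
qed

lemma iso_no_interior_degree_3:
  assumes iso: "iso_by f M N" and perm: "rot N permutes darts N" "opp N permutes darts N"
    and M: "no_interior_degree_3 M"
  shows "no_interior_degree_3 N"
  unfolding no_interior_degree_3_def
proof (intro ballI impI)
  fix y assume y: "y \<in> darts N" "card (tail N y) = 3"
  have bij: "inj_on f D" "f ` D = darts N" "f ` outer_face M = outer_face N"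
    using iso unfolding iso_by_def bij_betw_def by auto
  then obtain x where x: "x \<in> D" "y = f x" using y by blast
  have t: "tail N y = f ` tail M x" using iso_tail[OF iso perm x(1)] x(2) by simp
  have "inj_on f (tail M x)" using bij(1) tail_subset[OF x(1)] inj_on_subset by blast
  then have "card (tail M x) = 3" using y(2) t card_image by metis
  then have "tail M x \<inter> outer_face M \<noteq> {}" using M x(1) unfolding no_interior_degree_3_def by blast
  then show "tail N y \<inter> outer_face N \<noteq> {}" using t bij(3) by blast
qed

lemma relabel_iso:
  assumes inj: "inj_on f D"
  shows "iso_by f M (relabel f M)" "rot (relabel f M) permutes darts (relabel f M)"
    "opp (relabel f M) permutes darts (relabel f M)" "darts (relabel f M) = f ` D"
proof -
  have g: "inv_into D f (f d) = d" if "d \<in> D" for d using inj that by simp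
  show "darts (relabel f M) = f ` D" by (simp add: relabel_def Let_def)
  show "iso_by f M (relabel f M)"
    unfolding iso_by_def relabel_def Let_def bij_betw_def using inj g by auto
  have bij: "bij_betw (\<lambda>y. if y \<in> f ` D then f (s (inv_into D f y)) else y) (f ` D) (f ` D)"
    if s: "s permutes D" for s
  proof -
    have "bij_betw (f \<circ> s \<circ> inv_into D f) (f ` D) (f ` D)"
      using bij_betw_trans[OF bij_betw_inv_into[OF inj_on_imp_bij_betw[OF inj]]
          bij_betw_trans[OF permutes_imp_bij[OF s] inj_on_imp_bij_betw[OF inj]]] .
    then show ?thesis by (rule bij_betw_cong[THEN iffD1, rotated]) auto
  qed
  show "rot (relabel f M) permutes darts (relabel f M)" "opp (relabel f M) permutes darts (relabel f M)"
    unfolding relabel_def Let_def using bij[OF rot_permutes] bij[OF opp_permutes]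
    by (auto intro!: bij_imp_permutes)
qed

lemma iso_by_id: "iso_by id M M"
  unfolding iso_by_def by simp

lemma iso_by_inv:
  assumes iso: "iso_by f M N"
  shows "iso_by (inv_into D f) N M"
proof -
  let ?g = "inv_into D f"
  have bij: "inj_on f D" "f ` D = darts N"
    and hom: "\<And>d. d \<in> D \<Longrightarrow> rot N (f d) = f (\<sigma> d)" "\<And>d. d \<in> D \<Longrightarrow> opp N (f d) = f (\<alpha> d)"
    and out: "outer_face N = f ` outer_face M" "root_dart N = f (root_dart M)"
    using iso unfolding iso_by_def bij_betw_def by auto
  have g: "?g (f d) = d" if "d \<in> D" for d using bij that by simp
  have "bij_betw ?g (darts N) D" using bij bij_betw_inv_into unfolding bij_betw_def by blast
  moreover have "\<forall>e\<in>darts N. ?g (rot N e) = \<sigma> (?g e) \<and> ?g (opp N e) = \<alpha> (?g e)"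
    unfolding bij(2)[symmetric] using g hom by auto
  moreover have "?g ` outer_face N = outer_face M"
    unfolding out image_image using g outer_subset by (auto simp: image_iff subset_eq)
  moreover have "?g (root_dart N) = root_dart M" using out(2) g root(1) by simp
  ultimately show ?thesis unfolding iso_by_def by blast
qed

text \<open>Two isomorphisms agree at the root, and the set where they agree is invariant under
  \<sigma> and \<alpha>.\<close>

lemma automorphism_free:
  assumes f: "iso_by f M N" and g: "iso_by g M N" and d: "d \<in> D"
  shows "f d = g d"
proof -
  let ?X = "{d\<in>D. f d = g d}"
  have hom: "\<And>d. d \<in> D \<Longrightarrow> f (\<sigma> d) = rot N (f d) \<and> f (\<alpha> d) = opp N (f d)"
    "\<And>d. d \<in> D \<Longrightarrow> g (\<sigma> d) = rot N (g d) \<and> g (\<alpha> d) = opp N (g d)"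
    "f (root_dart M) = g (root_dart M)"
    using f g unfolding iso_by_def by auto
  have "?X = D"
    by (rule connectedness[unfolded cut_connected_def, rule_format, of ?X]) (use hom root(1) in auto)
  then show ?thesis using d by blast
qed

end

lemma iso_by_comp:
  assumes "iso_by f L M" "iso_by g M N"
  shows "iso_by (g \<circ> f) L N"
proof -
  have "(g \<circ> f) ` outer_face L = outer_face N"
    using assms unfolding iso_by_def by (metis image_comp)
  then show ?thesis
    using assms bij_betw_trans[of f "darts L" "darts M" g "darts N"] bij_betwE[of f "darts L" "darts M"]
    unfolding iso_by_def by simp
qed

definition iso_rel :: "'d plane_map set \<Rightarrow> ('d plane_map \<times> 'd plane_map) set" where
  "iso_rel A = {(M, N). M \<in> A \<and> N \<in> A \<and> rooted_iso M N}"

lemma num_up_to_iso_eq: "num_up_to_iso A = card (A // iso_rel A)"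
  unfolding num_up_to_iso_def iso_rel_def ..

lemma equiv_iso_rel:
  assumes "\<And>M. M \<in> A \<Longrightarrow> three_connected_triangulation M"
  shows "equiv A (iso_rel A)"
proof (rule equivI)
  show "iso_rel A \<subseteq> A \<times> A" unfolding iso_rel_def by blast
  show "refl_on A (iso_rel A)"
    unfolding refl_on_def iso_rel_def rooted_iso_iff
    using simple_triangulation.iso_by_id assms simple_triangulation.intro by blast
  show "sym (iso_rel A)"
    unfolding sym_def iso_rel_def rooted_iso_iff
    using simple_triangulation.iso_by_inv[OF simple_triangulation.intro[OF assms]] by blast
  show "trans (iso_rel A)"
    unfolding trans_def iso_rel_def rooted_iso_iff using iso_by_comp by blast
qed

text \<open>The symmetric group acts freely on the maps with darts \<open>{..<k}\<close>, since
  rooted maps have no automorphisms, so each class contains exactly k! of them. Finiteness is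
  recorded for later comparisons of cardinalities.\<close>

lemma num_up_to_iso_mult_fact:
  fixes A :: "nat plane_map set"
  assumes A: "\<And>M. M \<in> A \<Longrightarrow> three_connected_triangulation M" "\<And>M. M \<in> A \<Longrightarrow> card (darts M) = k"
    and closed: "\<And>M N f. M \<in> A \<Longrightarrow> iso_by f M N \<Longrightarrow> rot N permutes darts N \<Longrightarrow>
      opp N permutes darts N \<Longrightarrow> N \<in> A"
  shows "fact k * num_up_to_iso A = card {M \<in> A. darts M = {..<k}}" "finite (A // iso_rel A)"
proof -
  let ?L = "{M \<in> A. darts M = {..<k}}" and ?R = "iso_rel A"
  have finL: "finite ?L"
    by (rule finite_subset[OF _ finite_triangulations_on[of "{..<k}"]])
      (use A in \<open>auto simp: triangulations_on_def\<close>)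
  have eq: "equiv A ?R" by (rule equiv_iso_rel[OF A(1)])
  have count: "card (c \<inter> ?L) = fact k" if c: "c \<in> A // ?R" for c
  proof -
    obtain M where M: "M \<in> A" "c = ?R `` {M}" using c by (rule quotientE)
    interpret M: simple_triangulation M using A M by unfold_locales blast
    obtain h where h: "bij_betw h (darts M) {..<k}"
      using finite_same_card_bij[OF M.fin, of "{..<k}"] A(2)[OF M(1)] by auto
    define L where "L = relabel h M"
    have inj: "inj_on h (darts M)" using h bij_betw_def by blast
    have L: "L \<in> A" "darts L = {..<k}" "(M, L) \<in> ?R"
    proof -
      note iso = M.relabel_iso[OF inj]
      show "L \<in> A" unfolding L_def by (rule closed[OF M(1) iso(1-3)])
      then show "(M, L) \<in> ?R" unfolding iso_rel_def rooted_iso_iff using M(1) iso(1) L_def by blast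
      show "darts L = {..<k}" unfolding L_def iso(4) using h by (rule bij_betw_imp_surj_on)
    qed
    interpret L: simple_triangulation L using A L by unfold_locales blast
    have c': "c = ?R `` {L}" using M(2) equiv_class_eq[OF eq L(3)] by simp
    have inj_p: "inj_on s (darts L)" if "s permutes {..<k}" for s
      using that L(2) permutes_inj_on by metis
    \<comment> \<open>The labelled members of a class form a single orbit of the symmetric
      group.\<close>
    have "c \<inter> ?L = (\<lambda>s. relabel s L) ` {s. s permutes {..<k}}"
    proof
      show "(\<lambda>s. relabel s L) ` {s. s permutes {..<k}} \<subseteq> c \<inter> ?L"
      proof
        fix N assume "N \<in> (\<lambda>s. relabel s L) ` {s. s permutes {..<k}}"
        then obtain s where s: "s permutes {..<k}" "N = relabel s L" by blast
        note iso = L.relabel_iso[OF inj_p[OF s(1)]]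
        have "N \<in> A" unfolding s(2) by (rule closed[OF L(1) iso(1-3)])
        moreover have "darts N = {..<k}" unfolding s(2) iso(4) L(2) using s(1) by (rule permutes_image)
        moreover have "(L, N) \<in> ?R"
          unfolding iso_rel_def rooted_iso_iff using L(1) calculation(1) iso(1) s(2) by blast
        ultimately show "N \<in> c \<inter> ?L" using c' by blast
      qed
      show "c \<inter> ?L \<subseteq> (\<lambda>s. relabel s L) ` {s. s permutes {..<k}}"
      proof
        fix N assume N: "N \<in> c \<inter> ?L"
        then have "(L, N) \<in> ?R" using c' by blast
        then obtain f where f: "iso_by f L N" unfolding iso_rel_def rooted_iso_iff by blast
        have NA: "three_connected_triangulation N" "darts N = {..<k}" using N A(1) by auto
        \<comment> \<open>Extending the isomorphism by the identity turns it into a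
          permutation.\<close>
        define s where "s = (\<lambda>x. if x \<in> {..<k} then f x else x)"
        have bij: "bij_betw f {..<k} {..<k}" using f L(2) NA(2) unfolding iso_by_def by simp
        then have s: "s permutes {..<k}" unfolding s_def
        proof (intro bij_imp_permutes)
          show "bij_betw (\<lambda>x. if x \<in> {..<k} then f x else x) {..<k} {..<k}"
            using bij by (rule bij_betw_cong[THEN iffD1, rotated]) simp
        qed auto
        have fs: "f x = s x" if "x \<in> {..<k}" for x using that by (simp add: s_def)
        have hom: "\<And>d. d \<in> darts L \<Longrightarrow> s (rot L d) = rot N (s d) \<and> s (opp L d) = opp N (s d)"
          "s ` outer_face L = outer_face N" "s (root_dart L) = root_dart N"
          using f fs L(2) L.in_D_iff L.outer_subset L.root(1) unfolding iso_by_def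
          by (auto simp: subset_eq)
        have perm: "rot N permutes {..<k}" "opp N permutes {..<k}"
          using NA unfolding three_connected_triangulation_iff by metis+
        have g: "inv_into {..<k} s y \<in> {..<k}" "s (inv_into {..<k} s y) = y" if "y \<in> {..<k}" for y
          using that permutes_image[OF s] inv_into_into f_inv_into_f by metis+
        have "rot (relabel s L) = rot N" "opp (relabel s L) = opp N"
          unfolding relabel_def Let_def L(2) permutes_image[OF s]
          using hom(1) g L(2) perm by (auto simp: fun_eq_iff permutes_def)
        moreover have "darts (relabel s L) = darts N" "outer_face (relabel s L) = outer_face N"
          "root_dart (relabel s L) = root_dart N"
          unfolding relabel_def Let_def using hom L(2) NA(2) permutes_image[OF s] by simp_all
        ultimately have "N = relabel s L" by simp
        then show "N \<in> (\<lambda>s. relabel s L) ` {s. s permutes {..<k}}" using s by blast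
      qed
    qed
    moreover have "inj_on (\<lambda>s. relabel s L) {s. s permutes {..<k}}"
    proof (rule inj_onI)
      fix s s' assume s: "s \<in> {s. s permutes {..<k}}" "s' \<in> {s. s permutes {..<k}}" "relabel s L = relabel s' L"
      have "s x = s' x" for x
      proof (cases "x \<in> {..<k}")
        case True
        have "iso_by s L (relabel s L)" "iso_by s' L (relabel s' L)"
          using s(1,2) L.relabel_iso(1)[OF inj_p] by blast+
        then show ?thesis using L.automorphism_free[of s "relabel s L" s' x] s(3) True L(2) by metis
      next
        case False
        then show ?thesis using s by (simp add: permutes_def)
      qed
      then show "s = s'" by blast
    qed
    ultimately show "card (c \<inter> ?L) = fact k"
      using card_image card_permutations[of "{..<k}" k] by (metis (no_types, lifting) card_lessThan finite_lessThan)
  qed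
  \<comment> \<open>Every class has a labelled member, so its trace on \<open>?L\<close> determines
    it.\<close>
  have inj: "inj_on (\<lambda>c. c \<inter> ?L) (A // ?R)"
  proof (rule inj_onI)
    fix c c' assume c: "c \<in> A // ?R" "c' \<in> A // ?R" "c \<inter> ?L = c' \<inter> ?L"
    have "c \<inter> ?L \<noteq> {}" using count[OF c(1)] by (metis card.empty fact_nonzero)
    then have "c \<inter> c' \<noteq> {}" using c(3) by blast
    then show "c = c'" using quotient_disj[OF eq c(1,2)] by blast
  qed
  have "card ?L = fact k * card ((\<lambda>c. c \<inter> ?L) ` (A // ?R))"
  proof (rule card_of_constant_fibres[OF finL])
    show "\<Union> ((\<lambda>c. c \<inter> ?L) ` (A // ?R)) = ?L" using Union_quotient[OF eq] by blast
    show "pairwise disjnt ((\<lambda>c. c \<inter> ?L) ` (A // ?R))"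
      unfolding pairwise_def disjnt_def using quotient_disj[OF eq] by blast
  qed (use count in auto)
  then show "fact k * num_up_to_iso A = card ?L"
    unfolding num_up_to_iso_eq using card_image[OF inj] by simp
  have "(\<lambda>c. c \<inter> ?L) ` (A // ?R) \<subseteq> Pow ?L" by blast
  then show "finite (A // ?R)"
    using finite_imageD[OF finite_subset[OF _ finite_Pow_iff[THEN iffD2, OF finL]] inj] by blast
qed

text \<open>The classes within a subset \<open>B\<close> inject into those of \<open>A\<close>, even
  if \<open>B\<close> contains only a part of an isomorphism class. In this way \<open>Q\<close> is
  compared with all triangulations without showing that it is invariant under isomorphism.\<close>

lemma class_extension:
  assumes A: "\<And>M. M \<in> A \<Longrightarrow> three_connected_triangulation M" and B: "B \<subseteq> A"
  shows "inj_on (\<lambda>c. iso_rel A `` c) (B // iso_rel B)"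
    and "(\<lambda>c. iso_rel A `` c) ` (B // iso_rel B) = {iso_rel A `` {M} |M. M \<in> B}"
proof -
  have eqA: "equiv A (iso_rel A)" by (rule equiv_iso_rel[OF A])
  have eqB: "equiv B (iso_rel B)" using A B by (intro equiv_iso_rel) blast
  have sub: "(M, N) \<in> iso_rel B \<longleftrightarrow> (M, N) \<in> iso_rel A" if "M \<in> B" "N \<in> B" for M N
    using that B unfolding iso_rel_def by blast
  have ext: "iso_rel A `` (iso_rel B `` {M}) = iso_rel A `` {M}" if "M \<in> B" for M
  proof
    show "iso_rel A `` (iso_rel B `` {M}) \<subseteq> iso_rel A `` {M}"
    proof
      fix N assume "N \<in> iso_rel A `` (iso_rel B `` {M})"
      then obtain L where L: "(M, L) \<in> iso_rel B" "(L, N) \<in> iso_rel A" by blast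
      then have "(M, L) \<in> iso_rel A" using B unfolding iso_rel_def by blast
      then show "N \<in> iso_rel A `` {M}" using L(2) eqA unfolding equiv_def trans_def by blast
    qed
    have "(M, M) \<in> iso_rel B" using eqB that unfolding equiv_def refl_on_def by blast
    then show "iso_rel A `` {M} \<subseteq> iso_rel A `` (iso_rel B `` {M})" by blast
  qed
  show "(\<lambda>c. iso_rel A `` c) ` (B // iso_rel B) = {iso_rel A `` {M} |M. M \<in> B}"
    unfolding quotient_def using ext by auto
  show "inj_on (\<lambda>c. iso_rel A `` c) (B // iso_rel B)"
  proof (rule inj_onI)
    fix c c' assume c: "c \<in> B // iso_rel B" "c' \<in> B // iso_rel B" "iso_rel A `` c = iso_rel A `` c'"
    obtain M M' where M: "M \<in> B" "c = iso_rel B `` {M}" "M' \<in> B" "c' = iso_rel B `` {M'}"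
      using c(1,2) by (metis quotientE)
    then have "iso_rel A `` {M} = iso_rel A `` {M'}" using c(3) ext by metis
    then have "(M, M') \<in> iso_rel A" using eqA M B by (metis eq_equiv_class subsetD)
    then show "c = c'" using M sub equiv_class_eq[OF eqB] by metis
  qed
qed

lemma num_up_to_iso_mono:
  assumes A: "\<And>M. M \<in> A \<Longrightarrow> three_connected_triangulation M" and B: "B \<subseteq> A"
    and fin: "finite (A // iso_rel A)"
  shows "num_up_to_iso B \<le> num_up_to_iso A" "finite (B // iso_rel B)"
proof -
  have sub: "(\<lambda>c. iso_rel A `` c) ` (B // iso_rel B) \<subseteq> A // iso_rel A"
  proof -
    have "{iso_rel A `` {M} |M. M \<in> B} \<subseteq> A // iso_rel A" using B by (auto intro: quotientI)
    then show ?thesis using class_extension(2)[OF A B] by simp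
  qed
  show "num_up_to_iso B \<le> num_up_to_iso A"
    unfolding num_up_to_iso_eq using class_extension(1)[OF A B] sub fin by (rule card_inj_on_le)
  show "finite (B // iso_rel B)"
    by (rule finite_imageD[OF finite_subset[OF sub fin] class_extension(1)[OF A B]])
qed

lemma num_up_to_iso_Un_le:
  assumes A: "\<And>M. M \<in> A \<Longrightarrow> three_connected_triangulation M" and BC: "A = B \<union> C"
    and fin: "finite (A // iso_rel A)"
  shows "num_up_to_iso A \<le> num_up_to_iso B + num_up_to_iso C"
proof -
  let ?h = "\<lambda>c. iso_rel A `` c"
  have B: "B \<subseteq> A" and C: "C \<subseteq> A" using BC by auto
  have "A // iso_rel A = ?h ` (B // iso_rel B) \<union> ?h ` (C // iso_rel C)"
  proof -
    have "A // iso_rel A = {iso_rel A `` {M} |M. M \<in> A}"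
      unfolding quotient_def Setcompr_eq_image UNION_singleton_eq_range ..
    also have "\<dots> = {iso_rel A `` {M} |M. M \<in> B} \<union> {iso_rel A `` {M} |M. M \<in> C}"
      unfolding Setcompr_eq_image Collect_mem_eq BC image_Un ..
    also have "\<dots> = ?h ` (B // iso_rel B) \<union> ?h ` (C // iso_rel C)"
      using class_extension(2)[OF A B] class_extension(2)[OF A C] by simp
    finally show ?thesis .
  qed
  then have "card (A // iso_rel A) \<le> card (?h ` (B // iso_rel B)) + card (?h ` (C // iso_rel C))"
    by (metis card_Un_le)
  also have "\<dots> \<le> card (B // iso_rel B) + card (C // iso_rel C)"
    using num_up_to_iso_mono(2)[OF A B fin] num_up_to_iso_mono(2)[OF A C fin]
    by (intro add_mono card_image_le)
  finally show ?thesis unfolding num_up_to_iso_eq .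
qed

section \<open>Double wheels\<close>

text \<open>\<open>Rim i\<close> leads from rim vertex i to the next one, \<open>Up i\<close> and
  \<open>Down i\<close> from it to the two hubs; a prime marks the reverse dart.\<close>

datatype wheel_dart = Rim nat | Rim' nat | Up nat | Up' nat | Down nat | Down' nat

locale double_wheel =
  fixes n :: nat
  assumes n: "3 \<le> n"
begin

definition "s i = (if Suc i = n then 0 else Suc i)"
definition "p i = (if i = 0 then n - 1 else i - 1)"

lemma s_p: "i < n \<Longrightarrow> s i < n" "i < n \<Longrightarrow> p i < n" "i < n \<Longrightarrow> p (s i) = i" "i < n \<Longrightarrow> s (p i) = i"
  "i < n \<Longrightarrow> s i \<noteq> i" "i < n \<Longrightarrow> s (s i) \<noteq> i" "i < n \<Longrightarrow> j < n \<Longrightarrow> s i = s j \<longleftrightarrow> i = j"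
  using n by (auto simp: s_def p_def)

fun wopp where
  "wopp (Rim i) = Rim' i" | "wopp (Rim' i) = Rim i" | "wopp (Up i) = Up' i" | "wopp (Up' i) = Up i"
| "wopp (Down i) = Down' i" | "wopp (Down' i) = Down i"

text \<open>For i < n the faces are \<open>(Rim i, Down (s i), Down' i)\<close> and
  \<open>(Rim' i, Up i, Up' (s i))\<close>.\<close>

fun wface where
  "wface (Rim i) = Down (s i)" | "wface (Down i) = Down' (p i)" | "wface (Down' i) = Rim i"
| "wface (Rim' i) = Up i" | "wface (Up i) = Up' (s i)" | "wface (Up' i) = Rim' (p i)"

text \<open>The rim vertices are \<open>0, \<dots>, n - 1\<close>, the two hubs are \<open>n\<close> and \<open>n + 1\<close>.\<close>

fun lab where
  "lab (Rim i) = i" | "lab (Rim' i) = s i" | "lab (Up i) = i" | "lab (Up' i) = n" | "lab (Down i) = i"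
| "lab (Down' i) = n + 1"

fun pos where
  "pos (Rim i) = i" | "pos (Rim' i) = i" | "pos (Up i) = i" | "pos (Up' i) = i" | "pos (Down i) = i"
| "pos (Down' i) = i"

definition "W = {d. pos d < n}"

definition wheel :: "wheel_dart plane_map" where
  "wheel = \<lparr>darts = W, rot = (\<lambda>d. if d \<in> W then wface (wopp d) else d),
    opp = (\<lambda>d. if d \<in> W then wopp d else d), outer_face = {Rim 0, Down 1, Down' 0}, root_dart = Rim 0\<rparr>"

lemma W_closed: "d \<in> W \<Longrightarrow> wopp d \<in> W" "d \<in> W \<Longrightarrow> wface d \<in> W"
  unfolding W_def using s_p by (cases d; simp)+

lemma wopp_wopp: "wopp (wopp d) = d" "wopp d \<noteq> d"
  by (cases d; simp)+

lemma wface3: "d \<in> W \<Longrightarrow> wface (wface (wface d)) = d" "wface d \<noteq> d"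
  unfolding W_def using s_p by (cases d; simp)+

lemma W_eq: "W = Rim ` {..<n} \<union> (Rim' ` {..<n} \<union> (Up ` {..<n} \<union> (Up' ` {..<n} \<union> (Down ` {..<n} \<union> Down' ` {..<n}))))"
proof (rule set_eqI)
  fix d show "d \<in> W \<longleftrightarrow> d \<in> Rim ` {..<n} \<union> (Rim' ` {..<n} \<union> (Up ` {..<n} \<union> (Up' ` {..<n} \<union> (Down ` {..<n} \<union> Down' ` {..<n}))))"
    unfolding W_def by (cases d) auto
qed

lemma card_W: "finite W" "card W = 6 * n"
proof -
  show "finite W" unfolding W_eq by simp
  have i: "inj_on Rim {..<n}" "inj_on Rim' {..<n}" "inj_on Up {..<n}" "inj_on Up' {..<n}"
    "inj_on Down {..<n}" "inj_on Down' {..<n}" by (auto intro: inj_onI)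
  have d: "Rim ` {..<n} \<inter> (Rim' ` {..<n} \<union> (Up ` {..<n} \<union> (Up' ` {..<n} \<union> (Down ` {..<n} \<union> Down' ` {..<n})))) = {}"
    "Rim' ` {..<n} \<inter> (Up ` {..<n} \<union> (Up' ` {..<n} \<union> (Down ` {..<n} \<union> Down' ` {..<n}))) = {}"
    "Up ` {..<n} \<inter> (Up' ` {..<n} \<union> (Down ` {..<n} \<union> Down' ` {..<n})) = {}"
    "Up' ` {..<n} \<inter> (Down ` {..<n} \<union> Down' ` {..<n}) = {}" "Down ` {..<n} \<inter> Down' ` {..<n} = {}" by auto
  show "card W = 6 * n" unfolding W_eq
    by (simp add: card_Un_disjoint d card_image i)
qed

lemma opp_permutes: "opp wheel permutes W"
proof -
  have "bij_betw (\<lambda>d. if d \<in> W then wopp d else d) W W"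
    by (rule bij_betw_byWitness[where f' = wopp]) (use W_closed wopp_wopp in auto)
  then show ?thesis unfolding wheel_def by (auto intro: bij_imp_permutes)
qed

lemma rot_permutes: "rot wheel permutes W"
proof -
  have "bij_betw (\<lambda>d. if d \<in> W then wface (wopp d) else d) W W"
    \<comment> \<open>Since \<open>wface\<close> has order 3, its square is its inverse.\<close>
    by (rule bij_betw_byWitness[where f' = "\<lambda>d. wopp (wface (wface d))"])
      (use W_closed wopp_wopp wface3 in auto)
  then show ?thesis unfolding wheel_def by (auto intro: bij_imp_permutes)
qed

lemma face_wheel: "d \<in> W \<Longrightarrow> face_perm wheel d = wface d"
  unfolding face_perm_def wheel_def using W_closed wopp_wopp by simp

lemma rot_wheel: "d \<in> W \<Longrightarrow> rot wheel d = wface (wopp d)"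
  unfolding wheel_def by simp

lemma lab_rot: "d \<in> W \<Longrightarrow> lab (rot wheel d) = lab d"
  using s_p by (cases d) (simp_all add: rot_wheel, simp_all add: W_def)

lemma tail_step: "d \<in> W \<Longrightarrow> tail wheel (wface (wopp d)) = tail wheel d"
  unfolding rot_wheel[symmetric] tail_def using orbit_step_eq[OF rot_permutes card_W(1)] .

lemma tail_rim:
  assumes "i < n"
  shows "tail wheel (Up i) = tail wheel (Rim i)" "tail wheel (Down i) = tail wheel (Rim i)"
    "tail wheel (Rim' i) = tail wheel (Rim (s i))"
proof -
  have 1: "tail wheel (Down i) = tail wheel (Rim i)" if "i < n" for i
    using tail_step[of "Down i"] that by (simp add: W_def)
  then show "tail wheel (Down i) = tail wheel (Rim i)" using assms .
  show "tail wheel (Up i) = tail wheel (Rim i)" using tail_step[of "Rim i"] assms by (simp add: W_def)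
  show "tail wheel (Rim' i) = tail wheel (Rim (s i))"
    using tail_step[of "Rim' i"] 1[of "s i"] assms s_p by (simp add: W_def)
qed

lemma tail_hub: "i < n \<Longrightarrow> tail wheel (Up' i) = tail wheel (Up' 0)"
  "i < n \<Longrightarrow> tail wheel (Down' i) = tail wheel (Down' 0)"
proof (induction i)
  case (Suc i)
  {
    case 1
    then show ?case using tail_step[of "Up' i"] Suc.IH(1) by (simp add: W_def s_def)
  next
    case 2
    then show ?case using tail_step[of "Down' (Suc i)"] Suc.IH(2) by (simp add: W_def p_def)
  }
qed simp_all

text \<open>The rotation preserves labels; conversely, every dart belongs to the same vertex as a
  representative chosen for its label.\<close>

lemma tail_eq_iff:
  assumes "d \<in> W" "e \<in> W"
  shows "tail wheel d = tail wheel e \<longleftrightarrow> lab d = lab e"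
proof
  assume "tail wheel d = tail wheel e"
  then have "e \<in> orbit (rot wheel) d"
    using self_in_orbit[OF rot_permutes card_W(1)] unfolding tail_def by simp
  moreover have "orbit (rot wheel) d \<subseteq> {e\<in>W. lab e = lab d}"
    by (rule orbit_subset_closed) (use assms lab_rot W_closed rot_wheel in auto)
  ultimately show "lab d = lab e" by auto
next
  define rep where "rep i = (if i < n then Rim i else if i = n then Up' 0 else Down' 0)" for i
  have "tail wheel x = tail wheel (rep (lab x))" if "x \<in> W" for x
    using that tail_rim[of "pos x"] tail_hub[of "pos x"] s_p(1)[of "pos x"] unfolding W_def rep_def
    by (cases x) auto
  then show "lab d = lab e \<Longrightarrow> tail wheel d = tail wheel e" using assms by metis
qed

lemma card_vertices_wheel: "card (vertices wheel) = n + 2"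
proof -
  have "vertices wheel = tail wheel ` W" unfolding vertices_def tail_def by (simp add: wheel_def)
  also have "card \<dots> = card (lab ` W)"
    by (rule card_image_eq_if_same_kernel) (rule tail_eq_iff)
  also have "lab ` W = {..<n + 2}"
  proof
    show "lab ` W \<subseteq> {..<n + 2}"
    proof
      fix i assume "i \<in> lab ` W"
      then obtain d where "d \<in> W" "i = lab d" by blast
      then show "i \<in> {..<n + 2}" unfolding W_def using s_p(1)[of "pos d"] by (cases d) auto
    qed
    have "i \<in> lab ` W" if i: "i < n + 2" for i
    proof -
      consider "i < n" | "i = n" | "i = n + 1" using i by linarith
      then show ?thesis
      proof cases
        case 1
        then show ?thesis by (intro image_eqI[of _ _ "Rim i"]) (auto simp: W_def)
      next
        case 2
        then show ?thesis using n by (intro image_eqI[of _ _ "Up' 0"]) (auto simp: W_def)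
      next
        case 3
        then show ?thesis using n by (intro image_eqI[of _ _ "Down' 0"]) (auto simp: W_def)
      qed
    qed
    then show "{..<n + 2} \<subseteq> lab ` W" by blast
  qed
  finally show ?thesis by simp
qed

text \<open>An invariant set reaches some rim vertex, from there the upper hub and thus the entire
  rim; every edge has an end on the rim.\<close>

lemma cut_connected_wheel: "cut_connected wheel"
  unfolding cut_connected_def
proof (intro allI impI)
  fix X assume X: "X \<subseteq> darts wheel" "X \<noteq> {}" "\<forall>d\<in>X. rot wheel d \<in> X" "\<forall>d\<in>X. opp wheel d \<in> X"
  have XW: "X \<subseteq> W" using X(1) by (simp add: wheel_def)
  have opp: "wopp d \<in> X" if "d \<in> X" for d 
  proof -
    have "opp wheel d \<in> X" "d \<in> W" using X(4) that XW by blast+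
    then show ?thesis by (simp add: wheel_def)
  qed
  have same: "e \<in> X" if "d \<in> X" "e \<in> W" "lab e = lab d" for d e
  proof -
    have "e \<in> orbit (rot wheel) d"
      using tail_eq_iff[of e d] that XW self_in_orbit[OF rot_permutes card_W(1), of e] unfolding tail_def by auto
    moreover have "orbit (rot wheel) d \<subseteq> X" using orbit_subset_closed[of d X] that(1) X(3) by blast
    ultimately show ?thesis by blast
  qed
  have up: "Up i \<in> X" if "d \<in> X" "lab d = i" "i < n" for d i
    using same[OF that(1), of "Up i"] that by (simp add: W_def)
  obtain d where d: "d \<in> X" using X(2) by blast
  then have pos: "pos d < n" using XW unfolding W_def by blast
  have "\<exists>i<n. Up i \<in> X"
    using up[OF d, of "lab d"] up[OF opp[OF d], of "lab (wopp d)"] opp[OF d] pos s_p(1)[OF pos]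
    by (cases d) auto
  then obtain i where "i < n" "Up' i \<in> X" using opp by fastforce
  then have "Up' j \<in> X" if "j < n" for j using same[of "Up' i" "Up' j"] that by (simp add: W_def)
  then have U: "Up j \<in> X" if "j < n" for j using opp[of "Up' j"] that by simp
  have low: "e \<in> X" if "e \<in> W" "lab e < n" for e using same[OF U, of "lab e" e] that by simp
  have "e \<in> X" if "e \<in> W" for e
  proof -
    have "pos e < n" using that unfolding W_def by simp
    then have "lab e < n \<or> lab (wopp e) < n" using s_p(1) by (cases e) auto
    then show ?thesis using low[OF that] low[OF W_closed(1)[OF that]] opp[of "wopp e"] wopp_wopp by auto
  qed
  then show "X = darts wheel" using XW by (auto simp: wheel_def)
qed

lemma wheel_triangulation: "three_connected_triangulation wheel"
proof -
  have D: "darts wheel = W" "root_dart wheel = Rim 0" by (simp_all add: wheel_def)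
  have o: "opp wheel d = wopp d" if "d \<in> W" for d using that by (simp add: wheel_def)
  have h: "head wheel d = tail wheel (wopp d)" if "d \<in> W" for d unfolding head_def o[OF that] ..
  have R: "Rim 0 \<in> W" using n by (simp add: W_def)
  have loop: "lab d \<noteq> lab (wopp d)" if "d \<in> W" for d
    using that s_p(5)[of "pos d"] unfolding W_def by (cases d) auto
  have simple: "d = e" if "d \<in> W" "e \<in> W" "lab d = lab e" "lab (wopp d) = lab (wopp e)" for d e
    using that s_p(1,6,7)[of "pos d"] s_p(1,6,7)[of "pos e"] unfolding W_def
    by (cases d; cases e) auto
  have outer: "outer_face wheel = {Rim 0, face_perm wheel (Rim 0), face_perm wheel (face_perm wheel (Rim 0))}"
    using face_wheel[OF R] face_wheel[OF W_closed(2)[OF R]] s_p(3)[of 0] n by (auto simp: wheel_def s_def)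
  have faces: "face_perm wheel (face_perm wheel (face_perm wheel d)) = d \<and> face_perm wheel d \<noteq> d" if "d \<in> W" for d
    using that face_wheel W_closed(2) wface3 by simp
  show ?thesis
    unfolding three_connected_triangulation_iff D
  proof (intro conjI ballI impI)
    show "\<exists>d\<in>W. outer_face wheel = {d, face_perm wheel d, face_perm wheel (face_perm wheel d)}"
      using R outer by blast
    show "Rim 0 \<in> outer_face wheel \<or> opp wheel (Rim 0) \<in> outer_face wheel" using outer by blast
    fix d assume d: "d \<in> W"
    show "tail wheel d \<noteq> head wheel d" unfolding h[OF d] using loop tail_eq_iff d W_closed(1) by blast
    fix e assume e: "e \<in> W" "tail wheel d = tail wheel e" "head wheel d = head wheel e"
    show "d = e"
      by (rule simple) (use d e h tail_eq_iff W_closed(1) in auto)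
  qed (use card_W card_vertices_wheel cut_connected_wheel opp_permutes rot_permutes faces R o W_closed wopp_wopp in auto)
qed

end

lemma triangulation_exists:
  assumes "3 \<le> n"
  shows "\<exists>M :: wheel_dart plane_map. three_connected_triangulation M \<and> card (darts M) = 6 * n"
proof -
  interpret double_wheel n using assms by unfold_locales
  show ?thesis using wheel_triangulation card_W by (intro exI[of _ wheel]) (simp add: wheel_def)
qed

section \<open>The limit\<close>

lemma (in simple_triangulation) card_darts_faces: "card D = 3 * card (faces M)"
  unfolding faces_def
  by (rule card_of_constant_fibres[OF fin _ disjoint_orbits(2,1)[OF face_permutes fin]])
    (use face3 face_neq card_orbit_period_3[of \<phi>] in auto)

lemma interior_degree_3_in_Q:
  assumes M: "three_connected_triangulation M" and n: "card (faces M) = 2 * n" "3 \<le> n"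
    and "\<not> no_interior_degree_3 M"
  shows "M \<in> Q"
proof -
  interpret simple_triangulation M using M by unfold_locales
  obtain x where x: "x \<in> D" "card (tail M x) = 3" "tail M x \<inter> outer_face M = {}"
    using assms(4) unfolding no_interior_degree_3_def by blast
  \<comment> \<open>There are n + 2 vertices, so \<open>3 \<le> n\<close> provides the fifth
    one.\<close>
  interpret degree_3_vertex M x
    using x euler card_darts_faces n by unfold_locales auto
  show ?thesis by (rule in_Q)
qed

definition triangulations_with :: "nat \<Rightarrow> nat plane_map set" where
  "triangulations_with n = {M. three_connected_triangulation M \<and> card (faces M) = 2 * n}"

lemma triangulations_withD:
  assumes "M \<in> triangulations_with n"
  shows "three_connected_triangulation M" "simple_triangulation M" "card (darts M) = 6 * n"
proof -
  show M: "three_connected_triangulation M" using assms unfolding triangulations_with_def by blast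
  then show "simple_triangulation M" by unfold_locales
  then show "card (darts M) = 6 * n"
    using simple_triangulation.card_darts_faces assms unfolding triangulations_with_def by fastforce
qed

lemma triangulations_with_iff:
  "M \<in> triangulations_with n \<longleftrightarrow> three_connected_triangulation M \<and> card (darts M) = 6 * n"
proof
  assume M: "three_connected_triangulation M \<and> card (darts M) = 6 * n"
  then interpret simple_triangulation M by unfold_locales blast
  show "M \<in> triangulations_with n" unfolding triangulations_with_def using M card_darts_faces by simp
qed (use triangulations_withD in blast)

lemma triangulations_with_closed:
  assumes "M \<in> triangulations_with n" "iso_by f M N" "rot N permutes darts N" "opp N permutes darts N"
  shows "N \<in> triangulations_with n"
proof -
  interpret simple_triangulation M using triangulations_withD(2)[OF assms(1)] .
  have "card (darts N) = card D" using assms(2) bij_betw_same_card unfolding iso_by_def by metis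
  then show ?thesis
    using iso_triangulation[OF assms(2-4)] triangulations_withD(3)[OF assms(1)] triangulations_with_iff by simp
qed

lemma labelled_triangulations:
  "{M \<in> triangulations_with n. darts M = {..<6 * n}} = triangulations_on {..<6 * n}"
  unfolding triangulations_on_def using triangulations_with_iff[of _ n] by auto

abbreviation "rare_with n \<equiv> {M \<in> triangulations_with n. no_interior_degree_3 M}"

lemma t_eq: "t n = num_up_to_iso (triangulations_with n)"
  unfolding t_def triangulations_with_def ..

lemma fact_mult_t:
  "fact (6 * n) * t n = card (triangulations_on {..<6 * n})"
  "finite (triangulations_with n // iso_rel (triangulations_with n))"
proof -
  note * = num_up_to_iso_mult_fact[of "triangulations_with n" "6 * n",
    OF triangulations_withD(1) triangulations_withD(3) triangulations_with_closed]
  show "fact (6 * n) * t n = card (triangulations_on {..<6 * n})"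
    unfolding t_eq labelled_triangulations[symmetric] by (rule *(1))
  show "finite (triangulations_with n // iso_rel (triangulations_with n))" by (rule *(2))
qed

lemma fact_mult_rare:
  "fact (6 * n) * num_up_to_iso (rare_with n) =
    card {M \<in> triangulations_on {..<6 * n}. no_interior_degree_3 M}"
proof -
  have "fact (6 * n) * num_up_to_iso (rare_with n) = card {M \<in> rare_with n. darts M = {..<6 * n}}"
  proof (rule num_up_to_iso_mult_fact(1))
    fix M N :: "nat plane_map" and f
    assume *: "M \<in> rare_with n" "iso_by f M N" "rot N permutes darts N" "opp N permutes darts N"
    then interpret simple_triangulation M using triangulations_withD(2) by blast
    show "N \<in> rare_with n"
      using * triangulations_with_closed iso_no_interior_degree_3[OF *(2-4)] by blast
  qed (use triangulations_withD in auto)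
  also have "{M \<in> rare_with n. darts M = {..<6 * n}} = {M \<in> triangulations_on {..<6 * n}. no_interior_degree_3 M}"
    using labelled_triangulations[of n] by auto
  finally show ?thesis .
qed

lemma rare_le:
  assumes "2 \<le> n"
  shows "(n - 2) * num_up_to_iso (rare_with n) \<le> 2 * (\<Sum>d\<in>{1..8}. 2 ^ d * (9 + 12 * d)) * t n"
proof -
  let ?K = "2 * (\<Sum>d\<in>{1..8 :: nat}. 2 ^ d * (9 + 12 * d))" and ?r = "num_up_to_iso (rare_with n)"
  have "(n - 2) * (fact (6 * n) * ?r) \<le> ?K * (fact (6 * n) * t n)"
    unfolding fact_mult_rare fact_mult_t(1)
    by (rule no_interior_degree_3_rare) (use assms in auto)
  then have "fact (6 * n) * ((n - 2) * ?r) \<le> fact (6 * n) * (?K * t n)"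
    by (simp only: mult.left_commute)
  moreover have "(0 :: nat) < fact (6 * n)" by simp
  ultimately show ?thesis using mult_le_cancel1 by blast
qed

lemma q_bounds:
  assumes "3 \<le> n"
  shows "q n \<le> t n" "t n \<le> q n + num_up_to_iso (rare_with n)"
proof -
  let ?A = "triangulations_with n" and ?B = "{M :: nat plane_map. M \<in> Q \<and> card (faces M) = 2 * n}"
  have BA: "?B \<subseteq> ?A" unfolding triangulations_with_def Q_def by blast
  have A: "\<And>M. M \<in> ?A \<Longrightarrow> three_connected_triangulation M" by (rule triangulations_withD(1))
  show "q n \<le> t n"
    unfolding q_def t_eq by (rule num_up_to_iso_mono(1)[OF A BA fact_mult_t(2)])
  have "?A = ?B \<union> rare_with n"
    using BA interior_degree_3_in_Q[OF _ _ assms] unfolding triangulations_with_def by blast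
  then show "t n \<le> q n + num_up_to_iso (rare_with n)"
    unfolding q_def t_eq by (intro num_up_to_iso_Un_le A fact_mult_t(2))
qed

text \<open>Keeps the quotient in the theorem from being the default value of a division by
  0.\<close>

lemma t_pos:
  assumes "3 \<le> n"
  shows "0 < t n"
proof -
  obtain M :: "wheel_dart plane_map" where M: "three_connected_triangulation M" "card (darts M) = 6 * n"
    using triangulation_exists[OF assms] by blast
  interpret simple_triangulation M using M by unfold_locales
  obtain f where f: "bij_betw f D {..<6 * n}"
    using finite_same_card_bij[OF fin, of "{..<6 * n}"] M(2) by auto
  have inj: "inj_on f D" using f bij_betw_def by blast
  have "relabel f M \<in> triangulations_on {..<6 * n}"
    unfolding triangulations_on_def using iso_triangulation[OF relabel_iso(1-3)[OF inj]]
      relabel_iso(4)[OF inj] bij_betw_imp_surj_on[OF f] by simp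
  moreover have "finite (triangulations_on {..<6 * n})" by (rule finite_triangulations_on) simp
  ultimately have "card (triangulations_on {..<6 * n}) \<noteq> 0" by auto
  then show ?thesis using fact_mult_t(1)[of n] by (metis gr0I mult_0_right)
qed

theorem theorem9:
  shows "\<exists>c::real. c > 0 \<and> (\<lambda>n. real (q n) / real (t n)) \<longlonglongrightarrow> c"
proof -
  define K :: nat where "K = 2 * (\<Sum>d\<in>{1..8}. 2 ^ d * (9 + 12 * d))"
  \<comment> \<open>\<open>t n\<close> exceeds \<open>q n\<close> by at most the number of rare
    maps, which is at most \<open>K * t n / (n - 2)\<close>.\<close>
  have lower: "1 - real K / (real n - 2) \<le> real (q n) / real (t n)" if n: "3 \<le> n" for n
  proof -
    let ?r = "num_up_to_iso (rare_with n)"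
    have tp: "0 < real (t n)" using t_pos[OF n] by simp
    have "(n - 2) * ?r \<le> K * t n" unfolding K_def using n by (intro rare_le) simp
    then have "real (n - 2) * real ?r \<le> real K * real (t n)" by (metis of_nat_le_iff of_nat_mult)
    then have "(real n - 2) * real ?r \<le> real K * real (t n)" using n by (simp add: of_nat_diff)
    then have "real ?r / real (t n) \<le> real K / (real n - 2)"
      using n tp by (simp add: field_simps)
    moreover have "1 \<le> (real (q n) + real ?r) / real (t n)"
      using q_bounds(2)[OF n] tp by simp
    ultimately show ?thesis by (simp add: add_divide_distrib)
  qed
  have upper: "real (q n) / real (t n) \<le> 1" if n: "3 \<le> n" for n
    using q_bounds(1)[OF n] t_pos[OF n] by simp
  have "(\<lambda>n. real n - 2) = (\<lambda>n. -2 + real n)" by auto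
  then have "filterlim (\<lambda>n. real n - 2) at_top sequentially"
    using filterlim_tendsto_add_at_top[OF tendsto_const filterlim_real_sequentially, of "-2"] by simp
  then have "(\<lambda>n. real K / (real n - 2)) \<longlonglongrightarrow> 0"
    by (rule real_tendsto_divide_at_top[OF tendsto_const])
  then have lim: "(\<lambda>n. 1 - real K / (real n - 2)) \<longlonglongrightarrow> 1"
    using tendsto_diff[OF tendsto_const, of _ 0 sequentially 1] by simp
  have "(\<lambda>n. real (q n) / real (t n)) \<longlonglongrightarrow> 1"
    by (rule tendsto_sandwich[OF _ _ lim tendsto_const])
      (use lower upper in \<open>auto intro: eventually_sequentiallyI[of 3]\<close>)
  then show ?thesis by (intro exI[of _ 1]) simp
qed

end
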